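(* Let $n\ge1$. Every normalized basic sequence in $\mathfrak Z_n$ admits a subsequence equivalent to the canonical basis of one of the Orlicz sequence spaces $\ell_{f_k}$, $1\le k\le n$, where $f_k(t)=t^2\log^{2(k-1)}t$.
   Context: Let $\mathbb S=\{z\in\mathbb C:0<\mathrm{Re}\,z<1\}$ and let $\mathcal C$ be the Calderón space of the pair $(\ell_\infty,\ell_1)$: bounded continuous functions $f:\overline{\mathbb S}\to\ell_\infty$, holomorphic on $\mathbb S$, with $f(1+it)\in\ell_1$ for all real $t$ and $\|f\|_{\mathcal C}=\max(\sup_t\|f(it)\|_\infty,\sup_t\|f(1+it)\|_1)<\infty$. For $n\ge1$ the Rochberg space $\mathfrak Z_n$ is the space of arrays $(x_{n-1},\dots,x_0)\in\ell_\infty^n$ for which there is $f\in\mathcal C$ with $x_j=f^{(j)}(1/2)/j!$ for $0\le j\le n-1$, normed by the infimum of $\|f\|_{\mathcal C}$ over such $f$ ($\mathfrak Z_1=\ell_2$, $\mathfrak Z_2$ is the Kalton–Peck space). For a function $f$ which near $0$ agrees with an Orlicz function, $\ell_f$ is the Orlicz sequence space of scalar sequences $(a_i)$ with $\sum_i f(|a_i|/\rho)<\infty$ for some $\rho>0$, with the Luxemburg norm; its canonical basis is the unit vector sequence. Two basic sequences $(x_i),(y_i)$ are equivalent if for all scalars $(a_i)$, $\sum a_ix_i$ converges iff $\sum a_iy_i$ converges. *)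

theory Defs
  imports "HOL-Analysis.Analysis"
begin

type_synonym cseq = "nat \<Rightarrow> complex"

definition linf_bdd :: "cseq \<Rightarrow> bool" where
  "linf_bdd x \<longleftrightarrow> bdd_above (range (\<lambda>k. cmod (x k)))"

definition linf_norm :: "cseq \<Rightarrow> real" where
  "linf_norm x = (SUP k. cmod (x k))"

definition in_l1 :: "cseq \<Rightarrow> bool" where
  "in_l1 x \<longleftrightarrow> summable (\<lambda>k. cmod (x k))"

definition l1_norm :: "cseq \<Rightarrow> real" where
  "l1_norm x = (\<Sum>k. cmod (x k))"

definition strip :: "complex set" where
  "strip = {z. 0 < Re z \<and> Re z < 1}"

definition cl_strip :: "complex set" where
  "cl_strip = {z. 0 \<le> Re z \<and> Re z \<le> 1}"

definition linf_has_deriv :: "(complex \<Rightarrow> cseq) \<Rightarrow> cseq \<Rightarrow> complex \<Rightarrow> bool" where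
  "linf_has_deriv f v z \<longleftrightarrow> linf_bdd v \<and>
     ((\<lambda>w. linf_norm (\<lambda>k. (f w k - f z k) / (w - z) - v k)) \<longlongrightarrow> 0) (at z)"

definition linf_holomorphic_on :: "(complex \<Rightarrow> cseq) \<Rightarrow> complex set \<Rightarrow> bool" where
  "linf_holomorphic_on f S \<longleftrightarrow> (\<forall>z\<in>S. \<exists>v. linf_has_deriv f v z)"

definition lderiv :: "(complex \<Rightarrow> cseq) \<Rightarrow> complex \<Rightarrow> cseq" where
  "lderiv f = (\<lambda>z. SOME v. linf_has_deriv f v z)"

definition taylor_coeff :: "(complex \<Rightarrow> cseq) \<Rightarrow> nat \<Rightarrow> cseq" where
  "taylor_coeff f j = (\<lambda>k. ((lderiv ^^ j) f (1/2) k) / of_nat (fact j))"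

definition calderon :: "(complex \<Rightarrow> cseq) \<Rightarrow> bool" where
  "calderon f \<longleftrightarrow>
     (\<forall>z\<in>cl_strip. linf_bdd (f z)) \<and>
     bdd_above ((\<lambda>z. linf_norm (f z)) ` cl_strip) \<and>
     (\<forall>z\<in>cl_strip. ((\<lambda>w. linf_norm (\<lambda>k. f w k - f z k)) \<longlongrightarrow> 0) (at z within cl_strip)) \<and>
     linf_holomorphic_on f strip \<and>
     (\<forall>t::real. in_l1 (f (1 + \<i> * of_real t))) \<and>
     bdd_above (range (\<lambda>t::real. linf_norm (f (\<i> * of_real t)))) \<and>
     bdd_above (range (\<lambda>t::real. l1_norm (f (1 + \<i> * of_real t))))"

definition cal_norm :: "(complex \<Rightarrow> cseq) \<Rightarrow> real" where
  "cal_norm f = max (SUP t::real. linf_norm (f (\<i> * of_real t)))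
                    (SUP t::real. l1_norm (f (1 + \<i> * of_real t)))"

text \<open>An element of Z_n is an array x with x j in l_infinity for j < n
  (x j = 0 for j >= n, a canonical representative).\<close>
type_synonym zelem = "nat \<Rightarrow> cseq"

definition represents :: "nat \<Rightarrow> (complex \<Rightarrow> cseq) \<Rightarrow> zelem \<Rightarrow> bool" where
  "represents n f x \<longleftrightarrow> calderon f \<and> (\<forall>j<n. x j = taylor_coeff f j)"

definition zn :: "nat \<Rightarrow> zelem set" where
  "zn n = {x. (\<forall>j\<ge>n. x j = (\<lambda>_. 0)) \<and> (\<exists>f. represents n f x)}"

definition zn_norm :: "nat \<Rightarrow> zelem \<Rightarrow> real" where
  "zn_norm n x = Inf {cal_norm f | f. represents n f x}"

definition zdiff :: "zelem \<Rightarrow> zelem \<Rightarrow> zelem" where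
  "zdiff x y = (\<lambda>j k. x j k - y j k)"

definition zpsum :: "(nat \<Rightarrow> zelem) \<Rightarrow> (nat \<Rightarrow> complex) \<Rightarrow> nat \<Rightarrow> zelem" where
  "zpsum x a m = (\<lambda>j k. \<Sum>i\<le>m. a i * x i j k)"

definition zseries_conv :: "nat \<Rightarrow> (nat \<Rightarrow> zelem) \<Rightarrow> (nat \<Rightarrow> complex) \<Rightarrow> bool" where
  "zseries_conv n x a \<longleftrightarrow>
     (\<exists>y\<in>zn n. (\<lambda>m. zn_norm n (zdiff y (zpsum x a m))) \<longlonglongrightarrow> 0)"

definition zclspan :: "nat \<Rightarrow> (nat \<Rightarrow> zelem) \<Rightarrow> zelem set" where
  "zclspan n x = {y\<in>zn n. \<forall>e>0. \<exists>c m. zn_norm n (zdiff y (zpsum x c m)) < e}"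

definition basic_seq :: "nat \<Rightarrow> (nat \<Rightarrow> zelem) \<Rightarrow> bool" where
  "basic_seq n x \<longleftrightarrow> (\<forall>i. x i \<in> zn n) \<and>
     (\<forall>y\<in>zclspan n x. \<exists>!a. (\<lambda>m. zn_norm n (zdiff y (zpsum x a m))) \<longlonglongrightarrow> 0)"

definition orlicz_fun :: "(real \<Rightarrow> real) \<Rightarrow> bool" where
  "orlicz_fun M \<longleftrightarrow> continuous_on {0..} M \<and> mono_on {0..} M \<and> convex_on {0..} M \<and>
     M 0 = 0 \<and> filterlim M at_top at_top"

definition in_orlicz :: "(real \<Rightarrow> real) \<Rightarrow> cseq \<Rightarrow> bool" where
  "in_orlicz M a \<longleftrightarrow> (\<exists>\<rho>>0. summable (\<lambda>i. M (cmod (a i) / \<rho>)))"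

definition lux_norm :: "(real \<Rightarrow> real) \<Rightarrow> cseq \<Rightarrow> real" where
  "lux_norm M a = Inf {\<rho>. \<rho> > 0 \<and> summable (\<lambda>i. M (cmod (a i) / \<rho>)) \<and>
                          (\<Sum>i. M (cmod (a i) / \<rho>)) \<le> 1}"

definition orlicz_series_conv :: "(real \<Rightarrow> real) \<Rightarrow> (nat \<Rightarrow> complex) \<Rightarrow> bool" where
  "orlicz_series_conv M a \<longleftrightarrow>
     (\<exists>b. in_orlicz M b \<and>
        (\<lambda>m. lux_norm M (\<lambda>i. b i - (if i \<le> m then a i else 0))) \<longlonglongrightarrow> 0)"

definition fk :: "nat \<Rightarrow> real \<Rightarrow> real" where
  "fk k t = t\<^sup>2 * (ln t) ^ (2 * (k - 1))"

text \<open>(x_i) equivalent to the unit vector basis of l_f, f agreeing near 0 with an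
  Orlicz function: l_f is realised via any Orlicz function M agreeing with f on [0,d].\<close>
definition equiv_orlicz_basis :: "nat \<Rightarrow> (nat \<Rightarrow> zelem) \<Rightarrow> (real \<Rightarrow> real) \<Rightarrow> bool" where
  "equiv_orlicz_basis n x f \<longleftrightarrow>
     (\<forall>M d. orlicz_fun M \<and> d > 0 \<and> (\<forall>t. 0 \<le> t \<and> t \<le> d \<longrightarrow> M t = f t) \<longrightarrow>
        (\<forall>a. zseries_conv n x a \<longleftrightarrow> orlicz_series_conv M a))"

end

theory Submission
  imports Defs "HOL-Complex_Analysis.Complex_Analysis" "HOL-Library.Function_Algebras"
begin

text \<open>
  Restricting a representing function to a set of coordinates is a contraction, so the coordinates give a
  decomposition of the Rochberg space into finite-dimensional pieces, and up to small perturbations one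
  deals with blocks \<open>g\<^sub>i\<close> of disjoint finite supports. Subtracting from a block whose leading Taylor
  coefficient has small \<open>\<ell>\<^sub>2\<close> norm the extremal function of that coefficient, one may assume that the
  Taylor coefficients of order \<open>< m\<close> vanish and that those of order \<open>m\<close> are bounded below in \<open>\<ell>\<^sub>2\<close>.
  Such blocks are equivalent to the basis of \<open>\<ell>\<^sub>f\<close> with \<open>f = f\<^bsub>n-m\<^esub>\<close>. For the upper estimate one
  multiplies the blocks by scalar functions \<open>b\<^sub>i\<close> with \<open>b\<^sub>i = a\<^sub>i\<close> to order \<open>n - m\<close> at \<open>1/2\<close>, of
  modulus \<open>O(1)\<close> on \<open>Re z = 0\<close> and \<open>O(f(|a\<^sub>i|))\<close> on \<open>Re z = 1\<close>. For the lower estimate one pairs \<open>F(z)\<close> with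
  \<open>G(1 - z)\<close>, where \<open>G\<close> combines extremal functions of the leading coefficients with factors
  \<open>\<tau>\<^sub>i^(2z)\<close>, \<open>\<tau>\<^sub>i = |a\<^sub>i| ln^(n-m-1) (1/|a\<^sub>i|)\<close>, and reads off the Taylor coefficient of order \<open>n - 1\<close>.

  The lower estimate makes the decomposition boundedly complete, so a subsequence of the given sequence
  converges coordinatewise to an element \<open>y\<close> of the space; by the upper estimate Cesaro means of a further
  subsequence converge to \<open>y\<close> in norm, and continuity of the coordinate functionals of a basic sequence
  forces \<open>y = 0\<close>.
\<close>

subsection \<open>Holomorphic functions on the strip\<close>

text \<open>The logarithms come from the jets. To multiply a block by \<open>a\<close> one wants a
  scalar factor with value \<open>a\<close> and vanishing derivatives up to order
  \<open>n - m - 1\<close> at \<open>1/2\<close>. The natural candidate \<open>|a|^(2z)\<close>, up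
  to phase, has derivatives involving powers of \<open>L = ln (1/|a|)\<close>, and cancelling them
  costs a factor \<open>L^(n-m-1)\<close> on both boundary lines. Shifting the exponent moves the
  whole cost to \<open>Re z = 1\<close>, where \<open>|a|^2\<close> becomes
  \<open>|a|^2 L^(2(n-m-1))\<close>. The weights in the test function of the lower estimate are the
  square roots of this quantity, so the two estimates meet in the same function. Two features of the
  definitions shape the argument. The norm is an infimum that need not be attained, so estimates are
  carried by individual representing functions. A basic sequence is only known to have unique
  expansions; a bound on partial sums, or continuity of the coordinate functionals, has to be won by
  a category argument.\<close>

lemma open_strip: "open strip"
proof -
  have "strip = {z. 0 < Re z} \<inter> {z. Re z < 1}" by (auto simp: strip_def)
  thus ?thesis using open_halfspace_Re_gt[of 0] open_halfspace_Re_lt[of 1] by (metis open_Int)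
qed

lemma strip_subset: "strip \<subseteq> cl_strip" and half_in_strip: "1/2 \<in> strip"
  by (auto simp: strip_def cl_strip_def)

lemma cball_half_subset: "r < 1/2 \<Longrightarrow> cball (1/2) r \<subseteq> strip"
proof
  fix z :: complex assume r: "r < 1/2" and "z \<in> cball (1/2) r"
  hence "cmod (1/2 - z) < 1/2" by (auto simp: dist_norm)
  hence "\<bar>Re (1/2 - z)\<bar> < 1/2" using abs_Re_le_cmod[of "1/2 - z"] by linarith
  thus "z \<in> strip" unfolding strip_def abs_less_iff by simp
qed

text \<open>The factor \<open>exp (e (z^2 - 1))\<close> has modulus at most 1 on the strip, because
  \<open>(Re z)^2 \<le> 1\<close>, and decays like \<open>exp (-e (Im z)^2)\<close>, so the maximum
  modulus principle on a tall enough rectangle suffices. Positivity of \<open>M\<close> lets the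
  decaying bound \<open>B exp (-e R^2)\<close> fall below it.\<close>

lemma strip_max_aux:
  fixes f :: "complex \<Rightarrow> complex"
  assumes cont: "continuous_on cl_strip f" and hol: "f holomorphic_on strip"
    and bd: "\<And>z. z \<in> cl_strip \<Longrightarrow> cmod (f z) \<le> B"
    and M: "\<And>z. Re z = 0 \<or> Re z = 1 \<Longrightarrow> cmod (f z) \<le> M" and "M > 0"
    and z0: "z0 \<in> cl_strip" and e: "e > 0"
  shows "cmod (f z0 * exp (of_real e * (z0\<^sup>2 - 1))) \<le> M"
proof -
  let ?g = "\<lambda>z. f z * exp (of_real e * (z\<^sup>2 - 1))"
  have nrm: "cmod (?g z) = cmod (f z) * exp (e * ((Re z)\<^sup>2 - (Im z)\<^sup>2 - 1))" for z
    by (simp add: norm_mult norm_exp_eq_Re Re_power2)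
  have "B \<ge> 0" using bd[OF z0] norm_ge_zero order_trans by blast
  have "((\<lambda>R. B * exp (- (e * R\<^sup>2))) \<longlongrightarrow> B * 0) at_top"
  proof (rule tendsto_mult_left)
    have "filterlim (\<lambda>R::real. e * R\<^sup>2) at_top at_top"
      using e by (intro filterlim_tendsto_pos_mult_at_top[OF tendsto_const]) (auto intro!: filterlim_pow_at_top filterlim_ident)
    thus "((\<lambda>R. exp (- (e * R\<^sup>2))) \<longlongrightarrow> 0) at_top"
      by (intro filterlim_compose[OF exp_at_bot]) (simp add: filterlim_uminus_at_bot)
  qed
  hence "eventually (\<lambda>R. B * exp (- (e * R\<^sup>2)) < M) at_top"
    using \<open>M > 0\<close> by (intro order_tendstoD(2)) auto
  moreover have "eventually (\<lambda>R. R \<ge> \<bar>Im z0\<bar> + 1) at_top" by (rule eventually_ge_at_top)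
  ultimately have "eventually (\<lambda>R. B * exp (- (e * R\<^sup>2)) < M \<and> R \<ge> \<bar>Im z0\<bar> + 1) at_top"
    by (rule eventually_conj)
  then obtain R where R: "B * exp (- (e * R\<^sup>2)) < M" "R \<ge> \<bar>Im z0\<bar> + 1"
    using eventually_happens'[OF trivial_limit_at_top_linorder] by blast
  define S where "S = cbox (Complex 0 (-R)) (Complex 1 R)"
  have S: "S = {z. 0 \<le> Re z \<and> Re z \<le> 1 \<and> -R \<le> Im z \<and> Im z \<le> R}"
    unfolding S_def by (auto simp: in_cbox_complex_iff)
  have inner_box: "interior S = {z. 0 < Re z \<and> Re z < 1 \<and> -R < Im z \<and> Im z < R}"
    unfolding S_def interior_cbox by (auto simp: in_box_complex_iff)
  have sub: "S \<subseteq> cl_strip" "interior S \<subseteq> strip"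
    unfolding inner_box by (auto simp: S cl_strip_def strip_def)
  have clS: "closure S = S" by (simp add: S_def)
  show ?thesis
  proof (rule maximum_modulus_frontier[of ?g S M])
    show "?g holomorphic_on interior S"
      by (intro holomorphic_intros holomorphic_on_subset[OF hol] sub)
    show "continuous_on (closure S) ?g" unfolding clS
      by (intro continuous_intros continuous_on_subset[OF cont] sub)
    show "bounded S" by (simp add: S_def)
    show "z0 \<in> S" using z0 R by (auto simp: S cl_strip_def)
  next
    fix z assume "z \<in> frontier S"
    hence z: "z \<in> S" "z \<notin> interior S" by (auto simp: frontier_def clS)
    have x1: "(Re z)\<^sup>2 \<le> 1" using z by (auto simp: S power_le_one)
    have "0 \<le> Re z \<and> Re z \<le> 1 \<and> -R \<le> Im z \<and> Im z \<le> R" using z(1) by (simp add: S)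
    moreover have "\<not> (0 < Re z \<and> Re z < 1 \<and> -R < Im z \<and> Im z < R)" using z(2) by (simp only: inner_box) simp
    ultimately consider "Re z = 0 \<or> Re z = 1" | "\<bar>Im z\<bar> = R" by argo
    thus "cmod (?g z) \<le> M"
    proof cases
      case 1
      have "(Re z)\<^sup>2 - (Im z)\<^sup>2 - 1 \<le> 0" using x1 zero_le_power2[of "Im z"] by linarith
      hence "exp (e * ((Re z)\<^sup>2 - (Im z)\<^sup>2 - 1)) \<le> 1" using e by (simp add: mult_le_0_iff)
      hence "cmod (?g z) \<le> cmod (f z) * 1" unfolding nrm by (intro mult_left_mono) auto
      thus ?thesis using M[OF 1] by simp
    next
      case 2
      hence i: "(Im z)\<^sup>2 = R\<^sup>2" by (metis power2_abs)
      have "e * ((Re z)\<^sup>2 - (Im z)\<^sup>2 - 1) \<le> e * (- R\<^sup>2)" using x1 i e by (intro mult_left_mono) auto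
      hence "exp (e * ((Re z)\<^sup>2 - (Im z)\<^sup>2 - 1)) \<le> exp (- (e * R\<^sup>2))" by simp
      hence "cmod (?g z) \<le> B * exp (- (e * R\<^sup>2))" unfolding nrm
        using bd[of z] z sub \<open>B \<ge> 0\<close> by (intro mult_mono) auto
      thus ?thesis using R by simp
    qed
  qed
qed

text \<open>The parameter \<open>e\<close> of the damped estimate tends to 0; the slack
  \<open>d\<close> covers the case \<open>M = 0\<close>.\<close>

lemma strip_maximum_principle:
  fixes f :: "complex \<Rightarrow> complex"
  assumes cont: "continuous_on cl_strip f" and hol: "f holomorphic_on strip"
    and bd: "\<And>z. z \<in> cl_strip \<Longrightarrow> cmod (f z) \<le> B"
    and M: "\<And>z. Re z = 0 \<or> Re z = 1 \<Longrightarrow> cmod (f z) \<le> M"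
    and z0: "z0 \<in> cl_strip"
  shows "cmod (f z0) \<le> M"
proof (rule field_le_epsilon)
  fix d :: real assume d: "d > 0"
  have "0 \<le> M" by (rule order_trans[OF norm_ge_zero M[of 0]]) simp
  hence pos: "M + d > 0" using d by simp
  have "((\<lambda>e. cmod (f z0 * exp (of_real e * (z0\<^sup>2 - 1)))) \<longlongrightarrow> cmod (f z0 * exp (of_real 0 * (z0\<^sup>2 - 1)))) (at_right 0)"
    by (intro tendsto_intros)
  moreover have "eventually (\<lambda>e. cmod (f z0 * exp (of_real e * (z0\<^sup>2 - 1))) \<le> M + d) (at_right 0)"
    using eventually_at_right_less[of "0::real"]
  proof eventually_elim
    case (elim e)
    show ?case
    proof (rule strip_max_aux[OF cont hol bd _ pos z0 elim])
      fix z assume "Re z = 0 \<or> Re z = 1"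
      from M[OF this] d show "cmod (f z) \<le> M + d" by linarith
    qed
  qed
  ultimately have "cmod (f z0 * exp (of_real 0 * (z0\<^sup>2 - 1))) \<le> M + d"
    by (rule tendsto_upperbound) auto
  thus "cmod (f z0) \<le> M + d" by simp
qed

section \<open>Taylor coefficients at 1/2 of scalar functions\<close>

definition tc :: "(complex \<Rightarrow> complex) \<Rightarrow> nat \<Rightarrow> complex" where
  "tc g j = (deriv ^^ j) g (1/2) / fact j"

abbreviation jet :: "(complex \<Rightarrow> cseq) \<Rightarrow> zelem" where
  "jet f j k \<equiv> tc (\<lambda>z. f z k) j"

text \<open>Cauchy's inequality on the circle of radius 1/4 around \<open>1/2\<close>; any radius
  below 1/2 would serve, and 4 is the reciprocal of the one chosen.\<close>

lemma tc_bound: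
  assumes "g holomorphic_on strip" and "\<And>z. z \<in> strip \<Longrightarrow> cmod (g z) \<le> B"
  shows "cmod (tc g j) \<le> B * 4 ^ j"
proof -
  have sub: "cball (1/2) (1/4) \<subseteq> strip" by (rule cball_half_subset) simp
  have "cmod ((deriv ^^ j) g (1/2)) \<le> fact j * B / (1/4) ^ j"
  proof (rule Cauchy_inequality)
    show "g holomorphic_on ball (1/2) (1/4)"
      using assms(1) sub holomorphic_on_subset ball_subset_cball by blast
    show "continuous_on (cball (1/2) (1/4)) g"
      using assms(1) sub holomorphic_on_imp_continuous_on holomorphic_on_subset by blast
    fix x :: complex assume "norm (1/2 - x) = 1/4"
    hence "x \<in> strip" using sub by (auto simp: dist_norm subset_iff)
    thus "cmod (g x) \<le> B" by (rule assms)
  qed auto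
  thus ?thesis by (simp add: tc_def norm_divide field_simps power_divide)
qed

text \<open>Reading the coefficients as a formal power series turns sums and products of functions
  into operations on series.\<close>

lemma has_fps_expansion_tc:
  assumes "g holomorphic_on strip"
  shows "(\<lambda>x. g (1/2 + x)) has_fps_expansion Abs_fps (tc g)"
proof -
  have "g analytic_on {1/2}"
    using assms open_strip half_in_strip by (meson analytic_at)
  from analytic_at_imp_has_fps_expansion[OF this]
  show ?thesis by (simp add: fps_expansion_def tc_def[abs_def])
qed

lemma tc_eqI:
  assumes "(\<lambda>x. g (1/2 + x)) has_fps_expansion F"
  shows "tc g j = fps_nth F j"
proof -
  have "fps_nth F j = (deriv ^^ j) (\<lambda>x. g (1/2 + x)) 0 / fact j"
    using fps_nth_fps_expansion[OF assms] by simp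
  also have "(deriv ^^ j) (\<lambda>x. g (1/2 + x)) 0 = (deriv ^^ j) g (1/2)"
    by (simp add: higher_deriv_shift_0' add.commute o_def)
  finally show ?thesis by (simp add: tc_def)
qed

lemma tc_add:
  assumes "f holomorphic_on strip" "g holomorphic_on strip"
  shows "tc (\<lambda>z. f z + g z) j = tc f j + tc g j"
  using tc_eqI[OF has_fps_expansion_add[OF has_fps_expansion_tc[OF assms(1)] has_fps_expansion_tc[OF assms(2)]]]
  by simp

lemma tc_diff:
  assumes "f holomorphic_on strip" "g holomorphic_on strip"
  shows "tc (\<lambda>z. f z - g z) j = tc f j - tc g j"
  using tc_eqI[OF has_fps_expansion_diff[OF has_fps_expansion_tc[OF assms(1)] has_fps_expansion_tc[OF assms(2)]]]
  by simp

lemma tc_mult: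
  assumes "f holomorphic_on strip" "g holomorphic_on strip"
  shows "tc (\<lambda>z. f z * g z) j = (\<Sum>i=0..j. tc f i * tc g (j - i))"
  using tc_eqI[OF has_fps_expansion_mult[OF has_fps_expansion_tc[OF assms(1)] has_fps_expansion_tc[OF assms(2)]]]
  by (simp add: fps_mult_nth)

lemma tc_const: "tc (\<lambda>z. c) j = (if j = 0 then c else 0)"
  using tc_eqI[OF has_fps_expansion_const] by simp

lemma tc_zero [simp]: "tc (\<lambda>z. 0) j = 0"
  by (simp add: tc_const)

lemma tc_cmult:
  assumes "f holomorphic_on strip"
  shows "tc (\<lambda>z. c * f z) j = c * tc f j"
  using tc_eqI[OF has_fps_expansion_cmult_left[OF has_fps_expansion_tc[OF assms(1)]]]
  by simp

lemma tc_sum: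
  assumes "\<And>i. i \<in> I \<Longrightarrow> f i holomorphic_on strip"
  shows "tc (\<lambda>z. \<Sum>i\<in>I. f i z) j = (\<Sum>i\<in>I. tc (f i) j)"
  using assms
proof (induction I rule: infinite_finite_induct)
  case (insert x I)
  have "(\<lambda>z. \<Sum>i\<in>I. f i z) holomorphic_on strip"
    using insert by (intro holomorphic_intros) auto
  thus ?case using insert by (simp add: tc_add)
qed auto

lemma tc_0: "tc f 0 = f (1/2)"
  by (simp add: tc_def)

text \<open>\<open>2 z - 1\<close> vanishes at \<open>1/2\<close> and has real part -1 and 1 on the
  two boundary lines. For real \<open>c\<close> this exponential therefore has value 1 at
  \<open>1/2\<close> and modulus \<open>exp (-c)\<close> and \<open>exp c\<close> on the lines: it
  shifts size from one line to the other.\<close>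

lemma tc_exp: "tc (\<lambda>z. exp (c * (2 * z - 1))) j = (2 * c) ^ j / fact j"
proof -
  have "(\<lambda>x. exp (c * (2 * (1/2 + x) - 1))) has_fps_expansion fps_exp (2 * c)"
    using has_fps_expansion_exp[of "2*c"] by (simp add: algebra_simps)
  from tc_eqI[OF this] show ?thesis by simp
qed

text \<open>Later this exchanges an exponential for a much smaller function with the same low order
  jet.\<close>

lemma tc_mult_low:
  assumes "f holomorphic_on strip" "g holomorphic_on strip" "h holomorphic_on strip"
    and "\<And>i. i \<le> j \<Longrightarrow> tc g i = tc h i"
  shows "tc (\<lambda>z. f z * g z) j = tc (\<lambda>z. f z * h z) j"
  using assms by (simp add: tc_mult)

section \<open>Holomorphy in the sup norm and in each coordinate\<close>

lemma linf_bdd_I: "(\<And>k. cmod (x k) \<le> B) \<Longrightarrow> linf_bdd x"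
  unfolding linf_bdd_def by (rule bdd_aboveI2)

lemma linf_norm_upper: "linf_bdd x \<Longrightarrow> cmod (x k) \<le> linf_norm x"
  unfolding linf_bdd_def linf_norm_def by (rule cSUP_upper) auto

lemma linf_norm_least: "(\<And>k. cmod (x k) \<le> B) \<Longrightarrow> linf_norm x \<le> B"
  unfolding linf_norm_def by (rule cSUP_least) auto

lemma linf_norm_nonneg: "linf_bdd x \<Longrightarrow> 0 \<le> linf_norm x"
  using linf_norm_upper[of x 0] norm_ge_zero order_trans by blast

lemma linf_bdd_diff: "linf_bdd x \<Longrightarrow> linf_bdd y \<Longrightarrow> linf_bdd (\<lambda>k. x k - y k)"
proof (rule linf_bdd_I)
  fix k assume "linf_bdd x" "linf_bdd y"
  thus "cmod (x k - y k) \<le> linf_norm x + linf_norm y"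
    using linf_norm_upper[of x k] linf_norm_upper[of y k] norm_triangle_ineq4[of "x k" "y k"] by linarith
qed

lemma linf_bdd_cmult: "linf_bdd x \<Longrightarrow> linf_bdd (\<lambda>k. c * x k)"
  by (rule linf_bdd_I[where B="cmod c * linf_norm x"]) (auto simp: norm_mult intro!: mult_left_mono linf_norm_upper)

lemma linf_has_deriv_coord:
  assumes "open S" "z \<in> S" and bdd: "\<And>w. w \<in> S \<Longrightarrow> linf_bdd (g w)" and d: "linf_has_deriv g v z"
  shows "((\<lambda>w. g w k) has_field_derivative v k) (at z)"
proof -
  have v: "linf_bdd v" and lim: "((\<lambda>w. linf_norm (\<lambda>k. (g w k - g z k) / (w - z) - v k)) \<longlongrightarrow> 0) (at z)"
    using d by (auto simp: linf_has_deriv_def)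
  have ev: "eventually (\<lambda>w. w \<in> S) (at z)"
    using assms by (intro eventually_at_in_open') auto
  have "((\<lambda>w. (g w k - g z k) / (w - z) - v k) \<longlongrightarrow> 0) (at z)"
  proof (rule Lim_null_comparison[OF _ lim])
    show "eventually (\<lambda>w. norm ((g w k - g z k) / (w - z) - v k) \<le> linf_norm (\<lambda>k. (g w k - g z k) / (w - z) - v k)) (at z)"
      using ev
    proof eventually_elim
      case (elim w)
      have "linf_bdd (\<lambda>k. (1/(w-z)) * (g w k - g z k) - v k)"
        using elim assms v by (intro linf_bdd_diff linf_bdd_cmult) auto
      from linf_norm_upper[OF this, of k] show ?case by simp
    qed
  qed
  hence "((\<lambda>w. (g w k - g z k) / (w - z)) \<longlongrightarrow> v k) (at z)"
    by (simp add: LIM_zero_iff)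
  thus ?thesis by (simp add: has_field_derivative_iff)
qed

text \<open>Cauchy estimates bound the second derivatives of all coordinates at once, so the first
  order Taylor remainder is \<open>O(|w - z|^2)\<close> uniformly in the coordinate. A uniform bound
  thus upgrades coordinatewise to norm differentiability.\<close>

lemma linf_has_deriv_I:
  assumes r: "r > 0" and bd: "\<And>w k. w \<in> ball z r \<Longrightarrow> cmod (g w k) \<le> B"
    and hol: "\<And>k. (\<lambda>w. g w k) holomorphic_on ball z r"
  shows "linf_has_deriv g (\<lambda>k. deriv (\<lambda>w. g w k) z) z"
proof -
  \<comment> \<open>A quarter of the radius leaves a Cauchy disc of radius \<open>s\<close> around
    every point of \<open>cball z s\<close> inside \<open>ball z r\<close>.\<close>
  define s where "s = r / 4"
  have s: "s > 0" "r = 4 * s" using r by (auto simp: s_def)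
  have cau: "cmod ((deriv ^^ j) (\<lambda>w. g w k) u) \<le> fact j * B / s ^ j" if u: "u \<in> cball z s" for j k u
  proof (rule Cauchy_inequality[OF _ _ s(1)])
    have sub: "cball u s \<subseteq> ball z r"
    proof
      fix w assume "w \<in> cball u s"
      thus "w \<in> ball z r" using u s dist_triangle[of z w u] by auto
    qed
    thus "(\<lambda>w. g w k) holomorphic_on ball u s"
      using hol holomorphic_on_subset ball_subset_cball by blast
    show "continuous_on (cball u s) (\<lambda>w. g w k)"
      using sub hol holomorphic_on_imp_continuous_on continuous_on_subset by blast
    fix x assume "norm (u - x) = s"
    hence "x \<in> cball u s" by (simp add: dist_norm)
    thus "cmod (g x k) \<le> B" using sub bd by blast
  qed
  have est: "cmod ((g w k - g z k) / (w - z) - deriv (\<lambda>w. g w k) z) \<le> 2 * B / s\<^sup>2 * cmod (w - z)"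
    if w: "w \<in> cball z s" "w \<noteq> z" for w k
  proof -
    have "cmod ((deriv ^^ 0) (\<lambda>w. g w k) w - (\<Sum>i\<le>1. (deriv ^^ i) (\<lambda>w. g w k) z * (w - z) ^ i / fact i))
        \<le> (2 * B / s\<^sup>2) * cmod (w - z) ^ (Suc 1) / fact 1"
    proof (rule complex_Taylor[of "cball z s" 1 "\<lambda>i. (deriv ^^ i) (\<lambda>w. g w k)" "2 * B / s\<^sup>2" z w])
      fix i x assume x: "x \<in> cball z s" "i \<le> (1::nat)"
      have "x \<in> ball z r" using x s by auto
      hence "((deriv ^^ i) (\<lambda>w. g w k) has_field_derivative deriv ((deriv ^^ i) (\<lambda>w. g w k)) x) (at x)"
        by (intro holomorphic_derivI[OF holomorphic_higher_deriv[OF hol]]) auto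
      thus "((deriv ^^ i) (\<lambda>w. g w k) has_field_derivative (deriv ^^ Suc i) (\<lambda>w. g w k) x) (at x within cball z s)"
        by (auto intro: has_field_derivative_at_within)
    next
      fix x assume "x \<in> cball z s"
      from cau[OF this, of "Suc 1" k] show "cmod ((deriv ^^ Suc 1) (\<lambda>w. g w k) x) \<le> 2 * B / s\<^sup>2"
        by (simp add: power2_eq_square)
    qed (use s w in auto)
    hence "cmod (g w k - g z k - deriv (\<lambda>w. g w k) z * (w - z)) \<le> 2 * B / s\<^sup>2 * (cmod (w - z))\<^sup>2"
      by (simp add: power2_eq_square algebra_simps)
    hence "cmod (g w k - g z k - deriv (\<lambda>w. g w k) z * (w - z)) / cmod (w - z) \<le> 2 * B / s\<^sup>2 * (cmod (w - z))\<^sup>2 / cmod (w - z)"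
      by (intro divide_right_mono) auto
    also have "cmod (g w k - g z k - deriv (\<lambda>w. g w k) z * (w - z)) / cmod (w - z)
        = cmod ((g w k - g z k) / (w - z) - deriv (\<lambda>w. g w k) z)"
      using w by (simp add: norm_divide[symmetric] diff_divide_distrib)
    finally show ?thesis using w by (simp add: power2_eq_square)
  qed
  show ?thesis unfolding linf_has_deriv_def
  proof
    show "linf_bdd (\<lambda>k. deriv (\<lambda>w. g w k) z)"
      using cau[of z 1] s by (intro linf_bdd_I[where B="B/s"]) auto
    have ev: "eventually (\<lambda>w. w \<in> ball z s \<and> w \<noteq> z) (at z)"
      using s by (auto simp: eventually_at intro!: exI[of _ s] simp: dist_commute)
    show "((\<lambda>w. linf_norm (\<lambda>k. (g w k - g z k) / (w - z) - deriv (\<lambda>w. g w k) z)) \<longlongrightarrow> 0) (at z)"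
    proof (rule Lim_null_comparison)
      show "((\<lambda>w. 2 * B / s\<^sup>2 * cmod (w - z)) \<longlongrightarrow> 0) (at z)"
        using s by (auto intro!: tendsto_eq_intros)
      show "eventually (\<lambda>w. norm (linf_norm (\<lambda>k. (g w k - g z k) / (w - z) - deriv (\<lambda>w. g w k) z))
         \<le> 2 * B / s\<^sup>2 * cmod (w - z)) (at z)"
        using ev
      proof eventually_elim
        case (elim w)
        hence e: "cmod ((g w k - g z k) / (w - z) - deriv (\<lambda>w. g w k) z) \<le> 2 * B / s\<^sup>2 * cmod (w - z)" for k
          by (intro est) auto
        from linf_norm_least[OF this] linf_norm_nonneg[OF linf_bdd_I, OF e] show ?case by simp
      qed
    qed
  qed
qed

lemma coordinate_continuous_on:
  fixes f :: "complex \<Rightarrow> cseq"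
  assumes "\<And>z e. z \<in> D \<Longrightarrow> e > 0 \<Longrightarrow> eventually (\<lambda>w. \<forall>k. cmod (f w k - f z k) \<le> e) (at z within D)"
  shows "continuous_on D (\<lambda>z. f z k)"
proof -
  have "((\<lambda>w. f w k) \<longlongrightarrow> f z k) (at z within D)" if "z \<in> D" for z
  proof (rule tendstoI)
    fix e :: real assume "e > 0"
    hence "eventually (\<lambda>w. \<forall>k. cmod (f w k - f z k) \<le> e/2) (at z within D)"
      using that by (intro assms) auto
    thus "eventually (\<lambda>w. dist (f w k) (f z k) < e) (at z within D)"
    proof eventually_elim
      case (elim w)
      thus ?case using \<open>e > 0\<close> by (auto simp: dist_norm dest!: spec[of _ k])
    qed
  qed
  thus ?thesis by (auto simp: continuous_on)
qed

text \<open>The explicit form of membership in the ball of radius \<open>B\<close> of the Calderon space.\<close>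

definition cal :: "real \<Rightarrow> (complex \<Rightarrow> cseq) \<Rightarrow> bool" where
  "cal B f \<longleftrightarrow> (\<forall>z\<in>cl_strip. \<forall>k. cmod (f z k) \<le> B) \<and>
     (\<forall>z\<in>cl_strip. \<forall>e>0. eventually (\<lambda>w. \<forall>k. cmod (f w k - f z k) \<le> e) (at z within cl_strip)) \<and>
     (\<forall>k. (\<lambda>z. f z k) holomorphic_on strip) \<and>
     (\<forall>t::real. \<forall>N. (\<Sum>k<N. cmod (f (1 + \<i> * of_real t) k)) \<le> B)"

lemma
  assumes "cal B f"
  shows cal_bound: "z \<in> cl_strip \<Longrightarrow> cmod (f z k) \<le> B"
    and cal_equicont: "z \<in> cl_strip \<Longrightarrow> e > 0 \<Longrightarrow> eventually (\<lambda>w. \<forall>k. cmod (f w k - f z k) \<le> e) (at z within cl_strip)"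
    and cal_hol: "(\<lambda>z. f z k) holomorphic_on strip"
    and cal_l1: "(\<Sum>k<N. cmod (f (1 + \<i> * of_real t) k)) \<le> B"
  using assms by (auto simp: cal_def)

lemma cal_cont: "cal B f \<Longrightarrow> continuous_on cl_strip (\<lambda>z. f z k)"
  by (rule coordinate_continuous_on) (rule cal_equicont)

lemma cal_nonneg: "cal B f \<Longrightarrow> B \<ge> 0"
  using cal_l1[of B f 0 0] by simp

lemma cal_linf_deriv:
  assumes "cal B f" "z \<in> strip"
  shows "linf_has_deriv f (\<lambda>k. deriv (\<lambda>w. f w k) z) z"
proof -
  obtain r where r: "r > 0" "ball z r \<subseteq> strip"
    using open_strip assms(2) by (meson open_contains_ball)
  show ?thesis
    using r strip_subset assms by (intro linf_has_deriv_I[of r _ _ B] cal_bound holomorphic_on_subset[OF cal_hol]) auto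
qed

lemma cal_imp_calderon:
  assumes "cal B f"
  shows "calderon f" "cal_norm f \<le> B"
proof -
  have in_cl: "\<i> * of_real t \<in> cl_strip" "1 + \<i> * of_real t \<in> cl_strip" for t :: real
    by (auto simp: cl_strip_def)
  have b: "linf_norm (f z) \<le> B" if "z \<in> cl_strip" for z
    using that by (intro linf_norm_least cal_bound[OF assms])
  have s: "summable (\<lambda>k. cmod (f (1 + \<i> * of_real t) k))" for t :: real
    by (rule bounded_imp_summable[where B=B]) (use cal_l1[OF assms, where t=t and N="Suc _"] in \<open>auto simp: lessThan_Suc_atMost\<close>)
  have l: "l1_norm (f (1 + \<i> * of_real t)) \<le> B" for t :: real
    unfolding l1_norm_def using s cal_l1[OF assms] by (rule suminf_le_const)
  have b2: "bdd_above (range (\<lambda>t::real. linf_norm (f (\<i> * of_real t))))"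
    using b[OF in_cl(1)] by (auto simp: bdd_above_def)
  have b3: "bdd_above (range (\<lambda>t::real. l1_norm (f (1 + \<i> * of_real t))))"
    using l by (auto simp: bdd_above_def)
  show "cal_norm f \<le> B"
    unfolding cal_norm_def using b[OF in_cl(1)] l by (auto intro!: cSUP_least)
  have "((\<lambda>w. linf_norm (\<lambda>k. f w k - f z k)) \<longlongrightarrow> 0) (at z within cl_strip)" if z: "z \<in> cl_strip" for z
  proof (rule tendstoI)
    fix e :: real assume "e > 0"
    hence "eventually (\<lambda>w. \<forall>k. cmod (f w k - f z k) \<le> e/2) (at z within cl_strip)"
      using z by (intro cal_equicont[OF assms]) auto
    thus "eventually (\<lambda>w. dist (linf_norm (\<lambda>k. f w k - f z k)) 0 < e) (at z within cl_strip)"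
    proof eventually_elim
      case (elim w)
      hence "linf_norm (\<lambda>k. f w k - f z k) \<le> e/2" by (intro linf_norm_least) auto
      moreover have "0 \<le> linf_norm (\<lambda>k. f w k - f z k)"
        using elim by (intro linf_norm_nonneg linf_bdd_I[where B="e/2"]) auto
      ultimately show ?case using \<open>e > 0\<close> by simp
    qed
  qed
  moreover have "linf_holomorphic_on f strip"
    using cal_linf_deriv[OF assms] by (auto simp: linf_holomorphic_on_def)
  moreover have "linf_bdd (f z)" if "z \<in> cl_strip" for z
    using that cal_bound[OF assms] by (intro linf_bdd_I)
  moreover have "bdd_above ((\<lambda>z. linf_norm (f z)) ` cl_strip)"
    using b by (auto simp: bdd_above_def)
  ultimately show "calderon f"
    unfolding calderon_def in_l1_def using s b2 b3 by blast
qed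

text \<open>The definition grants some bound on the closed strip; the maximum principle in each
  coordinate improves it to \<open>cal_norm f\<close>, which sees the boundary lines only.\<close>

lemma calderon_imp_cal:
  assumes "calderon f"
  shows "cal (cal_norm f) f"
proof -
  note A = assms[unfolded calderon_def]
  have bdd: "linf_bdd (f z)" if "z \<in> cl_strip" for z using that A by blast
  obtain B where B: "\<And>z. z \<in> cl_strip \<Longrightarrow> linf_norm (f z) \<le> B"
    using A by (auto simp: bdd_above_def)
  have hol: "(\<lambda>z. f z k) holomorphic_on strip" for k
  proof (subst holomorphic_on_open[OF open_strip], safe)
    fix z assume z: "z \<in> strip"
    then obtain v where "linf_has_deriv f v z" using A by (auto simp: linf_holomorphic_on_def)
    from linf_has_deriv_coord[OF open_strip z _ this]
    show "\<exists>f'. ((\<lambda>z. f z k) has_field_derivative f') (at z)"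
      using bdd strip_subset by blast
  qed
  have eq: "eventually (\<lambda>w. \<forall>k. cmod (f w k - f z k) \<le> e) (at z within cl_strip)"
    if z: "z \<in> cl_strip" and "e > 0" for z e
  proof -
    have "((\<lambda>w. linf_norm (\<lambda>k. f w k - f z k)) \<longlongrightarrow> 0) (at z within cl_strip)" using A z by blast
    hence "eventually (\<lambda>w. linf_norm (\<lambda>k. f w k - f z k) < e) (at z within cl_strip)"
      using \<open>e > 0\<close> by (rule order_tendstoD)
    moreover have "eventually (\<lambda>w. w \<in> cl_strip) (at z within cl_strip)"
      by (auto simp: eventually_at_filter)
    ultimately show ?thesis
    proof eventually_elim
      case (elim w)
      show ?case using linf_norm_upper[OF linf_bdd_diff[OF bdd[OF elim(2)] bdd[OF z]]] elim(1) by (meson less_imp_le order_trans)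
    qed
  qed
  have l1: "(\<Sum>k<N. cmod (f (1 + \<i> * of_real t) k)) \<le> cal_norm f" for t :: real and N
  proof -
    have "(\<Sum>k<N. cmod (f (1 + \<i> * of_real t) k)) \<le> l1_norm (f (1 + \<i> * of_real t))"
      unfolding l1_norm_def using A by (intro sum_le_suminf) (auto simp: in_l1_def)
    also have "\<dots> \<le> (SUP t::real. l1_norm (f (1 + \<i> * of_real t)))"
      using A by (intro cSUP_upper) auto
    finally show ?thesis by (simp add: cal_norm_def)
  qed
  have "continuous_on cl_strip (\<lambda>z. f z k)" for k
    by (rule coordinate_continuous_on) (rule eq)
  moreover have "cmod (f z k) \<le> B" if "z \<in> cl_strip" for z k
    using linf_norm_upper[OF bdd[OF that], of k] B[OF that] by linarith
  moreover have "cmod (f z k) \<le> cal_norm f" if "Re z = 0 \<or> Re z = 1" for z k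
  proof (cases "Re z = 0")
    case True
    hence z: "z = \<i> * of_real (Im z)" by (simp add: complex_eq_iff)
    have "z \<in> cl_strip" using that by (auto simp: cl_strip_def)
    hence "cmod (f z k) \<le> linf_norm (f z)" using bdd linf_norm_upper by blast
    also have "linf_norm (f z) = linf_norm (f (\<i> * of_real (Im z)))" using z by metis
    also have "\<dots> \<le> (SUP t::real. linf_norm (f (\<i> * of_real t)))"
      using A by (intro cSUP_upper) auto
    finally show ?thesis by (simp add: cal_norm_def)
  next
    case False
    hence z: "z = 1 + \<i> * of_real (Im z)" using that by (simp add: complex_eq_iff)
    have "cmod (f z k) \<le> (\<Sum>l<Suc k. cmod (f z l))"
      by (rule member_le_sum) auto
    also have "\<dots> = (\<Sum>l<Suc k. cmod (f (1 + \<i> * of_real (Im z)) l))" using z by metis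
    also have "\<dots> \<le> cal_norm f" by (rule l1)
    finally show ?thesis .
  qed
  ultimately have "cmod (f z k) \<le> cal_norm f" if "z \<in> cl_strip" for z k
    using strip_maximum_principle[of "\<lambda>z. f z k" B "cal_norm f" z] hol that by blast
  thus ?thesis unfolding cal_def using eq hol l1 by blast
qed

text \<open>\<open>lderiv\<close> picks a norm derivative by \<open>SOME\<close>, but its
  coordinates are forced, since norm differentiability gives each coordinate the corresponding
  derivative. To have something to pick, the induction needs the \<open>j\<close>-th derivative to
  be norm differentiable, which follows from Cauchy bounds uniform in the coordinate.\<close>

lemma lderiv_funpow_coord:
  assumes "cal B f" "z \<in> strip"
  shows "(lderiv ^^ j) f z = (\<lambda>k. (deriv ^^ j) (\<lambda>w. f w k) z)"
  using assms(2)
proof (induction j arbitrary: z)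
  case (Suc j)
  let ?g = "(lderiv ^^ j) f"
  obtain r where r: "r > 0" "ball z r \<subseteq> strip"
    using open_strip Suc.prems by (meson open_contains_ball)
  define s where "s = r / 4"
  have s: "s > 0" "r = 4 * s" using r by (auto simp: s_def)
  have sub: "ball z s \<subseteq> strip" using r s by auto
  have gk: "?g w k = (deriv ^^ j) (\<lambda>w. f w k) w" if "w \<in> strip" for w k
    using Suc.IH[OF that] by simp
  have bd: "cmod (?g w k) \<le> fact j * B / s ^ j" if w: "w \<in> ball z s" for w k
  proof -
    have sub': "cball w s \<subseteq> strip"
    proof
      fix u assume "u \<in> cball w s"
      hence "u \<in> ball z r" using w s dist_triangle[of z u w] by auto
      thus "u \<in> strip" using r by auto
    qed
    have "cmod ((deriv ^^ j) (\<lambda>w. f w k) w) \<le> fact j * B / s ^ j"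
    proof (rule Cauchy_inequality)
      show "(\<lambda>w. f w k) holomorphic_on ball w s"
        using cal_hol[OF assms(1)] sub' holomorphic_on_subset ball_subset_cball by blast
      show "continuous_on (cball w s) (\<lambda>w. f w k)"
        using cal_hol[OF assms(1)] sub' holomorphic_on_imp_continuous_on continuous_on_subset by blast
      fix x assume "norm (w - x) = s"
      hence "x \<in> strip" using sub' by (auto simp: dist_norm subset_iff)
      thus "cmod (f x k) \<le> B" using cal_bound[OF assms(1)] strip_subset by blast
    qed (use s in auto)
    thus ?thesis using gk w sub by auto
  qed
  have hol: "(\<lambda>w. ?g w k) holomorphic_on strip" for k
    by (rule holomorphic_transform[OF holomorphic_higher_deriv[OF cal_hol[OF assms(1)] open_strip]])
       (use gk in auto)
  have "linf_has_deriv ?g (\<lambda>k. deriv (\<lambda>w. ?g w k) z) z"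
    using s sub by (intro linf_has_deriv_I[of s _ _ "fact j * B / s ^ j"] bd holomorphic_on_subset[OF hol]) auto
  hence some: "linf_has_deriv ?g (lderiv ?g z) z"
    using someI[of "\<lambda>v. linf_has_deriv ?g v z"] by (simp add: lderiv_def)
  have "lderiv ?g z k = (deriv ^^ Suc j) (\<lambda>w. f w k) z" for k
  proof -
    have "((\<lambda>w. ?g w k) has_field_derivative lderiv ?g z k) (at z)"
      using s by (intro linf_has_deriv_coord[OF open_ball _ _ some, of z s] linf_bdd_I[OF bd]) auto
    hence "deriv (\<lambda>w. ?g w k) z = lderiv ?g z k" by (rule DERIV_imp_deriv)
    moreover have "deriv (\<lambda>w. ?g w k) z = deriv ((deriv ^^ j) (\<lambda>w. f w k)) z"
    proof (rule deriv_cong_ev)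
      show "eventually (\<lambda>w. ?g w k = (deriv ^^ j) (\<lambda>w. f w k) w) (nhds z)"
        using eventually_nhds_in_open[OF open_strip Suc.prems] by eventually_elim (rule gk)
    qed simp
    ultimately show ?thesis by simp
  qed
  thus ?case by auto
qed simp

lemma taylor_coeff_eq_tc:
  assumes "cal B f"
  shows "taylor_coeff f j k = jet f j k"
  unfolding taylor_coeff_def tc_def using lderiv_funpow_coord[OF assms half_in_strip, of j] by simp

subsection \<open>The Calderon ball and the norm of the Rochberg space\<close>

lemma cal_add:
  assumes "cal B f" "cal C g"
  shows "cal (B + C) (\<lambda>z k. f z k + g z k)"
proof -
  have "cmod (f z k + g z k) \<le> B + C" if "z \<in> cl_strip" for z k
    using cal_bound[OF assms(1) that, of k] cal_bound[OF assms(2) that, of k] norm_triangle_ineq[of "f z k" "g z k"] by linarith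
  moreover have "eventually (\<lambda>w. \<forall>k. cmod ((f w k + g w k) - (f z k + g z k)) \<le> e) (at z within cl_strip)"
    if z: "z \<in> cl_strip" and e: "e > 0" for z e
  proof -
    have "eventually (\<lambda>w. \<forall>k. cmod (f w k - f z k) \<le> e/2) (at z within cl_strip)"
      "eventually (\<lambda>w. \<forall>k. cmod (g w k - g z k) \<le> e/2) (at z within cl_strip)"
      using cal_equicont[OF assms(1) z, of "e/2"] cal_equicont[OF assms(2) z, of "e/2"] e by auto
    thus ?thesis
    proof eventually_elim
      case (elim w)
      show ?case
      proof
        fix k
        have "cmod ((f w k + g w k) - (f z k + g z k)) = cmod ((f w k - f z k) + (g w k - g z k))"
          by (simp add: algebra_simps)
        also have "\<dots> \<le> cmod (f w k - f z k) + cmod (g w k - g z k)" by (rule norm_triangle_ineq)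
        also have "\<dots> \<le> e/2 + e/2" using elim by (intro add_mono) auto
        finally show "cmod ((f w k + g w k) - (f z k + g z k)) \<le> e" by simp
      qed
    qed
  qed
  moreover have "(\<lambda>z. f z k + g z k) holomorphic_on strip" for k
    by (intro holomorphic_intros cal_hol[OF assms(1)] cal_hol[OF assms(2)])
  moreover have "(\<Sum>k<N. cmod (f (1 + \<i> * of_real t) k + g (1 + \<i> * of_real t) k)) \<le> B + C" for t :: real and N
  proof -
    have "(\<Sum>k<N. cmod (f (1 + \<i> * of_real t) k + g (1 + \<i> * of_real t) k))
      \<le> (\<Sum>k<N. cmod (f (1 + \<i> * of_real t) k) + cmod (g (1 + \<i> * of_real t) k))"
      by (intro sum_mono norm_triangle_ineq)
    also have "\<dots> \<le> B + C" unfolding sum.distrib by (intro add_mono cal_l1[OF assms(1)] cal_l1[OF assms(2)])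
    finally show ?thesis .
  qed
  ultimately show ?thesis by (simp add: cal_def)
qed

lemma cal_mono: "cal B f \<Longrightarrow> B \<le> C \<Longrightarrow> cal C f"
proof -
  assume c: "cal B f" and "B \<le> C"
  hence "cmod (f z k) \<le> C" if "z \<in> cl_strip" for z k using cal_bound[OF c that, of k] by linarith
  moreover have "(\<Sum>k<N. cmod (f (1 + \<i> * of_real t) k)) \<le> C" for t :: real and N
    using cal_l1[OF c, of t N] \<open>B \<le> C\<close> by linarith
  ultimately show ?thesis using c by (simp add: cal_def)
qed

lemma cal_zero: "0 \<le> B \<Longrightarrow> cal B (\<lambda>z k. 0)"
  by (auto simp: cal_def)

lemma cal_scale:
  assumes "cal B f"
  shows "cal (cmod c * B) (\<lambda>z k. c * f z k)"
proof (cases "c = 0")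
  case True
  thus ?thesis using cal_zero[of 0] by simp
next
  case False
  have "eventually (\<lambda>w. \<forall>k. cmod (c * f w k - c * f z k) \<le> e) (at z within cl_strip)"
    if z: "z \<in> cl_strip" and e: "e > 0" for z e
  proof -
    have "eventually (\<lambda>w. \<forall>k. cmod (f w k - f z k) \<le> e / cmod c) (at z within cl_strip)"
      using cal_equicont[OF assms z, of "e / cmod c"] e False by simp
    thus ?thesis
    proof eventually_elim
      case (elim w)
      have "cmod (c * f w k - c * f z k) = cmod c * cmod (f w k - f z k)" for k
        by (simp only: right_diff_distrib[symmetric] norm_mult)
      thus ?case using elim False by (simp add: pos_le_divide_eq mult.commute)
    qed
  qed
  moreover have "(\<lambda>z. c * f z k) holomorphic_on strip" for k
    by (intro holomorphic_intros cal_hol[OF assms(1)])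
  ultimately show ?thesis
    using cal_bound[OF assms] cal_l1[OF assms]
    by (auto simp: cal_def norm_mult sum_distrib_left[symmetric] intro!: mult_left_mono)
qed

lemma cal_diff: "cal B f \<Longrightarrow> cal C g \<Longrightarrow> cal (B + C) (\<lambda>z k. f z k - g z k)"
  using cal_add[of B f C "\<lambda>z k. - 1 * g z k"] cal_scale[of C g "-1"] by simp

lemma cal_restrict:
  assumes "cal B f"
  shows "cal B (\<lambda>z k. if k \<in> A then f z k else 0)"
proof -
  have "eventually (\<lambda>w. \<forall>k. cmod ((if k \<in> A then f w k else 0) - (if k \<in> A then f z k else 0)) \<le> e) (at z within cl_strip)"
    if z: "z \<in> cl_strip" and e: "e > 0" for z e
    using cal_equicont[OF assms z e] by eventually_elim (use e in auto)
  moreover have "(\<lambda>z. if k \<in> A then f z k else 0) holomorphic_on strip" for k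
    using cal_hol[OF assms] by (cases "k \<in> A") auto
  moreover have "(\<Sum>k<N. cmod (if k \<in> A then f (1 + \<i> * of_real t) k else 0)) \<le> B" for t :: real and N
    by (rule order_trans[OF _ cal_l1[OF assms, of t N]]) (auto intro!: sum_mono)
  ultimately show ?thesis
    using cal_bound[OF assms] cal_nonneg[OF assms] by (auto simp: cal_def)
qed

text \<open>With finite support, continuity uniform over the coordinates is automatic, and the
  maximum principle leaves only the boundary lines to estimate; \<open>B'\<close> may be arbitrarily
  bad.\<close>

lemma cal_finite:
  assumes fin: "finite A" and supp: "\<And>z k. k \<notin> A \<Longrightarrow> f z k = 0"
    and cont: "\<And>k. k \<in> A \<Longrightarrow> continuous_on cl_strip (\<lambda>z. f z k)"
    and hol: "\<And>k. k \<in> A \<Longrightarrow> (\<lambda>z. f z k) holomorphic_on strip"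
    and bd: "\<And>k z. k \<in> A \<Longrightarrow> z \<in> cl_strip \<Longrightarrow> cmod (f z k) \<le> B'"
    and b0: "\<And>k t::real. k \<in> A \<Longrightarrow> cmod (f (\<i> * of_real t) k) \<le> B"
    and b1: "\<And>t::real. (\<Sum>k\<in>A. cmod (f (1 + \<i> * of_real t) k)) \<le> B"
  shows "cal B f"
proof -
  have B: "B \<ge> 0" by (rule order_trans[OF _ b1[of 0]]) (auto intro!: sum_nonneg)
  have bdry: "cmod (f z k) \<le> B" if k: "k \<in> A" and z: "Re z = 0 \<or> Re z = 1" for z k
  proof (cases "Re z = 0")
    case True
    hence z: "z = \<i> * of_real (Im z)" by (simp add: complex_eq_iff)
    show ?thesis by (subst z, rule b0[OF k])
  next
    case False
    hence z: "z = 1 + \<i> * of_real (Im z)" using z by (simp add: complex_eq_iff)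
    have "cmod (f z k) \<le> (\<Sum>l\<in>A. cmod (f z l))" using k fin by (intro member_le_sum) auto
    also have "\<dots> \<le> B" by (subst z, rule b1)
    finally show ?thesis .
  qed
  have "cmod (f z k) \<le> B" if z: "z \<in> cl_strip" for z k
  proof (cases "k \<in> A")
    case True
    show ?thesis
      by (rule strip_maximum_principle[OF cont[OF True] hol[OF True] bd[OF True] bdry[OF True] z])
  qed (use B supp in auto)
  moreover have "eventually (\<lambda>w. \<forall>k. cmod (f w k - f z k) \<le> e) (at z within cl_strip)"
    if z: "z \<in> cl_strip" and e: "e > 0" for z e
  proof -
    have "eventually (\<lambda>w. \<forall>k\<in>A. cmod (f w k - f z k) \<le> e) (at z within cl_strip)"
    proof (rule eventually_ball_finite[OF fin], safe)
      fix k assume "k \<in> A"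
      hence "((\<lambda>w. f w k) \<longlongrightarrow> f z k) (at z within cl_strip)"
        using cont z by (auto simp: continuous_on)
      hence "eventually (\<lambda>w. dist (f w k) (f z k) < e) (at z within cl_strip)"
        using e by (rule tendstoD)
      thus "eventually (\<lambda>w. cmod (f w k - f z k) \<le> e) (at z within cl_strip)"
        by eventually_elim (auto simp: dist_norm)
    qed
    thus ?thesis
    proof eventually_elim
      case (elim w)
      show ?case using elim supp e by (metis diff_self less_imp_le norm_zero)
    qed
  qed
  moreover have "(\<lambda>z. f z k) holomorphic_on strip" for k
    using hol supp by (cases "k \<in> A") auto
  moreover have "(\<Sum>k<N. cmod (f (1 + \<i> * of_real t) k)) \<le> B" for t :: real and N
  proof -
    have "(\<Sum>k<N. cmod (f (1 + \<i> * of_real t) k)) = (\<Sum>k\<in>{..<N} \<inter> A. cmod (f (1 + \<i> * of_real t) k))"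
      using supp by (intro sum.mono_neutral_right) auto
    also have "\<dots> \<le> (\<Sum>k\<in>A. cmod (f (1 + \<i> * of_real t) k))"
      using fin by (intro sum_mono2) auto
    finally show ?thesis using b1[of t] by linarith
  qed
  ultimately show ?thesis by (simp add: cal_def)
qed

text \<open>The source of completeness: the series converges uniformly on the closed strip, so
  continuity, holomorphy and Taylor coefficients pass to the limit.\<close>

lemma cal_suminf:
  assumes c: "\<And>i. cal (B i) (f i)" and B: "summable B"
  shows "cal (\<Sum>i. B i) (\<lambda>z k. \<Sum>i. f i z k)"
    and "tc (\<lambda>z. \<Sum>i. f i z k) j = (\<Sum>i. jet (f i) j k)"
    and "summable (\<lambda>i. jet (f i) j k)"
proof -
  have pos: "B i \<ge> 0" for i using cal_nonneg[OF c] .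
  have sm: "summable (\<lambda>i. cmod (f i z k))" if "z \<in> cl_strip" for z k
    using B by (rule summable_comparison_test') (use cal_bound[OF c that] in auto)
  have sm': "summable (\<lambda>i. f i z k)" if "z \<in> cl_strip" for z k
    using sm[OF that] by (rule summable_norm_cancel)
  have bd: "cmod (\<Sum>i. f i z k) \<le> (\<Sum>i. B i)" if z: "z \<in> cl_strip" for z k
    using sm[OF z] B cal_bound[OF c z] by (intro order_trans[OF summable_norm suminf_le]) auto
  have tail: "cmod ((\<Sum>i. f i z k) - (\<Sum>i<m. f i z k)) \<le> (\<Sum>i. B (i + m))" if z: "z \<in> cl_strip" for z k m
  proof -
    have "(\<Sum>i. f i z k) - (\<Sum>i<m. f i z k) = (\<Sum>i. f (i + m) z k)"
      using suminf_minus_initial_segment[OF sm'[OF z]] by simp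
    also have "cmod \<dots> \<le> (\<Sum>i. cmod (f (i + m) z k))"
      using sm[OF z] by (intro summable_norm) (simp add: summable_iff_shift[of "\<lambda>i. cmod (f i z k)"])
    also have "\<dots> \<le> (\<Sum>i. B (i + m))"
      using sm[OF z] B cal_bound[OF c z] by (intro suminf_le) (auto simp: summable_iff_shift[of "\<lambda>i. cmod (f i z k)"] summable_iff_shift)
    finally show ?thesis .
  qed
  have tail0: "(\<lambda>m. \<Sum>i. B (i + m)) \<longlonglongrightarrow> 0"
    using suminf_exist_split2[OF B] .
  have unif: "uniform_limit cl_strip (\<lambda>m z. \<Sum>i<m. f i z k) (\<lambda>z. \<Sum>i. f i z k) sequentially" for k
  proof (rule uniform_limitI)
    fix e :: real assume "e > 0"
    hence "eventually (\<lambda>m. (\<Sum>i. B (i + m)) < e) sequentially"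
      by (rule order_tendstoD[OF tail0])
    thus "\<forall>\<^sub>F m in sequentially. \<forall>z\<in>cl_strip. dist (\<Sum>i<m. f i z k) (\<Sum>i. f i z k) < e"
    proof eventually_elim
      case (elim m)
      thus ?case using tail[of _ k m] by (auto simp: dist_norm norm_minus_commute intro: le_less_trans)
    qed
  qed
  have unif': "uniform_limit strip (\<lambda>m z. \<Sum>i<m. f i z k) (\<lambda>z. \<Sum>i. f i z k) sequentially" for k
    by (rule uniform_limit_on_subset[OF unif strip_subset])
  have holp: "(\<lambda>z. \<Sum>i<m. f i z k) holomorphic_on strip" for m k
    by (intro holomorphic_intros cal_hol[OF c])
  have hol: "(\<lambda>z. \<Sum>i. f i z k) holomorphic_on strip" for k
  proof (rule holomorphic_uniform_sequence[OF open_strip holp])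
    fix x assume "x \<in> strip"
    then obtain d where "d > 0" "cball x d \<subseteq> strip" using open_strip open_contains_cball by blast
    thus "\<exists>d>0. cball x d \<subseteq> strip \<and> uniform_limit (cball x d) (\<lambda>m z. \<Sum>i<m. f i z k) (\<lambda>z. \<Sum>i. f i z k) sequentially"
      using uniform_limit_on_subset[OF unif'] by blast
  qed
  have "(\<lambda>m. (deriv ^^ j) (\<lambda>z. \<Sum>i<m. f i z k) (1/2)) \<longlonglongrightarrow> (deriv ^^ j) (\<lambda>z. \<Sum>i. f i z k) (1/2)"
    using holp half_in_strip open_strip by (intro higher_deriv_complex_uniform_limit[OF unif']) auto
  hence "(\<lambda>m. (deriv ^^ j) (\<lambda>z. \<Sum>i<m. f i z k) (1/2) / fact j) \<longlonglongrightarrow> (deriv ^^ j) (\<lambda>z. \<Sum>i. f i z k) (1/2) / fact j"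
    by (rule tendsto_divide[OF _ tendsto_const]) simp
  hence "(\<lambda>m. tc (\<lambda>z. \<Sum>i<m. f i z k) j) \<longlonglongrightarrow> tc (\<lambda>z. \<Sum>i. f i z k) j"
    by (simp add: tc_def)
  hence "(\<lambda>i. jet (f i) j k) sums tc (\<lambda>z. \<Sum>i. f i z k) j"
    by (simp add: sums_def tc_sum cal_hol[OF c])
  thus "tc (\<lambda>z. \<Sum>i. f i z k) j = (\<Sum>i. jet (f i) j k)" "summable (\<lambda>i. jet (f i) j k)"
    by (auto simp: sums_iff)
  have eqc: "eventually (\<lambda>w. \<forall>k. cmod ((\<Sum>i. f i w k) - (\<Sum>i. f i z k)) \<le> e) (at z within cl_strip)"
    if z: "z \<in> cl_strip" and e: "e > 0" for z e
  proof -
    have "eventually (\<lambda>m. (\<Sum>i. B (i + m)) < e/3) sequentially"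
      by (rule order_tendstoD[OF tail0]) (use e in simp)
    then obtain m where m: "(\<Sum>i. B (i + m)) < e/3" using eventually_happens'[OF sequentially_bot] by blast
    have "eventually (\<lambda>w. \<forall>i\<in>{..<m}. \<forall>k. cmod (f i w k - f i z k) \<le> e / (3 * (real m + 1))) (at z within cl_strip)"
      using e by (intro eventually_ball_finite) (auto intro!: cal_equicont[OF c z])
    moreover have "eventually (\<lambda>w. w \<in> cl_strip) (at z within cl_strip)"
      by (auto simp: eventually_at_filter)
    ultimately show ?thesis
    proof eventually_elim
      case (elim w)
      show ?case
      proof
        fix k
        let ?s = "\<lambda>w. \<Sum>i. f i w k" and ?p = "\<lambda>w. \<Sum>i<m. f i w k"
        have "cmod (?p w - ?p z) \<le> (\<Sum>i<m. cmod (f i w k - f i z k))"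
          unfolding sum_subtractf[symmetric] by (rule norm_sum)
        also have "\<dots> \<le> (\<Sum>i<m. e / (3 * (real m + 1)))"
          using elim by (intro sum_mono) auto
        also have "\<dots> \<le> e/3" using e by (simp add: field_simps)
        finally have p: "cmod (?p w - ?p z) \<le> e/3" .
        have "cmod (?s w - ?s z) = cmod ((?s w - ?p w) + (?p w - ?p z) - (?s z - ?p z))" by simp
        also have "\<dots> \<le> cmod (?s w - ?p w) + cmod (?p w - ?p z) + cmod (?s z - ?p z)"
          by (rule order_trans[OF norm_triangle_ineq4]) (intro add_right_mono norm_triangle_ineq)
        also have "\<dots> \<le> e/3 + e/3 + e/3"
          by (intro add_mono p order_trans[OF tail[OF elim(2)] less_imp_le[OF m]] order_trans[OF tail[OF z] less_imp_le[OF m]])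
        finally show "cmod (?s w - ?s z) \<le> e" by simp
      qed
    qed
  qed
  have l1: "(\<Sum>k<N. cmod (\<Sum>i. f i (1 + \<i> * of_real t) k)) \<le> (\<Sum>i. B i)" for t :: real and N
  proof -
    let ?z = "1 + \<i> * of_real t"
    have z: "?z \<in> cl_strip" by (auto simp: cl_strip_def)
    have "(\<Sum>k<N. cmod (\<Sum>i. f i ?z k)) \<le> (\<Sum>k<N. \<Sum>i. cmod (f i ?z k))"
      using sm[OF z] by (intro sum_mono summable_norm)
    also have "\<dots> = (\<Sum>i. \<Sum>k<N. cmod (f i ?z k))"
      using sm[OF z] by (intro suminf_sum[symmetric]) auto
    also have "\<dots> \<le> (\<Sum>i. B i)"
      using cal_l1[OF c] B sm[OF z] by (intro suminf_le summable_sum) auto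
    finally show ?thesis .
  qed
  show "cal (\<Sum>i. B i) (\<lambda>z k. \<Sum>i. f i z k)"
    unfolding cal_def using bd eqc hol l1 by blast
qed

text \<open>An attained form of "norm at most \<open>B\<close>": a single representing function
  carries the bound. It implies \<open>zn_norm n x \<le> B\<close>, and for an element of the space
  every number strictly above its norm qualifies, so arguments with an epsilon bypass the
  infimum.\<close>

definition zle :: "nat \<Rightarrow> zelem \<Rightarrow> real \<Rightarrow> bool" where
  "zle n x B \<longleftrightarrow> (\<exists>f. cal B f \<and> (\<forall>j<n. \<forall>k. x j k = jet f j k))"

lemma represents_iff:
  "represents n f x \<longleftrightarrow> calderon f \<and> (\<forall>j<n. \<forall>k. x j k = jet f j k)"
proof (cases "calderon f")
  case True
  show ?thesis unfolding represents_def fun_eq_iff taylor_coeff_eq_tc[OF calderon_imp_cal[OF True]] ..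
qed (simp add: represents_def)

lemma zn_iff: "x \<in> zn n \<longleftrightarrow> (\<forall>j\<ge>n. x j = (\<lambda>_. 0)) \<and> (\<exists>B. zle n x B)"
proof -
  have "(\<exists>f. represents n f x) \<longleftrightarrow> (\<exists>B. zle n x B)"
    unfolding zle_def represents_iff by (meson cal_imp_calderon(1) calderon_imp_cal)
  thus ?thesis by (simp add: zn_def)
qed

lemma cal_norm_nonneg: "calderon f \<Longrightarrow> 0 \<le> cal_norm f"
  using cal_nonneg[OF calderon_imp_cal] .

lemma zn_norm_le: "zle n x B \<Longrightarrow> zn_norm n x \<le> B"
proof -
  assume "zle n x B"
  then obtain f where f: "cal B f" "\<forall>j<n. \<forall>k. x j k = jet f j k" by (auto simp: zle_def)
  have "zn_norm n x \<le> cal_norm f" unfolding zn_norm_def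
    using f cal_imp_calderon(1)
    by (intro cInf_lower) (auto simp: represents_iff intro!: bdd_belowI[where m=0] cal_norm_nonneg)
  thus ?thesis using cal_imp_calderon(2)[OF f(1)] by linarith
qed

lemma zn_norm_less:
  assumes "zle n x B" "zn_norm n x < C"
  shows "zle n x C"
proof -
  obtain f where f: "cal B f" "\<forall>j<n. \<forall>k. x j k = jet f j k" using assms(1) by (auto simp: zle_def)
  hence "represents n f x" using cal_imp_calderon(1) by (auto simp: represents_iff)
  hence "{cal_norm f | f. represents n f x} \<noteq> {}" by blast
  from cInf_lessD[OF this] assms(2) obtain g where "represents n g x" "cal_norm g < C"
    unfolding zn_norm_def by auto
  thus ?thesis unfolding zle_def represents_iff
    using calderon_imp_cal cal_mono less_imp_le by blast
qed

lemma zle_nonneg: "zle n x B \<Longrightarrow> 0 \<le> B"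
  using cal_nonneg by (auto simp: zle_def)

lemma zn_norm_nonneg: "zle n x B \<Longrightarrow> 0 \<le> zn_norm n x"
  unfolding zn_norm_def
proof (rule cInf_greatest)
  assume "zle n x B"
  hence "\<exists>f. represents n f x" using cal_imp_calderon(1) unfolding represents_iff zle_def by blast
  thus "{cal_norm f | f. represents n f x} \<noteq> {}" by blast
qed (auto simp: represents_iff intro: cal_norm_nonneg)

lemma zle_mono: "zle n x B \<Longrightarrow> B \<le> C \<Longrightarrow> zle n x C"
  unfolding zle_def using cal_mono by blast

lemma zle_cong: "(\<And>j k. j < n \<Longrightarrow> x j k = y j k) \<Longrightarrow> zle n x B = zle n y B"
  unfolding zle_def by simp

lemma zle_zero: "0 \<le> B \<Longrightarrow> zle n (\<lambda>j k. 0) B"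
  unfolding zle_def by (rule exI[of _ "\<lambda>z k. 0"]) (simp add: cal_zero)

lemma zle_add: "zle n x B \<Longrightarrow> zle n y C \<Longrightarrow> zle n (\<lambda>j k. x j k + y j k) (B + C)"
  unfolding zle_def
proof safe
  fix f g assume "cal B f" "cal C g" "\<forall>j<n. \<forall>k. x j k = jet f j k" "\<forall>j<n. \<forall>k. y j k = jet g j k"
  thus "\<exists>h. cal (B + C) h \<and> (\<forall>j<n. \<forall>k. x j k + y j k = jet h j k)"
    by (intro exI[of _ "\<lambda>z k. f z k + g z k"]) (auto intro!: cal_add simp: tc_add[OF cal_hol cal_hol])
qed

lemma zle_scale: "zle n x B \<Longrightarrow> zle n (\<lambda>j k. c * x j k) (cmod c * B)"
  unfolding zle_def
proof safe
  fix f assume "cal B f" "\<forall>j<n. \<forall>k. x j k = jet f j k"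
  thus "\<exists>h. cal (cmod c * B) h \<and> (\<forall>j<n. \<forall>k. c * x j k = jet h j k)"
    by (intro exI[of _ "\<lambda>z k. c * f z k"]) (auto intro!: cal_scale simp: tc_cmult[OF cal_hol])
qed

lemma zle_diff: "zle n x B \<Longrightarrow> zle n y C \<Longrightarrow> zle n (\<lambda>j k. x j k - y j k) (B + C)"
  using zle_add[of n x B "\<lambda>j k. -1 * y j k" C] zle_scale[of n y C "-1"] by simp

lemma zle_sum:
  assumes "finite I" "\<And>i. i \<in> I \<Longrightarrow> zle n (x i) (B i)"
  shows "zle n (\<lambda>j k. \<Sum>i\<in>I. x i j k) (\<Sum>i\<in>I. B i)"
  using assms
proof (induction I rule: finite_induct)
  case (insert i I)
  have "zle n (\<lambda>j k. x i j k + (\<Sum>i\<in>I. x i j k)) (B i + (\<Sum>i\<in>I. B i))"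
    using insert by (intro zle_add) auto
  thus ?case using insert by simp
qed (simp add: zle_zero)

definition pr :: "nat set \<Rightarrow> zelem \<Rightarrow> zelem" where
  "pr A x = (\<lambda>j k. if k \<in> A then x j k else 0)"

lemma zle_pr: "zle n x B \<Longrightarrow> zle n (pr A x) B"
  unfolding zle_def
proof safe
  fix f assume f: "cal B f" "\<forall>j<n. \<forall>k. x j k = jet f j k"
  have "pr A x j k = tc (\<lambda>z. if k \<in> A then f z k else 0) j" if "j < n" for j k
    using f that by (cases "k \<in> A") (auto simp: pr_def)
  with f(1) show "\<exists>h. cal B h \<and> (\<forall>j<n. \<forall>k. pr A x j k = jet h j k)"
    by (intro exI[of _ "\<lambda>z k. if k \<in> A then f z k else 0"]) (auto intro: cal_restrict)
qed

lemma zle_coord: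
  assumes "zle n x B" "j < n"
  shows "cmod (x j k) \<le> B * 4 ^ j"
proof -
  obtain f where f: "cal B f" "x j k = jet f j k" using assms by (auto simp: zle_def)
  show ?thesis unfolding f(2)
    by (intro tc_bound cal_hol[OF f(1)] cal_bound[OF f(1)]) (use strip_subset in auto)
qed

lemma zle_suminf:
  assumes "\<And>i. zle n (x i) (B i)" "summable B"
  shows "zle n (\<lambda>j k. \<Sum>i. x i j k) (\<Sum>i. B i)" and "j < n \<Longrightarrow> summable (\<lambda>i. x i j k)"
proof -
  obtain f where f: "\<And>i. cal (B i) (f i)" "\<And>i j k. j < n \<Longrightarrow> x i j k = jet (f i) j k"
    using assms(1) unfolding zle_def by metis
  note * = cal_suminf[OF f(1) assms(2)]
  show "zle n (\<lambda>j k. \<Sum>i. x i j k) (\<Sum>i. B i)"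
    unfolding zle_def using * f(2) by (intro exI[of _ "\<lambda>z k. \<Sum>i. f i z k"]) auto
  show "j < n \<Longrightarrow> summable (\<lambda>i. x i j k)" using * f(2) by simp
qed

subsection \<open>Bounded holomorphic functions with prescribed jets\<close>

definition sfun :: "(complex \<Rightarrow> complex) \<Rightarrow> bool" where
  "sfun G \<longleftrightarrow> continuous_on cl_strip G \<and> G holomorphic_on strip \<and> (\<exists>K. \<forall>z\<in>cl_strip. cmod (G z) \<le> K)"

lemma sfun_cont: "sfun G \<Longrightarrow> continuous_on cl_strip G"
  and sfun_hol: "sfun G \<Longrightarrow> G holomorphic_on strip"
  by (auto simp: sfun_def)

lemma sfun_const: "sfun (\<lambda>z. c)"
  by (auto simp: sfun_def)

lemma sfun_add:
  assumes "sfun F" "sfun G" shows "sfun (\<lambda>z. F z + G z)"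
proof -
  obtain K L where K: "\<And>z. z \<in> cl_strip \<Longrightarrow> cmod (F z) \<le> K" and L: "\<And>z. z \<in> cl_strip \<Longrightarrow> cmod (G z) \<le> L"
    using assms by (auto simp: sfun_def)
  have "cmod (F z + G z) \<le> K + L" if "z \<in> cl_strip" for z
    using norm_triangle_ineq[of "F z" "G z"] K[OF that] L[OF that] by linarith
  thus ?thesis using assms unfolding sfun_def by (auto intro!: continuous_intros holomorphic_intros)
qed

lemma sfun_mult:
  assumes "sfun F" "sfun G" shows "sfun (\<lambda>z. F z * G z)"
proof -
  obtain K L where K: "\<And>z. z \<in> cl_strip \<Longrightarrow> cmod (F z) \<le> K" and L: "\<And>z. z \<in> cl_strip \<Longrightarrow> cmod (G z) \<le> L"
    using assms by (auto simp: sfun_def)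
  have "cmod (F z * G z) \<le> K * L" if "z \<in> cl_strip" for z
    unfolding norm_mult using K[OF that] L[OF that] order_trans[OF norm_ge_zero K[OF that]] by (intro mult_mono) auto
  thus ?thesis using assms unfolding sfun_def by (auto intro!: continuous_intros holomorphic_intros)
qed

lemma sfun_sum: "(\<And>i. i \<in> I \<Longrightarrow> sfun (F i)) \<Longrightarrow> sfun (\<lambda>z. \<Sum>i\<in>I. F i z)"
  by (induction I rule: infinite_finite_induct) (auto intro: sfun_add sfun_const)

lemma sfun_power: "sfun F \<Longrightarrow> sfun (\<lambda>z. F z ^ j)"
  by (induction j) (auto intro: sfun_mult sfun_const)

lemma sfun_exp: "sfun (\<lambda>z. exp (of_real c * (2 * z - 1)))"
proof -
  have "cmod (exp (of_real c * (2 * z - 1))) \<le> exp \<bar>c\<bar>" if "z \<in> cl_strip" for z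
  proof -
    have "\<bar>2 * Re z - 1\<bar> \<le> 1" using that unfolding cl_strip_def by (simp add: abs_if)
    hence "\<bar>c * (2 * Re z - 1)\<bar> \<le> \<bar>c\<bar> * 1" unfolding abs_mult by (intro mult_left_mono) auto
    hence "c * (2 * Re z - 1) \<le> \<bar>c\<bar>" by linarith
    thus ?thesis by (simp add: norm_exp_eq_Re)
  qed
  thus ?thesis unfolding sfun_def by (auto intro!: continuous_intros holomorphic_intros)
qed

lemma sfun_reflect:
  assumes "sfun G" shows "sfun (\<lambda>z. G (1 - z))"
proof -
  have r: "1 - z \<in> cl_strip" if "z \<in> cl_strip" for z using that by (auto simp: cl_strip_def)
  have r': "1 - z \<in> strip" if "z \<in> strip" for z using that by (auto simp: strip_def)
  have "continuous_on cl_strip (\<lambda>z. G (1 - z))"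
    by (rule continuous_on_compose2[OF sfun_cont[OF assms]]) (auto intro!: continuous_intros r)
  moreover have "(G \<circ> (\<lambda>z. 1 - z)) holomorphic_on strip"
    by (rule holomorphic_on_compose_gen[OF _ sfun_hol[OF assms]]) (auto intro!: holomorphic_intros r')
  hence "(\<lambda>z. G (1 - z)) holomorphic_on strip" by (simp add: o_def)
  moreover obtain K where "\<And>z. z \<in> cl_strip \<Longrightarrow> cmod (G z) \<le> K" using assms by (auto simp: sfun_def)
  hence "\<forall>z\<in>cl_strip. cmod (G (1 - z)) \<le> K" using r by blast
  ultimately show ?thesis unfolding sfun_def by blast
qed

lemma cal_sfun:
  assumes "cal B f" shows "sfun (\<lambda>z. f z k)"
  unfolding sfun_def using cal_cont[OF assms] cal_hol[OF assms] cal_bound[OF assms] by blast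

lemma sfun_max_principle:
  assumes F: "sfun F" and M0: "\<And>t::real. cmod (F (\<i> * of_real t)) \<le> M"
    and M1: "\<And>t::real. cmod (F (1 + \<i> * of_real t)) \<le> M" and z: "z \<in> cl_strip"
  shows "cmod (F z) \<le> M"
proof -
  obtain K where K: "\<And>z. z \<in> cl_strip \<Longrightarrow> cmod (F z) \<le> K" using F by (auto simp: sfun_def)
  show ?thesis
  proof (rule strip_maximum_principle[OF sfun_cont[OF F] sfun_hol[OF F] K _ z])
    fix z assume "Re z = 0 \<or> Re z = 1"
    hence "z = \<i> * of_real (Im z) \<or> z = 1 + \<i> * of_real (Im z)" by (auto simp: complex_eq_iff)
    thus "cmod (F z) \<le> M" using M0[of "Im z"] M1[of "Im z"] by auto
  qed
qed

lemma tc_lincomb: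
  assumes "\<And>i. i \<in> I \<Longrightarrow> sfun (F i)"
  shows "tc (\<lambda>z. \<Sum>i\<in>I. c i * F i z) l = (\<Sum>i\<in>I. c i * tc (F i) l)"
proof -
  have "tc (\<lambda>z. \<Sum>i\<in>I. c i * F i z) l = (\<Sum>i\<in>I. tc (\<lambda>z. c i * F i z) l)"
    by (rule tc_sum, rule sfun_hol, rule sfun_mult, rule sfun_const, rule assms)
  also have "\<dots> = (\<Sum>i\<in>I. c i * tc (F i) l)"
    by (rule sum.cong[OF refl]) (rule tc_cmult, rule sfun_hol, rule assms)
  finally show ?thesis .
qed

lemma cal_finite_sfun:
  assumes fin: "finite A" and supp: "\<And>z k. k \<notin> A \<Longrightarrow> f z k = 0"
    and sf: "\<And>k. k \<in> A \<Longrightarrow> sfun (\<lambda>z. f z k)"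
    and b0: "\<And>k t::real. k \<in> A \<Longrightarrow> cmod (f (\<i> * of_real t) k) \<le> B"
    and b1: "\<And>t::real. (\<Sum>k\<in>A. cmod (f (1 + \<i> * of_real t) k)) \<le> B"
  shows "cal B f"
proof (rule cal_finite[OF fin supp _ _ _ b0 b1, where B'=B])
  fix k z assume k: "k \<in> A" and z: "z \<in> cl_strip"
  show "cmod (f z k) \<le> B"
  proof (rule sfun_max_principle[OF sf[OF k] b0[OF k] _ z])
    fix t :: real
    have "cmod (f (1 + \<i> * of_real t) k) \<le> (\<Sum>k\<in>A. cmod (f (1 + \<i> * of_real t) k))"
      using k fin by (intro member_le_sum) auto
    thus "cmod (f (1 + \<i> * of_real t) k) \<le> B" using b1[of t] by linarith
  qed
qed (use sf in \<open>auto simp: sfun_def\<close>)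

lemma cal_l1_finite:
  assumes "cal B f" "finite U"
  shows "(\<Sum>k\<in>U. cmod (f (1 + \<i> * of_real t) k)) \<le> B"
proof -
  obtain N where N: "U \<subseteq> {..<N}" using assms(2) finite_nat_bounded by blast
  have "(\<Sum>k\<in>U. cmod (f (1 + \<i> * of_real t) k)) \<le> (\<Sum>k<N. cmod (f (1 + \<i> * of_real t) k))"
    using N by (intro sum_mono2) auto
  thus ?thesis using cal_l1[OF assms(1), of t N] by linarith
qed

text \<open>On each boundary line one factor is in \<open>\<ell>\<^sub>\<infinity>\<close> and the other, evaluated at the reflected point,
  in \<open>\<ell>\<^sub>1\<close>; this is the duality that yields all lower estimates.\<close>

lemma cal_pairing:
  assumes f: "cal B f" and g: "cal D g" and U: "finite U"
  shows "sfun (\<lambda>z. \<Sum>k\<in>U. f z k * g (1 - z) k)"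
    and "cmod (tc (\<lambda>z. \<Sum>k\<in>U. f z k * g (1 - z) k) j) \<le> B * D * 4 ^ j"
proof -
  let ?F = "\<lambda>z. \<Sum>k\<in>U. f z k * g (1 - z) k"
  show sf: "sfun ?F"
    by (intro sfun_sum sfun_mult cal_sfun[OF f] sfun_reflect[OF cal_sfun[OF g]])
  have cl: "\<i> * of_real t \<in> cl_strip" "- (\<i> * of_real t) \<in> cl_strip" for t :: real by (auto simp: cl_strip_def)
  have "B \<ge> 0" "D \<ge> 0" using cal_nonneg f g by auto
  have b0: "cmod (?F (\<i> * of_real t)) \<le> B * D" for t :: real
  proof -
    have "cmod (?F (\<i> * of_real t)) \<le> (\<Sum>k\<in>U. cmod (f (\<i> * of_real t) k) * cmod (g (1 - \<i> * of_real t) k))"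
      by (rule order_trans[OF norm_sum]) (simp add: norm_mult)
    also have "\<dots> \<le> (\<Sum>k\<in>U. B * cmod (g (1 + \<i> * of_real (-t)) k))"
      by (intro sum_mono) (auto intro!: mult_right_mono cal_bound[OF f] simp: cl)
    also have "\<dots> \<le> B * D"
      unfolding sum_distrib_left[symmetric] by (intro mult_left_mono cal_l1_finite[OF g U] \<open>B \<ge> 0\<close>)
    finally show ?thesis .
  qed
  have b1: "cmod (?F (1 + \<i> * of_real t)) \<le> B * D" for t :: real
  proof -
    have "cmod (?F (1 + \<i> * of_real t)) \<le> (\<Sum>k\<in>U. cmod (f (1 + \<i> * of_real t) k) * cmod (g (- (\<i> * of_real t)) k))"
      by (rule order_trans[OF norm_sum]) (simp add: norm_mult)
    also have "\<dots> \<le> (\<Sum>k\<in>U. cmod (f (1 + \<i> * of_real t) k) * D)"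
      by (intro sum_mono) (auto intro!: mult_left_mono cal_bound[OF g] simp: cl)
    also have "\<dots> \<le> B * D"
      unfolding sum_distrib_right[symmetric] by (intro mult_right_mono cal_l1_finite[OF f U] \<open>D \<ge> 0\<close>)
    finally show ?thesis .
  qed
  have "cmod (?F z) \<le> B * D" if "z \<in> cl_strip" for z
    by (rule sfun_max_principle[OF sf b0 b1 that])
  thus "cmod (tc ?F j) \<le> B * D * 4 ^ j"
    using strip_subset by (intro tc_bound sfun_hol[OF sf]) auto
qed

text \<open>The Cayley map of the right half plane onto the unit disc that sends \<open>1/2\<close>
  to 0. It is a bounded substitute for \<open>z - 1/2\<close>, with derivative 1 at
  \<open>1/2\<close>.\<close>

definition psi :: "complex \<Rightarrow> complex" where
  "psi z = (z - 1/2) / (z + 1/2)"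

lemma psi_le_1: "z \<in> cl_strip \<Longrightarrow> cmod (psi z) \<le> 1"
proof -
  assume "z \<in> cl_strip"
  hence x: "0 \<le> Re z" by (simp add: cl_strip_def)
  have "(cmod (z - 1/2))\<^sup>2 \<le> (cmod (z + 1/2))\<^sup>2"
    unfolding cmod_power2 using x by (simp add: power2_eq_square algebra_simps)
  hence "cmod (z - 1/2) \<le> cmod (z + 1/2)" by (rule power2_le_imp_le) simp
  thus ?thesis unfolding psi_def norm_divide by (rule divide_le_eq_1_pos[THEN iffD2, rotated])
     (use x in \<open>auto simp: complex_eq_iff\<close>)
qed

lemma psi_den: "z \<in> cl_strip \<Longrightarrow> z + 1/2 \<noteq> 0"
  by (auto simp: cl_strip_def complex_eq_iff)

lemma sfun_psi: "sfun psi"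
  unfolding sfun_def psi_def[abs_def]
proof (intro conjI exI ballI)
  show "continuous_on cl_strip (\<lambda>z. (z - 1/2) / (z + 1/2))"
    using psi_den by (intro continuous_intros) auto
  show "(\<lambda>z. (z - 1/2) / (z + 1/2)) holomorphic_on strip"
    using psi_den strip_subset by (intro holomorphic_intros) auto
  fix z assume "z \<in> cl_strip"
  thus "cmod ((z - 1/2) / (z + 1/2)) \<le> 1" using psi_le_1 by (simp add: psi_def)
qed

lemma tc_psi: "tc psi 0 = 0" "tc psi 1 = 1"
proof -
  show "tc psi 0 = 0" by (simp add: tc_def psi_def)
  have "(psi has_field_derivative 1) (at (1/2))"
    unfolding psi_def[abs_def] by (auto intro!: derivative_eq_intros)
  thus "tc psi 1 = 1" by (simp add: tc_def DERIV_imp_deriv)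
qed

lemma tc_psi_power: "(\<forall>l<j. tc (\<lambda>z. psi z ^ j) l = 0) \<and> tc (\<lambda>z. psi z ^ j) j = 1"
proof (induction j)
  case 0
  thus ?case by (simp add: tc_const)
next
  case (Suc j)
  have eq: "tc (\<lambda>z. psi z ^ Suc j) l = (\<Sum>i=0..l. tc psi i * tc (\<lambda>z. psi z ^ j) (l - i))" for l
    using tc_mult[OF sfun_hol[OF sfun_psi] sfun_hol[OF sfun_power[OF sfun_psi]]] by simp
  have "tc (\<lambda>z. psi z ^ Suc j) l = 0" if "l < Suc j" for l
    unfolding eq
  proof (intro sum.neutral ballI)
    fix i assume "i \<in> {0..l}"
    thus "tc psi i * tc (\<lambda>z. psi z ^ j) (l - i) = 0"
      using Suc.IH that by (cases "i = 0") (auto simp: tc_psi)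
  qed
  moreover have "(\<Sum>i=0..Suc j. tc psi i * tc (\<lambda>z. psi z ^ j) (Suc j - i)) = (\<Sum>i\<in>{1}. tc psi i * tc (\<lambda>z. psi z ^ j) (Suc j - i))"
  proof (intro sum.mono_neutral_right ballI)
    fix i assume "i \<in> {0..Suc j} - {1}"
    thus "tc psi i * tc (\<lambda>z. psi z ^ j) (Suc j - i) = 0"
      using Suc.IH by (cases "i = 0") (auto simp: tc_psi)
  qed auto
  hence "tc (\<lambda>z. psi z ^ Suc j) (Suc j) = 1"
    using Suc.IH tc_psi unfolding eq by simp
  ultimately show ?case by blast
qed

text \<open>Powers of \<open>psi\<close> are triangular with respect to the monomials at \<open>1/2\<close> but, unlike these, bounded on the strip.\<close>

lemma bounded_monomial_jet:
  assumes "j < n"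
  shows "\<exists>G. sfun G \<and> (\<forall>l<n. tc G l = (if l = j then 1 else 0))"
  using assms
proof (induction "n - j" arbitrary: j rule: less_induct)
  case less
  have "\<forall>i\<in>{j<..<n}. \<exists>G. sfun G \<and> (\<forall>l<n. tc G l = (if l = i then 1 else 0))"
  proof
    fix i assume "i \<in> {j<..<n}"
    thus "\<exists>G. sfun G \<and> (\<forall>l<n. tc G l = (if l = i then 1 else 0))"
      by (intro less.hyps) auto
  qed
  then obtain G where G: "\<And>i. i \<in> {j<..<n} \<Longrightarrow> sfun (G i)"
      "\<And>i l. i \<in> {j<..<n} \<Longrightarrow> l < n \<Longrightarrow> tc (G i) l = (if l = i then 1 else 0)" by metis
  let ?P = "\<lambda>z. psi z ^ j"
  \<comment> \<open>The induction descends in \<open>j\<close>: the higher monomials already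
    constructed clear the coefficients of \<open>psi^j\<close> above order \<open>j\<close>.\<close>
  let ?Q = "\<lambda>z. \<Sum>i\<in>{j<..<n}. - tc ?P i * G i z"
  have P: "sfun ?P" by (rule sfun_power[OF sfun_psi])
  have Q: "sfun ?Q" by (intro sfun_sum sfun_mult sfun_const G)
  have "tc (\<lambda>z. ?P z + ?Q z) l = (if l = j then 1 else 0)" if l: "l < n" for l
  proof -
    have "tc ?Q l = (\<Sum>i\<in>{j<..<n}. - tc ?P i * tc (G i) l)"
      by (rule tc_lincomb) (rule G)
    also have "\<dots> = (\<Sum>i\<in>{j<..<n}. if i = l then - tc ?P i else 0)"
      using l by (intro sum.cong) (auto simp: G)
    also have "\<dots> = (if l \<in> {j<..<n} then - tc ?P l else 0)"
      by (subst sum.delta) auto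
    finally have "tc (\<lambda>z. ?P z + ?Q z) l = tc ?P l + (if l \<in> {j<..<n} then - tc ?P l else 0)"
      by (simp only: tc_add[OF sfun_hol[OF P] sfun_hol[OF Q]])
    thus ?thesis using tc_psi_power[of j] l by (cases l j rule: linorder_cases) auto
  qed
  thus ?case using sfun_add[OF P Q] by blast
qed

lemma bounded_monomial_jets:
  "\<exists>Psi K. K \<ge> 0 \<and> (\<forall>j<n. sfun (Psi j) \<and> (\<forall>z\<in>cl_strip. cmod (Psi j z) \<le> K)
      \<and> (\<forall>l<n. tc (Psi j) l = (if l = j then 1 else 0)))"
proof -
  obtain Psi where P: "\<And>j. j < n \<Longrightarrow> sfun (Psi j)"
      "\<And>j l. j < n \<Longrightarrow> l < n \<Longrightarrow> tc (Psi j) l = (if l = j then 1 else 0)"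
    using bounded_monomial_jet[of _ n] by metis
  have "\<forall>j\<in>{..<n}. \<exists>K. \<forall>z\<in>cl_strip. cmod (Psi j z) \<le> K" using P(1) by (auto simp: sfun_def)
  then obtain K where K: "\<And>j z. j < n \<Longrightarrow> z \<in> cl_strip \<Longrightarrow> cmod (Psi j z) \<le> K j" by (metis lessThan_iff)
  have "cmod (Psi j z) \<le> (\<Sum>j<n. \<bar>K j\<bar>)" if "j < n" "z \<in> cl_strip" for j z
  proof -
    have "cmod (Psi j z) \<le> \<bar>K j\<bar>" using K[OF that] by linarith
    also have "\<dots> \<le> (\<Sum>j<n. \<bar>K j\<bar>)" using that by (intro member_le_sum) auto
    finally show ?thesis .
  qed
  moreover have "(\<Sum>j<n. \<bar>K j\<bar>) \<ge> 0" by (intro sum_nonneg) auto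
  ultimately show ?thesis using P by (intro exI[of _ Psi] exI[of _ "\<Sum>j<n. \<bar>K j\<bar>"]) auto
qed

text \<open>Elements supported on finitely many coordinates form a finite-dimensional space, so
  their norm is controlled by the size of the entries; the constant may depend on
  \<open>N\<close>.\<close>

lemma zle_small_support:
  "\<exists>K\<ge>0. \<forall>x e. (\<forall>j<n. \<forall>k. k \<ge> N \<longrightarrow> x j k = 0) \<and> (\<forall>j<n. \<forall>k. cmod (x j k) \<le> e) \<and> e \<ge> 0 \<longrightarrow> zle n x (K * e)"
proof -
  obtain Psi K where K: "K \<ge> 0" and Psi: "\<And>j. j < n \<Longrightarrow> sfun (Psi j)" "\<And>j z. j < n \<Longrightarrow> z \<in> cl_strip \<Longrightarrow> cmod (Psi j z) \<le> K"
      "\<And>j l. j < n \<Longrightarrow> l < n \<Longrightarrow> tc (Psi j) l = (if l = j then 1 else 0)"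
    using bounded_monomial_jets[of n] by metis
  \<comment> \<open>The factor is \<open>N + 1\<close> and not \<open>N\<close>, so that it is at
    least 1 and the same constant serves the sup norm on \<open>Re z = 0\<close>.\<close>
  define K' where "K' = (real N + 1) * (real n * K)"
  have "zle n x (K' * e)" if x: "\<forall>j<n. \<forall>k. k \<ge> N \<longrightarrow> x j k = 0" and e: "\<forall>j<n. \<forall>k. cmod (x j k) \<le> e" "e \<ge> 0" for x :: zelem and e
  proof -
    define f where "f = (\<lambda>z k. \<Sum>j<n. x j k * Psi j z)"
    have bd: "cmod (f z k) \<le> real n * K * e" if "z \<in> cl_strip" for z k
    proof -
      have "cmod (f z k) \<le> (\<Sum>j<n. cmod (x j k) * cmod (Psi j z))"
        unfolding f_def by (rule order_trans[OF norm_sum]) (simp add: norm_mult)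
      also have "\<dots> \<le> (\<Sum>j<n. e * K)"
        using e K Psi(2)[OF _ that] by (intro sum_mono mult_mono) auto
      finally show ?thesis by (simp add: mult_ac)
    qed
    have nn: "real n * K * e \<ge> 0" using K e by simp
    have "cal (K' * e) f"
    proof (rule cal_finite_sfun[of "{..<N}"])
      fix z k assume "k \<notin> {..<N}"
      thus "f z k = 0" using x by (simp add: f_def)
    next
      fix k show "sfun (\<lambda>z. f z k)" unfolding f_def
        by (intro sfun_sum sfun_mult sfun_const Psi) auto
    next
      fix k and t :: real
      have "cmod (f (\<i> * of_real t) k) \<le> real n * K * e" by (rule bd) (simp add: cl_strip_def)
      also have "\<dots> \<le> (real N + 1) * (real n * K * e)" using mult_right_mono[of 1 "real N + 1", OF _ nn] by simp
      finally show "cmod (f (\<i> * of_real t) k) \<le> K' * e" by (simp add: K'_def mult_ac)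
    next
      fix t :: real
      have "(\<Sum>k<N. cmod (f (1 + \<i> * of_real t) k)) \<le> (\<Sum>k<N. real n * K * e)"
        by (intro sum_mono bd) (simp add: cl_strip_def)
      also have "\<dots> \<le> (real N + 1) * (real n * K * e)" using nn by (simp add: algebra_simps)
      finally show "(\<Sum>k<N. cmod (f (1 + \<i> * of_real t) k)) \<le> K' * e" by (simp add: K'_def mult_ac)
    qed simp
    moreover have "x j k = jet f j k" if j: "j < n" for j k
    proof -
      have "jet f j k = (\<Sum>i<n. x i k * tc (Psi i) j)" unfolding f_def
        by (rule tc_lincomb) (auto intro: Psi)
      also have "\<dots> = (\<Sum>i<n. if i = j then x i k else 0)" using j by (intro sum.cong) (auto simp: Psi)
      also have "\<dots> = x j k" using j by (subst sum.delta) auto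
      finally show ?thesis ..
    qed
    ultimately show ?thesis unfolding zle_def by blast
  qed
  moreover have "K' \<ge> 0" using K by (simp add: K'_def)
  ultimately show ?thesis by blast
qed

text \<open>With \<open>L = ln (1/|a|)\<close> and \<open>M = L - N ln L\<close> the factor \<open>a exp(-M(2z-1))\<close> has modulus \<open>L^(-N)\<close> on
  \<open>Re z = 0\<close> and \<open>|a|^2 L^N\<close> on \<open>Re z = 1\<close>, which absorbs the growth \<open>L^N\<close> of the \<open>N\<close>-jet of \<open>exp(M(2z-1))\<close>.\<close>

lemma scalar_upper_function:
  "\<exists>K\<ge>0. \<forall>a. cmod a \<le> exp (-1) \<longrightarrow> (\<exists>b. sfun b \<and> (\<forall>t::real. cmod (b (\<i> * of_real t)) \<le> K) \<and>
      (\<forall>t::real. cmod (b (1 + \<i> * of_real t)) \<le> K * fk (Suc N) (cmod a)) \<and>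
      (\<forall>l\<le>N. tc b l = (if l = 0 then a else 0)))"
proof -
  obtain Psi K0 where K0: "K0 \<ge> 0" and Psi: "\<And>j. j \<le> N \<Longrightarrow> sfun (Psi j)" "\<And>j z. j \<le> N \<Longrightarrow> z \<in> cl_strip \<Longrightarrow> cmod (Psi j z) \<le> K0"
      "\<And>j l. j \<le> N \<Longrightarrow> l \<le> N \<Longrightarrow> tc (Psi j) l = (if l = j then 1 else 0)"
    using bounded_monomial_jets[of "Suc N"] unfolding less_Suc_eq_le by metis
  \<comment> \<open>The function \<open>q\<close> below has \<open>N + 1\<close> terms, each at most
    \<open>(2 (N + 1) L)^N K0\<close>; the power of \<open>L\<close> is split off.\<close>
  define K where "K = (real N + 1) * (2 * (real N + 1)) ^ N * K0"
  have "K \<ge> 0" using K0 by (simp add: K_def)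
  moreover have "\<exists>b. sfun b \<and> (\<forall>t::real. cmod (b (\<i> * of_real t)) \<le> K) \<and>
      (\<forall>t::real. cmod (b (1 + \<i> * of_real t)) \<le> K * fk (Suc N) (cmod a)) \<and>
      (\<forall>l\<le>N. tc b l = (if l = 0 then a else 0))" if a: "cmod a \<le> exp (-1)" for a
  proof (cases "a = 0")
    case True
    thus ?thesis using \<open>K \<ge> 0\<close> by (intro exI[of _ "\<lambda>z. 0"]) (auto simp: sfun_const fk_def)
  next
    case False
    define t where "t = cmod a"
    define L where "L = - ln t"
    define M where "M = L - real N * ln L"
    have t: "t > 0" "t \<le> exp (-1)" using False a by (auto simp: t_def)
    have "ln t \<le> ln (exp (-1))" using t by (subst ln_le_cancel_iff) auto
    hence L: "L \<ge> 1" by (simp add: L_def)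
    have lnL: "0 \<le> ln L" "ln L \<le> L" using L ln_le_minus_one[of L] by auto
    have Mb: "\<bar>M\<bar> \<le> (real N + 1) * L"
    proof -
      have "\<bar>M\<bar> \<le> \<bar>L\<bar> + \<bar>real N * ln L\<bar>" unfolding M_def by (rule abs_triangle_ineq4)
      also have "\<dots> = L + real N * ln L" using L lnL by simp
      also have "\<dots> \<le> L + real N * L" using lnL by (intro add_mono mult_left_mono) auto
      finally show ?thesis by (simp add: algebra_simps)
    qed
    have eM: "exp M = 1 / (t * L ^ N)"
    proof -
      have "exp (real N * ln L) = L ^ N" using L by (simp add: exp_of_nat_mult)
      thus ?thesis using t by (simp add: M_def L_def exp_diff exp_minus field_simps)
    qed
    \<comment> \<open>\<open>q\<close> copies the \<open>N\<close>-jet of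
      \<open>exp (M (2 z - 1))\<close> but has size only \<open>O(L^N)\<close> on the strip.
      Multiplied by \<open>a E (-M)\<close> it yields the \<open>N\<close>-jet of the constant
      \<open>a\<close>.\<close>
    define q where "q = (\<lambda>z. \<Sum>l\<le>N. (2 * of_real M) ^ l / fact l * Psi l z)"
    define E where "E = (\<lambda>c z. exp (of_real c * (2 * z - 1)) :: complex)"
    define b where "b = (\<lambda>z. a * E (-M) z * q z)"
    have sq: "sfun q" unfolding q_def by (intro sfun_sum sfun_mult sfun_const Psi) auto
    have sE: "sfun (E c)" for c unfolding E_def by (rule sfun_exp)
    have sb: "sfun b" unfolding b_def by (intro sfun_mult sfun_const sE sq)
    have qb: "cmod (q z) \<le> K * L ^ N" if z: "z \<in> cl_strip" for z
    proof -
      have "cmod (q z) \<le> (\<Sum>l\<le>N. cmod ((2 * of_real M) ^ l / fact l * Psi l z))"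
        unfolding q_def by (rule norm_sum)
      also have "\<dots> \<le> (\<Sum>l\<le>N. (2 * (real N + 1) * L) ^ N * K0)"
      proof (rule sum_mono)
        fix l assume l: "l \<in> {..N}"
        have "cmod ((2 * of_real M) ^ l / fact l) = (2 * \<bar>M\<bar>) ^ l / fact l"
          by (simp add: norm_divide norm_power norm_mult)
        also have "\<dots> \<le> (2 * \<bar>M\<bar>) ^ l" using divide_left_mono[of 1 "fact l" "(2 * \<bar>M\<bar>) ^ l"] by simp
        also have "\<dots> \<le> (2 * (real N + 1) * L) ^ l" using Mb by (intro power_mono) (auto simp: algebra_simps)
        also have "\<dots> \<le> (2 * (real N + 1) * L) ^ N"
        proof (rule power_increasing)
          have "1 * 1 \<le> (2 * (real N + 1)) * L" using L by (intro mult_mono) auto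
          thus "1 \<le> 2 * (real N + 1) * L" by simp
        qed (use l in auto)
        finally have "cmod ((2 * of_real M) ^ l / fact l) \<le> (2 * (real N + 1) * L) ^ N" .
        moreover have "cmod (Psi l z) \<le> K0" using l z by (intro Psi) auto
        ultimately show "cmod ((2 * of_real M) ^ l / fact l * Psi l z) \<le> (2 * (real N + 1) * L) ^ N * K0"
          unfolding norm_mult using L by (intro mult_mono) auto
      qed
      also have "\<dots> = K * L ^ N" by (simp add: K_def power_mult_distrib mult_ac)
      finally show ?thesis .
    qed
    have "cmod (b (\<i> * of_real s)) \<le> K" for s :: real
    proof -
      have "cmod (b (\<i> * of_real s)) = t * exp M * cmod (q (\<i> * of_real s))"
        by (simp add: b_def E_def norm_mult norm_exp_eq_Re t_def)
      also have "\<dots> \<le> t * exp M * (K * L ^ N)"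
        using t by (intro mult_left_mono qb) (auto simp: cl_strip_def)
      also have "\<dots> = K" using t L by (simp add: eM)
      finally show ?thesis .
    qed
    moreover have "cmod (b (1 + \<i> * of_real s)) \<le> K * fk (Suc N) (cmod a)" for s :: real
    proof -
      have "cmod (b (1 + \<i> * of_real s)) = t * exp (- M) * cmod (q (1 + \<i> * of_real s))"
        by (simp add: b_def E_def norm_mult norm_exp_eq_Re t_def)
      also have "\<dots> \<le> t * exp (- M) * (K * L ^ N)"
        using t by (intro mult_left_mono qb) (auto simp: cl_strip_def)
      also have "\<dots> = K * (t\<^sup>2 * (L ^ N)\<^sup>2)" using t L by (simp add: eM exp_minus power2_eq_square)
      also have "\<dots> = K * (t\<^sup>2 * ln t ^ (2 * N))"
        by (simp add: L_def power_even_eq[symmetric])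
      finally show ?thesis by (simp add: fk_def t_def)
    qed
    moreover have "tc b l = (if l = 0 then a else 0)" if l: "l \<le> N" for l
    proof -
      have tq: "tc q i = tc (E M) i" if "i \<le> l" for i
      proof -
        have "tc q i = (\<Sum>j\<le>N. (2 * of_real M) ^ j / fact j * tc (Psi j) i)" unfolding q_def
          by (rule tc_lincomb) (auto intro: Psi)
        also have "\<dots> = (\<Sum>j\<le>N. if j = i then (2 * of_real M) ^ j / fact j else 0)"
          using l that by (intro sum.cong) (auto simp: Psi)
        also have "\<dots> = (2 * of_real M) ^ i / fact i" using l that by (subst sum.delta) auto
        finally show ?thesis unfolding E_def tc_exp .
      qed
      have c: "(\<lambda>z. (a * E (-M) z) * E M z) = (\<lambda>z. a)"
        by (auto simp: E_def exp_minus fun_eq_iff)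
      have "tc b l = tc (\<lambda>z. (a * E (-M) z) * E M z) l" unfolding b_def
        using tq by (intro tc_mult_low sfun_hol sfun_mult sfun_const sE sq)
      thus ?thesis unfolding c by (simp add: tc_const)
    qed
    ultimately show ?thesis using sb by blast
  qed
  ultimately show ?thesis by blast
qed

subsection \<open>Disjoint blocks\<close>

definition l2n :: "nat set \<Rightarrow> cseq \<Rightarrow> real" where
  "l2n A y = sqrt (\<Sum>k\<in>A. (cmod (y k))\<^sup>2)"

lemma l2n_nonneg: "0 \<le> l2n A y"
  by (auto simp: l2n_def intro!: sum_nonneg)

lemma l2n_sq: "(l2n A y)\<^sup>2 = (\<Sum>k\<in>A. (cmod (y k))\<^sup>2)"
  by (auto simp: l2n_def intro!: sum_nonneg)

lemma l2n_pos: "finite A \<Longrightarrow> k \<in> A \<Longrightarrow> y k \<noteq> 0 \<Longrightarrow> l2n A y > 0"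
  unfolding l2n_def real_sqrt_gt_0_iff by (rule sum_pos2) auto

text \<open>The extremal function \<open>sgn(y) (|y|/\<parallel>y\<parallel>)^(2z)\<close> of the normalised vector \<open>y\<close>.\<close>

definition extr :: "nat set \<Rightarrow> cseq \<Rightarrow> complex \<Rightarrow> cseq" where
  "extr A y = (\<lambda>z k. if k \<in> A then (y k / of_real (l2n A y)) *
      exp (of_real (ln (cmod (y k) / l2n A y)) * (2 * z - 1)) else 0)"

lemma extr_half: "k \<in> A \<Longrightarrow> extr A y (1/2) k = y k / of_real (l2n A y)"
  by (simp add: extr_def)

lemma sfun_extr: "sfun (\<lambda>z. extr A y z k)"
proof (cases "k \<in> A")
  case True
  thus ?thesis unfolding extr_def by (simp only: if_True) (intro sfun_mult sfun_const sfun_exp)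
qed (simp add: extr_def sfun_const)

lemma extr_bound_0:
  assumes "finite A" shows "cmod (extr A y (\<i> * of_real t) k) \<le> 1"
proof (cases "k \<in> A \<and> y k \<noteq> 0")
  case True
  hence p: "l2n A y > 0" using l2n_pos assms by blast
  thus ?thesis using True
    by (simp add: extr_def norm_mult norm_divide norm_exp_eq_Re exp_minus)
qed (auto simp: extr_def)

lemma extr_bound_1:
  assumes "finite A" shows "(\<Sum>k\<in>A. cmod (extr A y (1 + \<i> * of_real t) k)) \<le> 1"
proof -
  have "cmod (extr A y (1 + \<i> * of_real t) k) = (cmod (y k))\<^sup>2 / (l2n A y)\<^sup>2" if k: "k \<in> A" for k
  proof (cases "y k = 0")
    case False
    hence p: "l2n A y > 0" using k l2n_pos assms by blast
    thus ?thesis using k False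
      by (simp add: extr_def norm_mult norm_divide norm_exp_eq_Re power2_eq_square)
  qed (simp add: extr_def)
  hence "(\<Sum>k\<in>A. cmod (extr A y (1 + \<i> * of_real t) k)) = (\<Sum>k\<in>A. (cmod (y k))\<^sup>2) / (l2n A y)\<^sup>2"
    by (simp add: sum_divide_distrib)
  also have "\<dots> \<le> 1" by (simp add: l2n_sq[symmetric])
  finally show ?thesis .
qed

lemma cal_extr: "finite A \<Longrightarrow> cal 1 (extr A y)"
proof (rule cal_finite_sfun[of A])
  fix z k assume "k \<notin> A"
  thus "extr A y z k = 0" by (simp add: extr_def)
qed (auto intro: sfun_extr extr_bound_0 extr_bound_1)

text \<open>\<open>psi^m\<close> kills the coefficients below order \<open>m\<close> and contributes
  the factor 1 at order \<open>m\<close>, where the extremal function supplies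
  \<open>y / l2n A y\<close>. Since \<open>psi\<close> is bounded by 1, the price is no more than
  the \<open>l2\<close> norm of \<open>y\<close>.\<close>

lemma jet_correction:
  assumes "finite A"
  shows "\<exists>g. cal (l2n A y) g \<and> (\<forall>z k. k \<notin> A \<longrightarrow> g z k = 0) \<and> (\<forall>j<m. \<forall>k. jet g j k = 0)
     \<and> (\<forall>k\<in>A. jet g m k = y k)"
proof -
  define g where "g = (\<lambda>z k. psi z ^ m * (of_real (l2n A y) * extr A y z k))"
  have supp: "g z k = 0" if "k \<notin> A" for z k using that by (simp add: g_def extr_def)
  have sf: "sfun (\<lambda>z. of_real (l2n A y) * extr A y z k)" for k by (intro sfun_mult sfun_const sfun_extr)
  have psi: "cmod (psi z ^ m) \<le> 1" if "z \<in> cl_strip" for z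
    using psi_le_1[OF that] by (simp add: norm_power power_le_one)
  have gb: "cmod (g z k) \<le> l2n A y * cmod (extr A y z k)" if "z \<in> cl_strip" for z k
  proof -
    have "cmod (g z k) = cmod (psi z ^ m) * (l2n A y * cmod (extr A y z k))"
      by (simp add: g_def norm_mult l2n_nonneg)
    also have "\<dots> \<le> 1 * (l2n A y * cmod (extr A y z k))"
      by (intro mult_right_mono psi that mult_nonneg_nonneg l2n_nonneg) auto
    finally show ?thesis by simp
  qed
  have "cal (l2n A y) g"
  proof (rule cal_finite_sfun[OF assms supp])
    fix k show "sfun (\<lambda>z. g z k)" unfolding g_def by (rule sfun_mult[OF sfun_power[OF sfun_psi] sf])
  next
    fix k and t :: real
    have "cmod (g (\<i> * of_real t) k) \<le> l2n A y * cmod (extr A y (\<i> * of_real t) k)"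
      by (rule gb) (simp add: cl_strip_def)
    also have "\<dots> \<le> l2n A y * 1" by (intro mult_left_mono extr_bound_0 assms l2n_nonneg)
    finally show "cmod (g (\<i> * of_real t) k) \<le> l2n A y" by simp
  next
    fix t :: real
    have "(\<Sum>k\<in>A. cmod (g (1 + \<i> * of_real t) k)) \<le> (\<Sum>k\<in>A. l2n A y * cmod (extr A y (1 + \<i> * of_real t) k))"
      by (intro sum_mono gb) (simp add: cl_strip_def)
    also have "\<dots> \<le> l2n A y * 1" unfolding sum_distrib_left[symmetric]
      by (intro mult_left_mono extr_bound_1 assms l2n_nonneg)
    finally show "(\<Sum>k\<in>A. cmod (g (1 + \<i> * of_real t) k)) \<le> l2n A y" by simp
  qed
  moreover have tcg: "jet g j k = (\<Sum>i=0..j. tc (\<lambda>z. psi z ^ m) i * tc (\<lambda>z. of_real (l2n A y) * extr A y z k) (j - i))" for j k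
    unfolding g_def by (rule tc_mult[OF sfun_hol[OF sfun_power[OF sfun_psi]] sfun_hol[OF sf]])
  have "jet g j k = 0" if "j < m" for j k
    unfolding tcg by (rule sum.neutral) (use tc_psi_power[of m] that in auto)
  moreover have "jet g m k = y k" if k: "k \<in> A" for k
  proof -
    have "jet g m k = (\<Sum>i\<in>{m}. tc (\<lambda>z. psi z ^ m) i * tc (\<lambda>z. of_real (l2n A y) * extr A y z k) (m - i))"
      unfolding tcg by (rule sum.mono_neutral_right) (use tc_psi_power[of m] in auto)
    also have "\<dots> = of_real (l2n A y) * (y k / of_real (l2n A y))"
      using tc_psi_power[of m] k by (simp add: tc_0 extr_half)
    also have "\<dots> = y k" using l2n_pos[OF assms k, of y] by (cases "y k = 0") auto
    finally show ?thesis .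
  qed
  ultimately show ?thesis using supp by blast
qed

text \<open>\<open>m\<close> is a common order of vanishing at \<open>1/2\<close>. For
  \<open>m = n\<close> the blocks represent 0 in the space, the case of a norm null sequence; for
  \<open>m < n\<close> the coefficients of order \<open>m\<close> stay away from 0.\<close>

definition blocks :: "nat \<Rightarrow> nat \<Rightarrow> (nat \<Rightarrow> nat set) \<Rightarrow> (nat \<Rightarrow> complex \<Rightarrow> cseq) \<Rightarrow> real \<Rightarrow> real \<Rightarrow> bool" where
  "blocks n m A g C d \<longleftrightarrow> m \<le> n \<and> disjoint_family A \<and> (\<forall>i. finite (A i)) \<and> (\<forall>i z k. k \<notin> A i \<longrightarrow> g i z k = 0)
     \<and> (\<forall>i. cal C (g i)) \<and> (\<forall>i. \<forall>j<m. \<forall>k. jet (g i) j k = 0)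
     \<and> (m < n \<longrightarrow> d > 0 \<and> (\<forall>i. d \<le> l2n (A i) (\<lambda>k. jet (g i) m k)))"

lemma blocksD:
  assumes "blocks n m A g C d"
  shows "m \<le> n" "disjoint_family A" "finite (A i)" "k \<notin> A i \<Longrightarrow> g i z k = 0" "cal C (g i)"
    "j < m \<Longrightarrow> jet (g i) j k = 0" "m < n \<Longrightarrow> d > 0" "m < n \<Longrightarrow> d \<le> l2n (A i) (\<lambda>k. jet (g i) m k)"
  using assms by (auto simp: blocks_def)

text \<open>Errors below \<open>(1/2)^i\<close> are summable, so that perturbations can be added up;
  \<open>S\<close> will be a set of indices along which a lower bound holds.\<close>

lemma fast_subsequence:
  fixes eps :: "nat \<Rightarrow> real"
  assumes S: "infinite S" and eps: "eps \<longlonglongrightarrow> 0"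
  shows "\<exists>r. strict_mono r \<and> (\<forall>i::nat. r i \<in> S \<and> eps (r i) \<le> (1/2) ^ i)"
proof -
  have ex: "\<exists>p. p > q \<and> p \<in> S \<and> eps p \<le> (1/2) ^ i" for q i
  proof -
    have "eventually (\<lambda>p. eps p < (1/2) ^ i) sequentially" by (rule order_tendstoD[OF eps]) simp
    then obtain p0 where p0: "\<And>p. p \<ge> p0 \<Longrightarrow> eps p < (1/2) ^ i" by (auto simp: eventually_sequentially)
    obtain p where "p > max q p0" "p \<in> S" using S by (meson infinite_nat_iff_unbounded)
    thus ?thesis using p0[of p] by (intro exI[of _ p]) auto
  qed
  have "\<exists>r. \<forall>i. (r i \<in> S \<and> eps (r i) \<le> (1/2) ^ i) \<and> r i < r (Suc i)"
  proof (rule dependent_nat_choice)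
    show "\<exists>x. x \<in> S \<and> eps x \<le> (1/2) ^ 0" using ex[of 0 0] by blast
    fix x and i :: nat
    show "\<exists>y. (y \<in> S \<and> eps y \<le> (1/2) ^ Suc i) \<and> x < y" using ex[of x "Suc i"] by blast
  qed
  thus ?thesis by (auto simp: strict_mono_Suc_iff)
qed

text \<open>Induction on the order \<open>m\<close>. If the \<open>l2\<close> norms of the
  coefficients of order \<open>m\<close> tend to 0, \<open>jet_correction\<close> removes these
  coefficients by a null perturbation and the order rises. Otherwise the norms exceed some
  \<open>d\<close> on an infinite set of indices and the process stops. It stops at
  \<open>m = n\<close> at the latest.\<close>

lemma block_dichotomy:
  fixes A :: "nat \<Rightarrow> nat set" and h :: "nat \<Rightarrow> complex \<Rightarrow> cseq"
  assumes A: "disjoint_family A" "\<And>i. finite (A i)" and supp: "\<And>i z k. k \<notin> A i \<Longrightarrow> h i z k = 0"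
    and h: "\<And>i. cal C (h i)"
  shows "\<exists>r m g C' d. strict_mono r \<and> blocks n m (A \<circ> r) g C' d
     \<and> (\<forall>i. cal ((1/2) ^ i) (\<lambda>z k. h (r i) z k - g i z k))"
proof -
  \<comment> \<open>The state of the induction: \<open>h i\<close> equals \<open>g i\<close> up to
    an error \<open>eps i\<close> tending to 0, and the jets of \<open>g i\<close> vanish below
    order \<open>m\<close>.\<close>
  define Q where "Q = (\<lambda>m g eps. eps \<longlonglongrightarrow> 0 \<and> (\<forall>i z k. k \<notin> A i \<longrightarrow> g i z k = 0) \<and>
    (\<forall>i. cal (eps i) (\<lambda>z k. h i z k - g i z k)) \<and> (\<forall>i. \<forall>j<m. \<forall>k. jet (g i) j k = 0))"
  define R where "R = (\<exists>r m g C' d. strict_mono r \<and> blocks n m (A \<circ> r) g C' d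
     \<and> (\<forall>i. cal ((1/2) ^ i) (\<lambda>z k. h (r i) z k - g i z k)))"
  have final: "R" if q: "Q m g eps" and m: "m \<le> n" and S: "infinite S"
    and d: "m < n \<Longrightarrow> d > 0 \<and> (\<forall>i\<in>S. d \<le> l2n (A i) (\<lambda>k. jet (g i) m k))" for m g eps S d
  proof -
    obtain r where r: "strict_mono r" "\<And>i. r i \<in> S" "\<And>i. eps (r i) \<le> (1/2) ^ i"
      using fast_subsequence[OF S, of eps] q by (auto simp: Q_def)
    have err: "cal ((1/2) ^ i) (\<lambda>z k. h (r i) z k - g (r i) z k)" for i
      using q r(3)[of i] by (auto simp: Q_def intro: cal_mono)
    have "cal (C + 1) (g (r i))" for i
    proof -
      have "cal (C + (1/2)^i) (g (r i))"
        using cal_diff[OF h[of "r i"] err[of i]] by simp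
      thus ?thesis by (rule cal_mono) (auto simp: power_le_one)
    qed
    moreover have "disjoint_family (A \<circ> r)"
      unfolding disjoint_family_on_def
    proof (intro ballI impI)
      fix i i' :: nat assume "i \<noteq> i'"
      hence "r i \<noteq> r i'" by (simp add: strict_mono_eq[OF r(1)])
      thus "(A \<circ> r) i \<inter> (A \<circ> r) i' = {}" using A(1) by (auto simp: disjoint_family_on_def)
    qed
    ultimately have "blocks n m (A \<circ> r) (\<lambda>i. g (r i)) (C + 1) d"
      using q m d r(2) A(2) unfolding blocks_def Q_def by auto
    thus R unfolding R_def using r(1) err by blast
  qed
  have main: "m \<le> n \<Longrightarrow> (\<exists>g eps. Q m g eps) \<or> R" for m
  proof (induction m)
    case 0
    have "Q 0 h (\<lambda>i. 0)" using supp by (auto simp: Q_def cal_zero)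
    thus ?case by blast
  next
    case (Suc m)
    show ?case
    proof (cases R)
      case False
      then obtain g eps where q: "Q m g eps" using Suc by auto
      define e where "e = (\<lambda>i. l2n (A i) (\<lambda>k. jet (g i) m k))"
      have "e \<longlonglongrightarrow> 0"
      proof (rule ccontr)
        assume "\<not> e \<longlonglongrightarrow> 0"
        then obtain d where d: "d > 0" "\<not> eventually (\<lambda>i. dist (e i) 0 < d) sequentially"
          unfolding tendsto_iff by blast
        define S where "S = {i. d \<le> e i}"
        have "infinite S"
        proof
          assume "finite S"
          then obtain N where "S \<subseteq> {..<N}" using finite_nat_bounded by blast
          hence "dist (e i) 0 < d" if "i \<ge> N" for i
          proof -
            have "i \<notin> S" using that \<open>S \<subseteq> {..<N}\<close> by auto
            moreover have "e i \<ge> 0" unfolding e_def by (rule l2n_nonneg)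
            ultimately show ?thesis by (simp add: S_def)
          qed
          with d(2) show False by (auto simp: eventually_sequentially)
        qed
        from final[OF q _ this, of d] Suc.prems d False show False by (auto simp: S_def e_def)
      qed
      have "\<exists>c. cal (e i) c \<and> (\<forall>z k. k \<notin> A i \<longrightarrow> c z k = 0) \<and> (\<forall>j<m. \<forall>k. jet c j k = 0)
          \<and> (\<forall>k\<in>A i. jet c m k = jet (g i) m k)" for i
        unfolding e_def by (rule jet_correction[OF A(2)])
      then obtain c where c: "\<And>i. cal (e i) (c i)" "\<And>i z k. k \<notin> A i \<Longrightarrow> c i z k = 0"
          "\<And>i j k. j < m \<Longrightarrow> jet (c i) j k = 0" "\<And>i k. k \<in> A i \<Longrightarrow> jet (c i) m k = jet (g i) m k"
        by metis
      have gcal: "cal (C + eps i) (g i)" for i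
        using cal_diff[OF h[of i], of "eps i" "\<lambda>z k. h i z k - g i z k"] q by (simp add: Q_def)
      have "Q (Suc m) (\<lambda>i z k. g i z k - c i z k) (\<lambda>i. eps i + e i)"
        unfolding Q_def
      proof (intro conjI allI impI)
        show "(\<lambda>i. eps i + e i) \<longlonglongrightarrow> 0"
          using tendsto_add[of eps 0 _ e 0] q \<open>e \<longlonglongrightarrow> 0\<close> by (simp add: Q_def)
        fix i
        show "cal (eps i + e i) (\<lambda>z k. h i z k - (g i z k - c i z k))"
          using cal_add[OF _ c(1), of "eps i" "\<lambda>z k. h i z k - g i z k" i] q by (simp add: Q_def algebra_simps)
        fix z k assume "k \<notin> A i"
        thus "g i z k - c i z k = 0" using q c(2) by (simp add: Q_def)
      next
        fix i j k assume j: "j < Suc m"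
        have eq: "tc (\<lambda>z. g i z k - c i z k) j = jet (g i) j k - jet (c i) j k"
          by (rule tc_diff[OF cal_hol[OF gcal] cal_hol[OF c(1)]])
        consider "j < m" | "j = m" "k \<in> A i" | "j = m" "k \<notin> A i" using j by (metis less_SucE)
        thus "tc (\<lambda>z. g i z k - c i z k) j = 0"
        proof cases
          case 1
          thus ?thesis unfolding eq using q c(3) by (simp add: Q_def)
        next
          case 2
          thus ?thesis unfolding eq using c(4) by simp
        next
          case 3
          thus ?thesis using q c(2) by (simp add: Q_def)
        qed
      qed
      thus ?thesis by blast
    qed simp
  qed
  have "R" using main[of n]
  proof
    assume "\<exists>g eps. Q n g eps"
    then obtain g eps where "Q n g eps" by blast
    from final[OF this, of UNIV 0] show R by auto
  qed auto
  thus ?thesis unfolding R_def .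
qed

section \<open>Upper and lower estimates for combinations of blocks\<close>

lemma fk_nonneg: "fk k t \<ge> 0"
  by (simp add: fk_def)

text \<open>Each block is multiplied by its own scalar function \<open>b i\<close>. Because the
  supports are disjoint, the sup norm on \<open>Re z = 0\<close> is a maximum over \<open>i\<close>,
  where boundedness of the \<open>b i\<close> is enough; on \<open>Re z = 1\<close> the
  \<open>l1\<close> norms add up, and there the sum of the \<open>fk\<close> values enters.\<close>

lemma block_upper_estimate:
  assumes b: "blocks n m A g C d" and mn: "m < n"
  obtains K where "K \<ge> 0" and "\<And>I a. finite I \<Longrightarrow> (\<And>i. i \<in> I \<Longrightarrow> cmod (a i) \<le> exp (-1)) \<Longrightarrow>
     (\<Sum>i\<in>I. fk (n - m) (cmod (a i))) \<le> 1 \<Longrightarrow> zle n (\<lambda>j k. \<Sum>i\<in>I. a i * jet (g i) j k) K"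
proof -
  define N where "N = n - m - 1"
  have nm: "n - m = Suc N" using mn by (simp add: N_def)
  obtain K where K: "K \<ge> 0" and sc: "\<And>a. cmod a \<le> exp (-1) \<Longrightarrow> (\<exists>b. sfun b \<and> (\<forall>t::real. cmod (b (\<i> * of_real t)) \<le> K) \<and>
      (\<forall>t::real. cmod (b (1 + \<i> * of_real t)) \<le> K * fk (Suc N) (cmod a)) \<and>
      (\<forall>l\<le>N. tc b l = (if l = 0 then a else 0)))"
    using scalar_upper_function[of N] by blast
  note B = blocksD[OF b]
  have C: "C \<ge> 0" using cal_nonneg[OF B(5)] .
  have main: "zle n (\<lambda>j k. \<Sum>i\<in>I. a i * jet (g i) j k) (K * C)"
    if I: "finite I" and a: "\<And>i. i \<in> I \<Longrightarrow> cmod (a i) \<le> exp (-1)" and S: "(\<Sum>i\<in>I. fk (n - m) (cmod (a i))) \<le> 1" for I a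
  proof -
    obtain b where b: "\<And>i. i \<in> I \<Longrightarrow> sfun (b i)" "\<And>i t. i \<in> I \<Longrightarrow> cmod (b i (\<i> * of_real t)) \<le> K"
      "\<And>i t. i \<in> I \<Longrightarrow> cmod (b i (1 + \<i> * of_real t)) \<le> K * fk (Suc N) (cmod (a i))"
      "\<And>i l. i \<in> I \<Longrightarrow> l \<le> N \<Longrightarrow> tc (b i) l = (if l = 0 then a i else 0)"
    proof -
      have "\<forall>i\<in>I. \<exists>b. sfun b \<and> (\<forall>t::real. cmod (b (\<i> * of_real t)) \<le> K) \<and>
        (\<forall>t::real. cmod (b (1 + \<i> * of_real t)) \<le> K * fk (Suc N) (cmod (a i))) \<and>
        (\<forall>l\<le>N. tc b l = (if l = 0 then a i else 0))"
        using a by (intro ballI sc) auto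
      from bchoice[OF this] that show thesis by blast
    qed
    define F where "F = (\<lambda>z k. \<Sum>i\<in>I. b i z * g i z k)"
    define U where "U = (\<Union>i\<in>I. A i)"
    have U: "finite U" using I B(3) by (auto simp: U_def)
    have disj: "k \<notin> A i'" if "k \<in> A i" "i' \<noteq> i" for k i i'
      using B(2) that unfolding disjoint_family_on_def by blast
    have Fk: "F z k = b i z * g i z k" if "i \<in> I" "k \<in> A i" for i z k
    proof -
      have "F z k = (\<Sum>i\<in>{i}. b i z * g i z k)" unfolding F_def
        using that I B(4) disj by (intro sum.mono_neutral_right) auto
      thus ?thesis by simp
    qed
    have "cal (K * C) F"
    proof (rule cal_finite_sfun[OF U])
      fix z k assume "k \<notin> U"
      thus "F z k = 0" using B(4) by (auto simp: F_def U_def intro!: sum.neutral)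
    next
      fix k show "sfun (\<lambda>z. F z k)" unfolding F_def
        by (rule sfun_sum, rule sfun_mult, rule b(1), assumption, rule cal_sfun, rule B(5))
    next
      fix k and t :: real assume "k \<in> U"
      then obtain i where i: "i \<in> I" "k \<in> A i" by (auto simp: U_def)
      have "cmod (F (\<i> * of_real t) k) = cmod (b i (\<i> * of_real t)) * cmod (g i (\<i> * of_real t) k)"
        by (simp add: Fk[OF i] norm_mult)
      also have "\<dots> \<le> K * C"
        using K C i by (intro mult_mono b cal_bound[OF B(5)]) (auto simp: cl_strip_def)
      finally show "cmod (F (\<i> * of_real t) k) \<le> K * C" .
    next
      fix t :: real
      let ?z = "1 + \<i> * of_real t"
      have "(\<Sum>k\<in>U. cmod (F ?z k)) = (\<Sum>i\<in>I. \<Sum>k\<in>A i. cmod (F ?z k))"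
        unfolding U_def using I B(3) disj by (intro sum.UNION_disjoint) blast+
      also have "\<dots> = (\<Sum>i\<in>I. cmod (b i ?z) * (\<Sum>k\<in>A i. cmod (g i ?z k)))"
        by (intro sum.cong) (auto simp: Fk norm_mult sum_distrib_left)
      also have "\<dots> \<le> (\<Sum>i\<in>I. (K * fk (Suc N) (cmod (a i))) * C)"
        using C K fk_nonneg by (intro sum_mono mult_mono b cal_l1_finite[OF B(5) B(3)]) (auto intro!: sum_nonneg)
      also have "\<dots> = K * C * (\<Sum>i\<in>I. fk (n - m) (cmod (a i)))"
        unfolding nm by (simp add: sum_distrib_left mult_ac)
      also have "\<dots> \<le> K * C * 1" using S K C by (intro mult_left_mono) auto
      finally show "(\<Sum>k\<in>U. cmod (F ?z k)) \<le> K * C" by simp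
    qed
    moreover have "(\<Sum>i\<in>I. a i * jet (g i) j k) = jet F j k" if j: "j < n" for j k
    proof -
      have "jet F j k = (\<Sum>i\<in>I. tc (\<lambda>z. b i z * g i z k) j)" unfolding F_def
        by (rule tc_sum, rule sfun_hol, rule sfun_mult, rule b(1), assumption, rule cal_sfun, rule B(5))
      also have "\<dots> = (\<Sum>i\<in>I. a i * jet (g i) j k)"
      proof (rule sum.cong[OF refl])
        fix i assume i: "i \<in> I"
        have "tc (\<lambda>z. b i z * g i z k) j = (\<Sum>l=0..j. tc (b i) l * jet (g i) (j - l) k)"
          by (rule tc_mult[OF sfun_hol[OF b(1)[OF i]] cal_hol[OF B(5)]])
        also have "\<dots> = (\<Sum>l\<in>{0}. tc (b i) l * jet (g i) (j - l) k)"
        proof (rule sum.mono_neutral_right)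
          show "\<forall>l\<in>{0..j} - {0}. tc (b i) l * jet (g i) (j - l) k = 0"
          proof
            fix l assume l: "l \<in> {0..j} - {0}"
            show "tc (b i) l * jet (g i) (j - l) k = 0"
            proof (cases "l \<le> N")
              case True
              thus ?thesis using b(4)[OF i True] l by simp
            next
              case False
              \<comment> \<open>\<open>b i\<close> agrees with the constant \<open>a i\<close> up to
                order \<open>N\<close>, the block vanishes below order \<open>m\<close>, and
                \<open>N + 1 + m = n\<close>; hence all cross terms of order below \<open>n\<close>
                disappear.\<close>
              hence "j - l < m" using j nm l by auto
              thus ?thesis using B(6) by simp
            qed
          qed
        qed auto
        also have "\<dots> = a i * jet (g i) j k" using b(4)[OF i, of 0] by simp
        finally show "tc (\<lambda>z. b i z * g i z k) j = a i * jet (g i) j k" .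
      qed
      finally show ?thesis ..
    qed
    ultimately show ?thesis unfolding zle_def by blast
  qed
  have "K * C \<ge> 0" using K C by simp
  from that[OF this main] show ?thesis .
qed

text \<open>Used with \<open>X = 2 ln (1/\<tau>)\<close>: for small weights the top power of
  \<open>X\<close>, whose coefficient is bounded below, absorbs all lower ones and keeps half of
  itself.\<close>

lemma dominant_term:
  fixes D \<delta> :: real
  assumes "D \<ge> 0" "\<delta> > 0"
  shows "\<exists>X0\<ge>1. \<forall>X\<ge>X0. D * (\<Sum>l<N. X ^ l / fact l) \<le> \<delta> / (2 * fact N) * X ^ N"
proof (cases N)
  case 0
  thus ?thesis using assms by (intro exI[of _ 1]) auto
next
  case (Suc N')
  define X0 where "X0 = max 1 (D * real N * (2 * fact N) / \<delta>)"
  have "D * (\<Sum>l<N. X ^ l / fact l) \<le> \<delta> / (2 * fact N) * X ^ N" if X: "X \<ge> X0" for X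
  proof -
    have X1: "X \<ge> 1" "X \<ge> D * real N * (2 * fact N) / \<delta>" using X by (auto simp: X0_def)
    have "X ^ l / fact l \<le> X ^ N'" if l: "l < N" for l
    proof -
      have "X ^ l / fact l \<le> X ^ l / 1" using X1 by (intro divide_left_mono) auto
      also have "\<dots> \<le> X ^ N'" using X1 l Suc by (simp add: power_increasing)
      finally show ?thesis .
    qed
    hence "(\<Sum>l<N. X ^ l / fact l) \<le> (\<Sum>l<N. X ^ N')" by (intro sum_mono) auto
    hence "D * (\<Sum>l<N. X ^ l / fact l) \<le> D * (real N * X ^ N')" using assms by (intro mult_left_mono) auto
    also have "\<dots> = (D * real N * (2 * fact N) / \<delta>) * (\<delta> / (2 * fact N)) * X ^ N'"
      using assms by (simp add: field_simps)
    also have "\<dots> \<le> X * (\<delta> / (2 * fact N)) * X ^ N'"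
      using X1 assms by (intro mult_right_mono) auto
    also have "\<dots> = \<delta> / (2 * fact N) * X ^ N" by (simp add: Suc)
    finally show ?thesis .
  qed
  moreover have "X0 \<ge> 1" by (simp add: X0_def)
  ultimately show ?thesis by blast
qed

lemma sum_disjoint_family_UN:
  assumes "finite I" "\<And>i. finite (A i)" "disjoint_family A"
  shows "(\<Sum>k\<in>(\<Union>i\<in>I. A i). p k) = (\<Sum>i\<in>I. \<Sum>k\<in>A i. p k)"
proof (rule sum.UNION_disjoint)
  show "\<forall>i\<in>I. \<forall>j\<in>I. i \<noteq> j \<longrightarrow> A i \<inter> A j = {}"
    using assms(3) by (simp add: disjoint_family_on_def)
qed (use assms in auto)

text \<open>With \<open>L = ln (1/|a|)\<close> large this reads
  \<open>|a| L^N \<le> |a|^(1/2)\<close>, which keeps the logarithm of the weight comparable to that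
  of the coefficient.\<close>

lemma power_le_exp_half: "\<exists>L0. \<forall>L\<ge>L0. L ^ N \<le> exp (L / 2 :: real)"
proof -
  have "((\<lambda>x::real. x ^ N / exp x) \<longlongrightarrow> 0) at_top" by (rule tendsto_power_div_exp_0)
  hence "eventually (\<lambda>x::real. x ^ N / exp x < 1 / 2 ^ N) at_top" by (rule order_tendstoD) simp
  then obtain x0 :: real where x0: "\<And>x. x \<ge> x0 \<Longrightarrow> x ^ N / exp x < 1 / 2 ^ N" by (auto simp: eventually_at_top_linorder)
  have "L ^ N \<le> exp (L / 2)" if "L \<ge> 2 * x0" for L
  proof -
    have "(L / 2) ^ N / exp (L / 2) < 1 / 2 ^ N" using that by (intro x0) auto
    thus ?thesis by (simp add: field_simps power_divide)
  qed
  thus ?thesis by blast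
qed

text \<open>The test function for the lower estimate is \<open>\<sigma>\<^sub>i \<tau>\<^sub>i^(2z)\<close> times the extremal function of the
  conjugate of the first nonzero Taylor coefficient of the \<open>i\<close>-th block; \<open>w\<close> below is the scalar factor.\<close>

lemma block_lower_estimate:
  assumes b: "blocks n m A g C d" and mn: "m < n"
  obtains K t0 where "K \<ge> 0" "0 < t0" "t0 < 1" and "\<And>I a B. finite I \<Longrightarrow> (\<And>i. i \<in> I \<Longrightarrow> cmod (a i) \<le> t0) \<Longrightarrow>
     zle n (\<lambda>j k. \<Sum>i\<in>I. a i * jet (g i) j k) B \<Longrightarrow>
     (\<Sum>i\<in>I. fk (n - m) (cmod (a i))) \<le> K * B * max 1 (sqrt (\<Sum>i\<in>I. fk (n - m) (cmod (a i))))"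
proof -
  define N where "N = n - m - 1"
  have nm: "n - m = Suc N" "n - 1 = N + m" using mn by (auto simp: N_def)
  note Bl = blocksD[OF b]
  have C: "C \<ge> 0" using cal_nonneg[OF Bl(5)] .
  have d: "d > 0" using Bl(7) mn .
  define D where "D = C * 4 ^ n"
  have D: "D \<ge> 0" using C by (simp add: D_def)
  obtain X0 where X0: "X0 \<ge> 1" "\<And>X. X \<ge> X0 \<Longrightarrow> D * (\<Sum>l<N. X ^ l / fact l) \<le> d / (2 * fact N) * X ^ N"
    using dominant_term[OF D d, of N] by blast
  obtain L0 where L0: "\<And>L. L \<ge> L0 \<Longrightarrow> L ^ N \<le> exp (L / 2 :: real)" using power_le_exp_half by blast
  \<comment> \<open>Nonzero coefficients of modulus at most \<open>t0\<close> have \<open>L\<close>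
    above both \<open>L0\<close> and \<open>X0\<close>, so both growth bounds are available.\<close>
  define t0 where "t0 = exp (- max L0 X0)"
  have t0: "0 < t0" "t0 < 1" using X0(1) by (auto simp: t0_def)
  define c where "c = d / (2 * fact N)"
  have c: "c > 0" using d by (simp add: c_def)
  define y where "y = (\<lambda>i k. cnj (jet (g i) m k))"
  define E where "E = (\<lambda>i. extr (A i) (y i))"
  \<comment> \<open>A block paired with the extremal function of its conjugated leading coefficient:
    \<open>H i\<close> vanishes below order \<open>m\<close>, and its coefficient of order
    \<open>m\<close> is the \<open>l2\<close> norm of the leading coefficient, hence at least
    \<open>d\<close>.\<close>
  define H where "H = (\<lambda>i z. \<Sum>k\<in>A i. g i z k * E i (1 - z) k)"
  have E: "cal 1 (E i)" for i unfolding E_def by (rule cal_extr[OF Bl(3)])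
  have H: "sfun (H i)" and Hb: "cmod (tc (H i) j) \<le> C * 4 ^ j" for i j
    using cal_pairing[OF Bl(5)[of i] E[of i] Bl(3)[of i]] unfolding H_def by auto
  have tcH: "tc (H i) j = (\<Sum>k\<in>A i. \<Sum>l=0..j. jet (g i) l k * tc (\<lambda>z. E i (1 - z) k) (j - l))" for i j
  proof -
    have "tc (H i) j = (\<Sum>k\<in>A i. tc (\<lambda>z. g i z k * E i (1 - z) k) j)" unfolding H_def
      by (rule tc_sum, rule sfun_hol, rule sfun_mult, rule cal_sfun, rule Bl(5), rule sfun_reflect, rule cal_sfun, rule E)
    also have "\<dots> = (\<Sum>k\<in>A i. \<Sum>l=0..j. jet (g i) l k * tc (\<lambda>z. E i (1 - z) k) (j - l))"
      by (intro sum.cong refl tc_mult cal_hol[OF Bl(5)] sfun_hol[OF sfun_reflect[OF cal_sfun[OF E]]])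
    finally show ?thesis .
  qed
  have H0: "tc (H i) j = 0" if "j < m" for i j
    unfolding tcH using that by (intro sum.neutral ballI) (auto simp: Bl(6))
  have Hm: "Re (tc (H i) m) \<ge> d" for i
  proof -
    let ?e = "l2n (A i) (y i)"
    have l: "?e = l2n (A i) (\<lambda>k. jet (g i) m k)" by (simp add: l2n_def y_def)
    hence e: "?e \<ge> d" using Bl(8)[OF mn] by simp
    have "tc (H i) m = (\<Sum>k\<in>A i. jet (g i) m k * (y i k / of_real ?e))" unfolding tcH
    proof (rule sum.cong[OF refl])
      fix k assume k: "k \<in> A i"
      have "(\<Sum>l=0..m. jet (g i) l k * tc (\<lambda>z. E i (1 - z) k) (m - l))
        = (\<Sum>l\<in>{m}. jet (g i) l k * tc (\<lambda>z. E i (1 - z) k) (m - l))"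
        by (rule sum.mono_neutral_right) (auto simp: Bl(6))
      also have "\<dots> = jet (g i) m k * (y i k / of_real ?e)"
        using extr_half[OF k, of "y i"] by (simp add: tc_0 E_def)
      finally show "(\<Sum>l=0..m. jet (g i) l k * tc (\<lambda>z. E i (1 - z) k) (m - l)) = jet (g i) m k * (y i k / of_real ?e)" .
    qed
    also have "\<dots> = (\<Sum>k\<in>A i. of_real ((cmod (y i k))\<^sup>2 / ?e))"
      by (intro sum.cong refl) (simp add: y_def complex_norm_square del: of_real_power)
    also have "\<dots> = of_real ((\<Sum>k\<in>A i. (cmod (y i k))\<^sup>2) / ?e)"
      by (simp add: sum_divide_distrib)
    also have "\<dots> = of_real ?e" unfolding l2n_sq[symmetric] using e d by (simp add: power2_eq_square)
    finally show ?thesis using e by simp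
  qed
  have main: "(\<Sum>i\<in>I. fk (n - m) (cmod (a i))) \<le> (4 ^ n / c) * B * max 1 (sqrt (\<Sum>i\<in>I. fk (n - m) (cmod (a i))))"
    if I: "finite I" and a: "\<And>i. i \<in> I \<Longrightarrow> cmod (a i) \<le> t0" and z: "zle n (\<lambda>j k. \<Sum>i\<in>I. a i * jet (g i) j k) B" for I a B
  proof -
    obtain G where G: "cal B G" "\<And>j k. j < n \<Longrightarrow> jet G j k = (\<Sum>i\<in>I. a i * jet (g i) j k)"
      using z unfolding zle_def by metis
    define L where "L = (\<lambda>i. - ln (cmod (a i)))"
    \<comment> \<open>\<open>(s i)^2\<close> is \<open>fk (n - m) (cmod (a i))\<close>. Division by
      \<open>la\<close> makes the squares sum to at most 1, and \<open>la \<ge> 1\<close> ensures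
      \<open>\<tau> i \<le> s i\<close>, so the weights are small.\<close>
    define s where "s = (\<lambda>i. cmod (a i) * L i ^ N)"
    define S where "S = (\<Sum>i\<in>I. fk (n - m) (cmod (a i)))"
    define la where "la = max 1 (sqrt S)"
    define \<tau> where "\<tau> = (\<lambda>i. s i / la)"
    have la: "la \<ge> 1" "la\<^sup>2 \<ge> S"
    proof -
      show "la \<ge> 1" by (simp add: la_def)
      have "S \<ge> 0" unfolding S_def by (intro sum_nonneg fk_nonneg)
      hence "S = (sqrt S)\<^sup>2" by simp
      also have "\<dots> \<le> la\<^sup>2" by (rule power_mono) (auto simp: la_def \<open>S \<ge> 0\<close>)
      finally show "la\<^sup>2 \<ge> S" .
    qed
    have sfk: "(s i)\<^sup>2 = fk (n - m) (cmod (a i))" for i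
      by (simp add: s_def L_def nm fk_def power_mult_distrib power_even_eq[symmetric])
    have Lb: "L i \<ge> L0" "L i \<ge> X0" "cmod (a i) = exp (- L i)" if "i \<in> I" "a i \<noteq> 0" for i
    proof -
      have "ln (cmod (a i)) \<le> ln t0" using a that t0 by (subst ln_le_cancel_iff) auto
      thus "L i \<ge> L0" "L i \<ge> X0" by (auto simp: L_def t0_def)
      show "cmod (a i) = exp (- L i)" using that by (simp add: L_def)
    qed
    have s0: "s i \<ge> 0" if "i \<in> I" for i
    proof (cases "a i = 0")
      case False
      thus ?thesis using Lb(2)[OF that False] X0(1) by (auto simp: s_def)
    qed (simp add: s_def)
    have t0': "\<tau> i \<ge> 0" if "i \<in> I" for i using s0[OF that] la by (simp add: \<tau>_def)
    have tsum: "(\<Sum>i\<in>I. (\<tau> i)\<^sup>2) \<le> 1"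
    proof -
      have "(\<Sum>i\<in>I. (\<tau> i)\<^sup>2) = S / la\<^sup>2" by (simp add: \<tau>_def power_divide sfk S_def sum_divide_distrib)
      thus ?thesis using la by simp
    qed
    \<comment> \<open>This is \<open>\<tau>^(2z)\<close> with the phase that cancels that of
      \<open>a i\<close>; for \<open>\<tau> i = 0\<close> it is the zero function.\<close>
    define w where "w = (\<lambda>i z. cnj (sgn (a i)) * of_real (\<tau> i) * exp (of_real (ln (\<tau> i)) * (2 * z - 1)))"
    have sw: "sfun (w i)" for i unfolding w_def by (intro sfun_mult sfun_const sfun_exp)
    have sg: "cmod (cnj (sgn (a i))) \<le> 1" for i by (simp add: norm_sgn)
    have w0: "cmod (w i (\<i> * of_real t)) \<le> 1" if i: "i \<in> I" for i and t :: real
    proof -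
      have "cmod (w i (\<i> * of_real t)) = cmod (cnj (sgn (a i))) * (\<tau> i * exp (- ln (\<tau> i)))"
        using t0'[OF i] by (simp add: w_def norm_mult norm_exp_eq_Re)
      also have "\<dots> \<le> 1 * 1" using t0'[OF i] sg by (intro mult_mono) (auto simp: exp_minus le_less)
      finally show ?thesis by simp
    qed
    have w1: "cmod (w i (1 + \<i> * of_real t)) \<le> (\<tau> i)\<^sup>2" if i: "i \<in> I" for i and t :: real
    proof -
      have "cmod (w i (1 + \<i> * of_real t)) = cmod (cnj (sgn (a i))) * (\<tau> i * exp (ln (\<tau> i)))"
        using t0'[OF i] by (simp add: w_def norm_mult norm_exp_eq_Re)
      also have "\<dots> \<le> 1 * (\<tau> i)\<^sup>2" using t0'[OF i] sg by (intro mult_mono) (auto simp: power2_eq_square le_less)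
      finally show ?thesis by simp
    qed
    define U where "U = (\<Union>i\<in>I. A i)"
    note Usum = sum_disjoint_family_UN[OF I Bl(3) Bl(2), folded U_def]
    have U: "finite U" using I Bl(3) by (auto simp: U_def)
    have disj: "k \<notin> A i'" if "k \<in> A i" "i' \<noteq> i" for k i i'
      using Bl(2) that unfolding disjoint_family_on_def by blast
    define T where "T = (\<lambda>z k. \<Sum>i\<in>I. w i z * E i z k)"
    have E0: "E i z k = 0" if "k \<notin> A i" for i z k using that by (simp add: E_def extr_def)
    have Tk: "T z k = w i z * E i z k" if "i \<in> I" "k \<in> A i" for i z k
    proof -
      have "T z k = (\<Sum>i\<in>{i}. w i z * E i z k)" unfolding T_def
        using that I E0 disj by (intro sum.mono_neutral_right) auto
      thus ?thesis by simp
    qed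
    have T: "cal 1 T"
    proof (rule cal_finite_sfun[OF U])
      fix z k assume "k \<notin> U"
      thus "T z k = 0" using E0 by (auto simp: T_def U_def intro!: sum.neutral)
    next
      fix k show "sfun (\<lambda>z. T z k)" unfolding T_def
        by (rule sfun_sum, rule sfun_mult, rule sw, rule cal_sfun, rule E)
    next
      fix k and t :: real assume "k \<in> U"
      then obtain i where i: "i \<in> I" "k \<in> A i" by (auto simp: U_def)
      have "cmod (T (\<i> * of_real t) k) = cmod (w i (\<i> * of_real t)) * cmod (E i (\<i> * of_real t) k)"
        by (simp add: Tk[OF i] norm_mult)
      also have "\<dots> \<le> 1 * 1"
        by (intro mult_mono w0 i cal_bound[OF E]) (auto simp: cl_strip_def)
      finally show "cmod (T (\<i> * of_real t) k) \<le> 1" by simp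
    next
      fix t :: real
      let ?z = "1 + \<i> * of_real t"
      have "(\<Sum>k\<in>U. cmod (T ?z k)) = (\<Sum>i\<in>I. \<Sum>k\<in>A i. cmod (T ?z k))" by (rule Usum)
      also have "\<dots> = (\<Sum>i\<in>I. cmod (w i ?z) * (\<Sum>k\<in>A i. cmod (E i ?z k)))"
        by (intro sum.cong refl) (auto simp: Tk norm_mult sum_distrib_left)
      also have "\<dots> \<le> (\<Sum>i\<in>I. (\<tau> i)\<^sup>2 * 1)"
        by (intro sum_mono mult_mono w1 cal_l1_finite[OF E Bl(3)]) (auto intro!: sum_nonneg)
      also have "\<dots> \<le> 1" using tsum by simp
      finally show "(\<Sum>k\<in>U. cmod (T ?z k)) \<le> 1" .
    qed
    \<comment> \<open>\<open>n - 1\<close> is the highest order of a coefficient of the pairing that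
      is determined by the element of the space.\<close>
    have tcT: "cmod (tc (\<lambda>z. \<Sum>k\<in>U. G z k * T (1 - z) k) (n - 1)) \<le> B * 4 ^ (n - 1)"
      using cal_pairing(2)[OF G(1) T U, of "n - 1"] by simp
    define P where "P = (\<lambda>z k. \<Sum>i\<in>I. a i * g i z k)"
    have sP: "sfun (\<lambda>z. P z k)" for k unfolding P_def
      by (rule sfun_sum, rule sfun_mult, rule sfun_const, rule cal_sfun, rule Bl(5))
    have tP: "jet G j k = jet P j k" if "j < n" for j k
      unfolding G(2)[OF that] P_def by (rule tc_lincomb[symmetric]) (rule cal_sfun, rule Bl(5))
    have sTr: "sfun (\<lambda>z. T (1 - z) k)" for k by (rule sfun_reflect[OF cal_sfun[OF T]])
    \<comment> \<open>A coefficient of order \<open>n - 1\<close> involves only jets of order below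
      \<open>n\<close>, so the unknown representing function \<open>G\<close> may be exchanged for
      the explicit \<open>P\<close>.\<close>
    have eq1: "tc (\<lambda>z. \<Sum>k\<in>U. G z k * T (1 - z) k) (n - 1) = tc (\<lambda>z. \<Sum>k\<in>U. P z k * T (1 - z) k) (n - 1)"
    proof -
      have "tc (\<lambda>z. \<Sum>k\<in>U. G z k * T (1 - z) k) (n - 1) = (\<Sum>k\<in>U. tc (\<lambda>z. G z k * T (1 - z) k) (n - 1))"
        by (rule tc_sum, rule sfun_hol, rule sfun_mult, rule cal_sfun[OF G(1)], rule sTr)
      also have "\<dots> = (\<Sum>k\<in>U. tc (\<lambda>z. P z k * T (1 - z) k) (n - 1))"
      proof (rule sum.cong[OF refl])
        fix k
        show "tc (\<lambda>z. G z k * T (1 - z) k) (n - 1) = tc (\<lambda>z. P z k * T (1 - z) k) (n - 1)"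
          unfolding tc_mult[OF sfun_hol[OF cal_sfun[OF G(1)]] sfun_hol[OF sTr]] tc_mult[OF sfun_hol[OF sP] sfun_hol[OF sTr]]
          using mn by (intro sum.cong refl) (simp add: tP)
      qed
      also have "\<dots> = tc (\<lambda>z. \<Sum>k\<in>U. P z k * T (1 - z) k) (n - 1)"
        by (rule tc_sum[symmetric], rule sfun_hol, rule sfun_mult, rule sP, rule sTr)
      finally show ?thesis .
    qed
    have eq2: "(\<lambda>z. \<Sum>k\<in>U. P z k * T (1 - z) k) = (\<lambda>z. \<Sum>i\<in>I. a i * (w i (1 - z) * H i z))"
    proof
      fix z
      have "P z k = a i * g i z k" if "i \<in> I" "k \<in> A i" for i k
      proof -
        have "P z k = (\<Sum>i\<in>{i}. a i * g i z k)" unfolding P_def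
          using that I Bl(4) disj by (intro sum.mono_neutral_right) auto
        thus ?thesis by simp
      qed
      thus "(\<Sum>k\<in>U. P z k * T (1 - z) k) = (\<Sum>i\<in>I. a i * (w i (1 - z) * H i z))"
        unfolding Usum H_def by (intro sum.cong refl) (auto simp: Tk sum_distrib_left mult_ac intro!: sum.cong)
    qed
    have swr: "sfun (\<lambda>z. w i (1 - z))" for i by (rule sfun_reflect[OF sw])
    have tcw: "tc (\<lambda>z. w i (1 - z)) l = cnj (sgn (a i)) * of_real (\<tau> i) * ((2 * of_real (- ln (\<tau> i))) ^ l / fact l)" for i l
    proof -
      have "(\<lambda>z. w i (1 - z)) = (\<lambda>z. (cnj (sgn (a i)) * of_real (\<tau> i)) * exp (of_real (- ln (\<tau> i)) * (2 * z - 1)))"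
        by (auto simp: w_def fun_eq_iff algebra_simps)
      thus ?thesis
        using tc_cmult[OF sfun_hol[OF sfun_exp[of "- ln (\<tau> i)"]], of "cnj (sgn (a i)) * of_real (\<tau> i)" l]
        by (simp only: tc_exp)
    qed
    \<comment> \<open>The reflection \<open>1 - z\<close> turns \<open>ln (\<tau> i)\<close> into
      \<open>- ln (\<tau> i)\<close>, which is positive for small weights. Terms with
      \<open>l > N\<close> meet coefficients of \<open>H i\<close> of order below \<open>m\<close>
      and drop out.\<close>
    define V where "V = (\<lambda>i. \<Sum>l\<le>N. of_real ((2 * - ln (\<tau> i)) ^ l / fact l) * tc (H i) (n - 1 - l))"
    have eq3: "tc (\<lambda>z. \<Sum>i\<in>I. a i * (w i (1 - z) * H i z)) (n - 1) = (\<Sum>i\<in>I. of_real (cmod (a i) * \<tau> i) * V i)"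
    proof -
      have "tc (\<lambda>z. \<Sum>i\<in>I. a i * (w i (1 - z) * H i z)) (n - 1) = (\<Sum>i\<in>I. a i * tc (\<lambda>z. w i (1 - z) * H i z) (n - 1))"
        by (rule tc_lincomb) (rule sfun_mult[OF swr H])
      also have "\<dots> = (\<Sum>i\<in>I. of_real (cmod (a i) * \<tau> i) * V i)"
      proof (rule sum.cong[OF refl])
        fix i
        have "tc (\<lambda>z. w i (1 - z) * H i z) (n - 1) = (\<Sum>l=0..n - 1. tc (\<lambda>z. w i (1 - z)) l * tc (H i) (n - 1 - l))"
          by (rule tc_mult[OF sfun_hol[OF swr] sfun_hol[OF H]])
        also have "\<dots> = (\<Sum>l\<le>N. tc (\<lambda>z. w i (1 - z)) l * tc (H i) (n - 1 - l))"
        proof (rule sum.mono_neutral_right)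
          show "\<forall>l\<in>{0..n - 1} - {..N}. tc (\<lambda>z. w i (1 - z)) l * tc (H i) (n - 1 - l) = 0"
          proof
            fix l assume "l \<in> {0..n - 1} - {..N}"
            hence "n - 1 - l < m" using nm by auto
            thus "tc (\<lambda>z. w i (1 - z)) l * tc (H i) (n - 1 - l) = 0" using H0 by simp
          qed
        qed (use nm in auto)
        also have "\<dots> = cnj (sgn (a i)) * of_real (\<tau> i) * V i"
          unfolding tcw V_def sum_distrib_left by (intro sum.cong refl) simp
        finally have "a i * tc (\<lambda>z. w i (1 - z) * H i z) (n - 1) = (a i * cnj (sgn (a i))) * of_real (\<tau> i) * V i"
          by simp
        also have "a i * cnj (sgn (a i)) = of_real (cmod (a i))"
          by (cases "a i = 0") (auto simp: sgn_eq complex_norm_square[symmetric] power2_eq_square)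
        finally show "a i * tc (\<lambda>z. w i (1 - z) * H i z) (n - 1) = of_real (cmod (a i) * \<tau> i) * V i" by simp
      qed
      finally show ?thesis .
    qed
    have ReV: "Re (V i) \<ge> c * L i ^ N" if i: "i \<in> I" and ai: "a i \<noteq> 0" for i
    proof -
      \<comment> \<open>Since \<open>\<tau> i\<close> is at most the square root of
        \<open>cmod (a i)\<close>, the factor 2 recovers the full logarithm:
        \<open>X \<ge> L i\<close>.\<close>
      define X where "X = 2 * - ln (\<tau> i)"
      note Lbi = Lb[OF i ai]
      have L1: "L i \<ge> 1" using Lbi(2) X0(1) by simp
      have tpos: "\<tau> i > 0" using ai L1 la by (simp add: \<tau>_def s_def)
      have "\<tau> i \<le> s i" using la s0[OF i] by (simp add: \<tau>_def divide_le_eq mult_le_cancel_left1)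
      also have "\<dots> \<le> exp (- L i) * exp (L i / 2)" unfolding s_def Lbi(3)[symmetric]
        by (intro mult_left_mono L0 Lbi) auto
      also have "\<dots> = exp (- L i / 2)" by (simp add: exp_add[symmetric])
      finally have "ln (\<tau> i) \<le> - L i / 2" using tpos by (metis ln_exp ln_le_cancel_iff exp_gt_zero)
      hence XL: "X \<ge> L i" by (simp add: X_def)
      hence XX: "X \<ge> X0" using Lbi by simp
      have V: "V i = of_real (X ^ N / fact N) * tc (H i) m + (\<Sum>l<N. of_real (X ^ l / fact l) * tc (H i) (n - 1 - l))"
        unfolding V_def X_def[symmetric] lessThan_Suc_atMost[symmetric] using nm by (simp add: add.commute)
      have "cmod (\<Sum>l<N. of_real (X ^ l / fact l) * tc (H i) (n - 1 - l)) \<le> (\<Sum>l<N. X ^ l / fact l * D)"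
      proof (rule order_trans[OF norm_sum], rule sum_mono)
        fix l
        have X0': "X ^ l / fact l \<ge> 0" using XL L1 by simp
        have "cmod (tc (H i) (n - 1 - l)) \<le> C * 4 ^ (n - 1 - l)" by (rule Hb)
        also have "\<dots> \<le> D" unfolding D_def using C by (intro mult_left_mono power_increasing) auto
        finally show "cmod (of_real (X ^ l / fact l) * tc (H i) (n - 1 - l)) \<le> X ^ l / fact l * D"
          unfolding norm_mult norm_of_real abs_of_nonneg[OF X0'] by (intro mult_left_mono X0')
      qed
      also have "\<dots> = D * (\<Sum>l<N. X ^ l / fact l)" by (simp add: sum_distrib_left mult_ac)
      also have "\<dots> \<le> c * X ^ N" unfolding c_def by (rule X0(2)[OF XX])
      finally have r: "cmod (\<Sum>l<N. of_real (X ^ l / fact l) * tc (H i) (n - 1 - l)) \<le> c * X ^ N" .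
      have "Re (of_real (X ^ N / fact N) * tc (H i) m) = X ^ N / fact N * Re (tc (H i) m)"
        by (simp only: Re_complex_of_real Im_complex_of_real times_complex.sel)
      also have "\<dots> \<ge> X ^ N / fact N * d" using XL L1 Hm[of i] by (intro mult_left_mono) auto
      finally have "Re (of_real (X ^ N / fact N) * tc (H i) m) \<ge> 2 * (c * X ^ N)" by (simp add: c_def mult.commute[of d])
      moreover have "Re (\<Sum>l<N. of_real (X ^ l / fact l) * tc (H i) (n - 1 - l)) \<ge> - (c * X ^ N)"
        using r abs_Re_le_cmod[of "\<Sum>l<N. of_real (X ^ l / fact l) * tc (H i) (n - 1 - l)"] by linarith
      ultimately have "Re (V i) \<ge> c * X ^ N" unfolding V plus_complex.sel by linarith
      moreover have "c * X ^ N \<ge> c * L i ^ N" using c XL L1 by (intro mult_left_mono power_mono) auto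
      ultimately show ?thesis by linarith
    qed
    \<comment> \<open>Here \<open>cmod (a i) * L i ^ N\<close> is \<open>s i\<close> and
      \<open>\<tau> i\<close> is \<open>s i / la\<close>, so each summand is
      \<open>c (s i)^2 / la\<close>.\<close>
    have "c * (S / la) = (\<Sum>i\<in>I. cmod (a i) * \<tau> i * (c * L i ^ N))"
    proof -
      have "cmod (a i) * \<tau> i * (c * L i ^ N) = c * (fk (n - m) (cmod (a i)) / la)" for i
        unfolding sfk[symmetric] by (simp add: \<tau>_def s_def power2_eq_square)
      thus ?thesis by (simp add: S_def sum_distrib_left sum_divide_distrib)
    qed
    also have "\<dots> \<le> (\<Sum>i\<in>I. cmod (a i) * \<tau> i * Re (V i))"
    proof (rule sum_mono)
      fix i assume i: "i \<in> I"
      show "cmod (a i) * \<tau> i * (c * L i ^ N) \<le> cmod (a i) * \<tau> i * Re (V i)"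
        using ReV[OF i] t0'[OF i] by (cases "a i = 0") (auto intro!: mult_left_mono)
    qed
    also have "\<dots> = Re (\<Sum>i\<in>I. of_real (cmod (a i) * \<tau> i) * V i)" by simp
    also have "\<dots> \<le> cmod (\<Sum>i\<in>I. of_real (cmod (a i) * \<tau> i) * V i)" by (rule complex_Re_le_cmod)
    also have "\<dots> \<le> B * 4 ^ (n - 1)" using tcT unfolding eq1 eq2 eq3 .
    also have "\<dots> \<le> B * 4 ^ n" using cal_nonneg[OF G(1)] by (intro mult_left_mono power_increasing) auto
    finally have "c * (S / la) \<le> B * 4 ^ n" .
    hence "S \<le> (4 ^ n / c) * B * la" using c la by (simp add: field_simps)
    thus ?thesis by (simp add: S_def la_def)
  qed
  have "4 ^ n / c \<ge> 0" using c by simp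
  from that[OF this t0 main] show ?thesis .
qed

subsection \<open>Bounded completeness and the gliding hump\<close>

text \<open>Resolves the lower estimate, in which \<open>S\<close> occurs on both sides: for
  \<open>S > 1\<close> one divides by \<open>sqrt S\<close>.\<close>

lemma le_max_sqrt_bound:
  fixes S K :: real
  assumes "S \<ge> 0" "K \<ge> 0" "S \<le> K * max 1 (sqrt S)"
  shows "S \<le> max K (K\<^sup>2)"
proof (cases "S \<le> 1")
  case True
  hence "max 1 (sqrt S) = 1" by (simp add: max_def)
  thus ?thesis using assms by simp
next
  case False
  hence "sqrt S > 1" by simp
  hence "max 1 (sqrt S) = sqrt S" by simp
  hence "sqrt S * sqrt S \<le> K * sqrt S" using assms by simp
  hence "sqrt S \<le> K" using \<open>sqrt S > 1\<close> by (simp only: mult_le_cancel_right)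
  hence "(sqrt S)\<^sup>2 \<le> K\<^sup>2" using assms by (intro power_mono) auto
  thus ?thesis using assms by simp
qed

lemma half_power_less: "e > 0 \<Longrightarrow> \<exists>i. (1/2) ^ i < (e::real)"
  using real_arch_pow_inv[of e "1/2"] by simp

lemma disjoint_familyI_less:
  fixes A :: "nat \<Rightarrow> 'b set"
  assumes "\<And>i j. i < j \<Longrightarrow> A i \<inter> A j = {}"
  shows "disjoint_family A"
  unfolding disjoint_family_on_def
proof (intro ballI impI)
  fix i j :: nat assume "i \<noteq> j"
  thus "A i \<inter> A j = {}" using assms[of i j] assms[of j i] by (cases "i < j") auto
qed

lemma pr_pr: "pr A (pr B x) = pr (A \<inter> B) x"
  by (auto simp: pr_def fun_eq_iff)

lemma block_dichotomy_zle:
  fixes A :: "nat \<Rightarrow> nat set"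
  assumes A: "disjoint_family A" "\<And>i. finite (A i)" and v: "\<And>i. zle n (v i) C"
  shows "\<exists>r m g C' d. strict_mono r \<and> blocks n m (A \<circ> r) g C' d
     \<and> (\<forall>i. zle n (\<lambda>j k. pr (A (r i)) (v (r i)) j k - jet (g i) j k) ((1/2) ^ i))"
proof -
  have "\<forall>i. \<exists>f. cal C f \<and> (\<forall>j<n. \<forall>k. v i j k = jet f j k)" using v by (auto simp: zle_def)
  then obtain f where f: "\<And>i. cal C (f i)" "\<And>i j k. j < n \<Longrightarrow> v i j k = jet (f i) j k" by metis
  define h where "h = (\<lambda>i z k. if k \<in> A i then f i z k else 0)"
  have h: "cal C (h i)" for i unfolding h_def by (rule cal_restrict[OF f(1)])
  have th: "jet (h i) j k = pr (A i) (v i) j k" if "j < n" for i j k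
    using f(2)[OF that] by (cases "k \<in> A i") (auto simp: h_def pr_def)
  obtain r m g C' d where r: "strict_mono r" "blocks n m (A \<circ> r) g C' d"
      "\<And>i. cal ((1/2) ^ i) (\<lambda>z k. h (r i) z k - g i z k)"
    using block_dichotomy[OF A, of h C n] h by (auto simp: h_def)
  have "zle n (\<lambda>j k. pr (A (r i)) (v (r i)) j k - jet (g i) j k) ((1/2) ^ i)" for i
    unfolding zle_def
  proof (intro exI conjI allI impI)
    fix j k assume j: "j < n"
    show "pr (A (r i)) (v (r i)) j k - jet (g i) j k = tc (\<lambda>z. h (r i) z k - g i z k) j"
      unfolding tc_diff[OF cal_hol[OF h] cal_hol[OF blocksD(5)[OF r(2)]]] th[OF j] ..
  qed (rule r(3))
  thus ?thesis using r by blast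
qed

lemma fk_pos: "0 < t \<Longrightarrow> t < 1 \<Longrightarrow> fk k t > 0"
  unfolding fk_def by (simp add: power_mult zero_less_power)

text \<open>Bounded completeness: a divergent bounded series of blocks would violate the lower estimate for constant coefficients.\<close>

lemma bounded_projections_Cauchy:
  assumes C: "\<And>N. zle n (pr {..<N} x) C" and e: "e > 0"
  shows "\<exists>N0. \<forall>N\<ge>N0. \<forall>M. zle n (pr {N..<M} x) e"
proof (rule ccontr)
  assume "\<not> ?thesis"
  hence neg: "\<exists>N M. N \<ge> N0 \<and> \<not> zle n (pr {N..<M} x) e" for N0 by blast
  have lt: "N < M" if "\<not> zle n (pr {N..<M} x) e" for N M
  proof (rule ccontr)
    assume "\<not> N < M"
    hence "pr {N..<M} x = (\<lambda>j k. 0)" by (auto simp: pr_def fun_eq_iff)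
    thus False using that zle_zero[of e n] e by simp
  qed
  \<comment> \<open>Infinitely many successive windows, on each of which \<open>x\<close> fails to
    be small.\<close>
  have "\<exists>p. \<forall>i. \<not> zle n (pr {fst (p i)..<snd (p i)} x) e \<and> snd (p i) \<le> fst (p (Suc i))"
  proof (rule dependent_nat_choice)
    show "\<exists>p. \<not> zle n (pr {fst p..<snd p} x) e" using neg[of 0] by (metis fst_conv snd_conv)
    fix p :: "nat \<times> nat" and i :: nat
    show "\<exists>q. \<not> zle n (pr {fst q..<snd q} x) e \<and> snd p \<le> fst q" using neg[of "snd p"] by (metis fst_conv snd_conv)
  qed
  then obtain p where p: "\<And>i. \<not> zle n (pr {fst (p i)..<snd (p i)} x) e" "\<And>i. snd (p i) \<le> fst (p (Suc i))" by blast
  have plt: "fst (p i) < snd (p i)" for i by (rule lt[OF p(1)])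
  have ple: "snd (p i) \<le> fst (p (Suc (i + l)))" for i l
  proof (induction l)
    case (Suc l)
    thus ?case using plt[of "Suc (i + l)"] p(2)[of "Suc (i + l)"] by simp
  qed (simp add: p)
  define A where "A = (\<lambda>i. {fst (p i)..<snd (p i)})"
  have disj: "A i \<inter> A i' = {}" if "i < i'" for i i'
  proof -
    have "\<exists>l. i' = Suc (i + l)" by (rule less_imp_Suc_add[OF that])
    then obtain l where "i' = Suc (i + l)" ..
    thus ?thesis using ple[of i l] by (auto simp: A_def)
  qed
  have A: "disjoint_family A" "\<And>i. finite (A i)"
    using disjoint_familyI_less[OF disj] by (auto simp: A_def)
  have v: "zle n (pr {..<snd (p i)} x) C" for i by (rule C)
  have prA: "pr (A i) (pr {..<snd (p i)} x) = pr (A i) x" for i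
    unfolding pr_pr by (rule arg_cong[of _ _ "\<lambda>A. pr A x"]) (auto simp: A_def)
  obtain r m g C' d where r: "strict_mono r" and b: "blocks n m (A \<circ> r) g C' d"
      and err: "\<And>i. zle n (\<lambda>j k. pr (A (r i)) x j k - jet (g i) j k) ((1/2) ^ i)"
    using block_dichotomy_zle[OF A, of n "\<lambda>i. pr {..<snd (p i)} x", OF v] unfolding prA by blast
  note Bl = blocksD[OF b]
  show False
  proof (cases "m = n")
    case True
    \<comment> \<open>All relevant jets of the blocks vanish, so the part of \<open>x\<close> in a
      late window is pure error and would be small.\<close>
    obtain i where i: "(1/2) ^ i < e" using half_power_less[OF e] by blast
    have "zle n (\<lambda>j k. pr (A (r i)) x j k - jet (g i) j k) ((1/2) ^ i) = zle n (pr (A (r i)) x) ((1/2) ^ i)"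
      by (rule zle_cong) (simp add: Bl(6) True)
    hence "zle n (pr (A (r i)) x) e" using err[of i] i by (auto intro: zle_mono)
    thus False using p(1)[of "r i"] by (simp add: A_def)
  next
    case False
    hence mn: "m < n" using Bl(1) by simp
    obtain K t0 where K: "K \<ge> 0" and t0: "0 < t0" "t0 < 1" and low: "\<And>I a B. finite I \<Longrightarrow> (\<And>i. i \<in> I \<Longrightarrow> cmod (a i) \<le> t0) \<Longrightarrow>
       zle n (\<lambda>j k. \<Sum>i\<in>I. a i * jet (g i) j k) B
       \<Longrightarrow> (\<Sum>i\<in>I. fk (n - m) (cmod (a i))) \<le> K * B * max 1 (sqrt (\<Sum>i\<in>I. fk (n - m) (cmod (a i))))"
    proof -
      show thesis by (rule block_lower_estimate[OF b mn]) (fact that)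
    qed
    have C0: "C \<ge> 0" using zle_nonneg[OF C] .
    define K' where "K' = K * (t0 * (C + 2))"
    have K': "K' \<ge> 0" using K t0 C0 by (simp add: K'_def)
    \<comment> \<open>The sum of the first \<open>q\<close> blocks is a projection of
      \<open>x\<close> up to an error of at most 2, so it is bounded independently of
      \<open>q\<close>. The lower estimate with all coefficients equal to \<open>t0\<close> then
      bounds \<open>q fk (n - m) t0\<close>, which is absurd for large \<open>q\<close>.\<close>
    have bound: "real q * fk (n - m) t0 \<le> max K' (K'\<^sup>2)" for q :: nat
    proof -
      define U where "U = (\<Union>i<q. A (r i))"
      have "finite U" using A(2) by (auto simp: U_def)
      then obtain N where N: "U \<subseteq> {..<N}" using finite_nat_bounded by blast
      have "pr U x = pr U (pr {..<N} x)" unfolding pr_pr using N by (metis Int_absorb2)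
      hence zU: "zle n (pr U x) C" using zle_pr[OF C[of N], of U] by simp
      have U_sum: "pr U x j k = (\<Sum>i<q. pr (A (r i)) x j k)" for j k
      proof (cases "k \<in> U")
        case True
        then obtain i where i: "i < q" "k \<in> A (r i)" by (auto simp: U_def)
        have "(\<Sum>i<q. pr (A (r i)) x j k) = (\<Sum>i\<in>{i}. pr (A (r i)) x j k)"
        proof (rule sum.mono_neutral_right)
          show "\<forall>i'\<in>{..<q} - {i}. pr (A (r i')) x j k = 0"
          proof
            fix i' assume "i' \<in> {..<q} - {i}"
            hence "(A \<circ> r) i' \<inter> (A \<circ> r) i = {}" using Bl(2) by (auto simp: disjoint_family_on_def)
            thus "pr (A (r i')) x j k = 0" using i by (auto simp: pr_def)
          qed
        qed (use i in auto)
        thus ?thesis using i True by (simp add: pr_def)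
      qed (auto simp: U_def pr_def)
      have zE: "zle n (\<lambda>j k. \<Sum>i<q. pr (A (r i)) x j k - jet (g i) j k) (\<Sum>i<q. (1/2) ^ i)"
        by (rule zle_sum) (auto intro: err)
      have "(\<Sum>i<q. (1/2::real) ^ i) \<le> 2" by (simp add: sum_gp_strict)
      hence zE': "zle n (\<lambda>j k. \<Sum>i<q. pr (A (r i)) x j k - jet (g i) j k) 2" using zE zle_mono by blast
      have "zle n (\<lambda>j k. pr U x j k - (\<Sum>i<q. pr (A (r i)) x j k - jet (g i) j k)) (C + 2)"
        by (rule zle_diff[OF zU zE'])
      hence "zle n (\<lambda>j k. \<Sum>i<q. jet (g i) j k) (C + 2)"
        by (simp add: U_sum sum_subtractf)
      from zle_scale[OF this, of "of_real t0"]
      have "zle n (\<lambda>j k. \<Sum>i<q. of_real t0 * jet (g i) j k) (t0 * (C + 2))"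
        using t0 by (simp add: sum_distrib_left)
      from low[OF _ _ this] t0
      have "real q * fk (n - m) t0 \<le> K' * max 1 (sqrt (real q * fk (n - m) t0))"
        by (simp add: K'_def)
      thus ?thesis using K' fk_nonneg by (intro le_max_sqrt_bound) auto
    qed
    have "fk (n - m) t0 > 0" by (rule fk_pos[OF t0])
    then obtain q where "max K' (K'\<^sup>2) < real q * fk (n - m) t0" using reals_Archimedean3 by blast
    thus False using bound[of q] by linarith
  qed
qed

text \<open>The Cauchy property controls finite windows only; the infinite tail is cut into windows
  with bounds \<open>e/2 (1/2)^i\<close>, which are summed by completeness.\<close>

lemma bounded_projections_tail:
  assumes C: "\<And>N. zle n (pr {..<N} x) C" and e: "e > 0"
  shows "\<exists>N0. \<forall>N\<ge>N0. zle n (pr {N..} x) e"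
proof -
  have ex: "\<exists>N0. \<forall>N\<ge>N0. \<forall>M. zle n (pr {N..<M} x) (e / 2 * (1/2) ^ i)" for i :: nat
    by (rule bounded_projections_Cauchy[OF C]) (use e in simp)
  have "\<exists>s. \<forall>i. (\<forall>N\<ge>s i. \<forall>M. zle n (pr {N..<M} x) (e / 2 * (1/2) ^ i)) \<and> s i < s (Suc i)"
  proof (rule dependent_nat_choice)
    show "\<exists>a. \<forall>N\<ge>a. \<forall>M. zle n (pr {N..<M} x) (e / 2 * (1/2) ^ 0)" by (rule ex)
    fix a i
    obtain N0 where "\<forall>N\<ge>N0. \<forall>M. zle n (pr {N..<M} x) (e / 2 * (1/2) ^ Suc i)" using ex by blast
    thus "\<exists>b. (\<forall>N\<ge>b. \<forall>M. zle n (pr {N..<M} x) (e / 2 * (1/2) ^ Suc i)) \<and> (a::nat) < b"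
      by (intro exI[of _ "max N0 (Suc a)"]) auto
  qed
  then obtain s where s: "\<And>i M. zle n (pr {s i..<M} x) (e / 2 * (1/2) ^ i)" "\<And>i. s i < s (Suc i)" by blast
  have sm: "strict_mono s" using s(2) by (simp add: strict_mono_Suc_iff)
  have "(\<lambda>i. (1/2::real) ^ i) sums (1 / (1 - 1/2))" by (rule geometric_sums) simp
  from sums_mult[OF this, of "e/2"] have geo: "(\<lambda>i. e / 2 * (1/2) ^ i) sums e" by simp
  have z: "zle n (\<lambda>j k. \<Sum>i. pr {s i..<s (Suc i)} x j k) e"
    using zle_suminf(1)[of n "\<lambda>i. pr {s i..<s (Suc i)} x", OF s(1)] geo by (simp add: sums_iff)
  have "(\<Sum>i. pr {s i..<s (Suc i)} x j k) = pr {s 0..} x j k" for j k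
  proof -
    have part: "(\<Sum>i<q. pr {s i..<s (Suc i)} x j k) = pr {s 0..<s q} x j k" for q
    proof (induction q)
      case (Suc q)
      have "s 0 \<le> s q" "s q \<le> s (Suc q)" using strict_mono_less_eq[OF sm] by auto
      thus ?case using Suc by (auto simp: pr_def)
    qed (simp add: pr_def)
    have "eventually (\<lambda>q. (\<Sum>i<q. pr {s i..<s (Suc i)} x j k) = pr {s 0..} x j k) sequentially"
      using eventually_gt_at_top[of k]
    proof eventually_elim
      case (elim q)
      hence "k < s q" using strict_mono_imp_increasing[OF sm, of q] by simp
      thus ?case unfolding part by (simp add: pr_def)
    qed
    hence "(\<lambda>q. \<Sum>i<q. pr {s i..<s (Suc i)} x j k) \<longlonglongrightarrow> pr {s 0..} x j k"
      by (rule tendsto_eventually)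
    hence "(\<lambda>i. pr {s i..<s (Suc i)} x j k) sums pr {s 0..} x j k" by (simp add: sums_def)
    thus ?thesis by (rule sums_unique[symmetric])
  qed
  hence z0: "zle n (pr {s 0..} x) e" using z by simp
  have "zle n (pr {N..} x) e" if "N \<ge> s 0" for N
  proof -
    have "{N..} \<inter> {s 0..} = {N..}" using that by auto
    thus ?thesis using zle_pr[OF z0, of "{N..}"] by (simp add: pr_pr)
  qed
  thus ?thesis by blast
qed

text \<open>Bounded completeness in usable form: an array known only through uniformly bounded heads
  acquires a representing function.\<close>

lemma bounded_projections_zle:
  assumes C: "\<And>N. zle n (pr {..<N} x) C"
  shows "zle n x (C + 1)"
proof -
  obtain N where "zle n (pr {N..} x) 1" using bounded_projections_tail[OF C, of 1] by auto
  from zle_add[OF C[of N] this] have "zle n (\<lambda>j k. pr {..<N} x j k + pr {N..} x j k) (C + 1)" .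
  moreover have "(\<lambda>j k. pr {..<N} x j k + pr {N..} x j k) = x" by (auto simp: pr_def fun_eq_iff)
  ultimately show ?thesis by simp
qed

lemma zle_tail:
  assumes "zle n x B" "e > 0"
  shows "\<exists>N0. \<forall>N\<ge>N0. zle n (pr {N..} x) e"
  by (rule bounded_projections_tail[OF zle_pr[OF assms(1)] assms(2)])

section \<open>Extraction of almost disjoint blocks\<close>

lemma head_null:
  assumes w: "\<And>j k. j < n \<Longrightarrow> (\<lambda>i. w i j k) \<longlonglongrightarrow> 0" and e: "e > 0"
  shows "eventually (\<lambda>i. zle n (pr {..<N} (w i)) e) sequentially"
proof -
  obtain K where K: "K \<ge> 0" and small: "\<forall>x e. (\<forall>j<n. \<forall>k. k \<ge> N \<longrightarrow> x j k = 0) \<and> (\<forall>j<n. \<forall>k. cmod (x j k) \<le> e) \<and> e \<ge> 0 \<longrightarrow> zle n x (K * e)"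
    using zle_small_support[of n N] by (elim exE conjE)
  define e' where "e' = e / (K + 1)"
  have e': "e' > 0" "K * e' \<le> e" using K e by (auto simp: e'_def field_simps)
  have "eventually (\<lambda>i. \<forall>j\<in>{..<n}. \<forall>k\<in>{..<N}. cmod (w i j k) \<le> e') sequentially"
  proof (intro eventually_ball_finite ballI finite_lessThan)
    fix j k assume "j \<in> {..<n}"
    hence "(\<lambda>i. w i j k) \<longlonglongrightarrow> 0" using w by simp
    hence "eventually (\<lambda>i. dist (w i j k) 0 < e') sequentially" using e'(1) by (rule tendstoD)
    thus "eventually (\<lambda>i. cmod (w i j k) \<le> e') sequentially" by eventually_elim simp
  qed
  thus ?thesis
  proof eventually_elim
    case (elim i)
    have "zle n (pr {..<N} (w i)) (K * e')" using elim e' by (intro small[rule_format]) (auto simp: pr_def)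
    thus ?case using e'(2) by (rule zle_mono)
  qed
qed

lemma gliding_hump:
  assumes w: "\<And>i. zle n (w i) C" and null: "\<And>j k. j < n \<Longrightarrow> (\<lambda>i. w i j k) \<longlonglongrightarrow> 0"
  shows "\<exists>r m A g C' d. strict_mono r \<and> blocks n m A g C' d \<and>
     (\<forall>i. zle n (\<lambda>j k. w (r i) j k - jet (g i) j k) (2 * (1/2) ^ i))"
proof -
  have tail: "\<exists>N0. \<forall>N\<ge>N0. zle n (pr {N..} (w p)) ((1/2) ^ (i + 2))" for p i
    by (rule zle_tail[OF w]) simp
  \<comment> \<open>\<open>s i\<close> pairs an index with a cut. The current vector is small beyond
    the cut and the next one is small before it, so the next vector lives essentially between two
    consecutive cuts.\<close>
  have "\<exists>s. \<forall>i. zle n (pr {snd (s i)..} (w (fst (s i)))) ((1/2) ^ (i + 2)) \<and>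
      (fst (s i) < fst (s (Suc i)) \<and> snd (s i) < snd (s (Suc i)) \<and> zle n (pr {..<snd (s i)} (w (fst (s (Suc i))))) ((1/2) ^ (i + 2)))"
  proof (rule dependent_nat_choice)
    obtain N where "zle n (pr {N..} (w 0)) ((1/2) ^ (0 + 2))" using tail[of 0 0] by auto
    thus "\<exists>s. zle n (pr {snd s..} (w (fst s))) ((1/2) ^ (0 + 2))" by (intro exI[of _ "(0, N)"]) simp
    fix s :: "nat \<times> nat" and i :: nat
    have "eventually (\<lambda>p. zle n (pr {..<snd s} (w p)) ((1/2) ^ (i + 2))) sequentially"
      by (rule head_null[OF null]) auto
    then obtain p0 where p0: "\<And>p. p \<ge> p0 \<Longrightarrow> zle n (pr {..<snd s} (w p)) ((1/2) ^ (i + 2))"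
      by (auto simp: eventually_sequentially)
    define p where "p = max p0 (Suc (fst s))"
    obtain N0 where N0: "\<And>N. N \<ge> N0 \<Longrightarrow> zle n (pr {N..} (w p)) ((1/2) ^ (Suc i + 2))" using tail[of p "Suc i"] by blast
    show "\<exists>q. zle n (pr {snd q..} (w (fst q))) ((1/2) ^ (Suc i + 2)) \<and>
      (fst s < fst q \<and> snd s < snd q \<and> zle n (pr {..<snd s} (w (fst q))) ((1/2) ^ (i + 2)))"
      using N0[of "max N0 (Suc (snd s))"] p0[of p] by (intro exI[of _ "(p, max N0 (Suc (snd s)))"]) (auto simp: p_def)
  qed
  then obtain s where s1: "\<And>i. zle n (pr {snd (s i)..} (w (fst (s i)))) ((1/2) ^ (i + 2))"
    and s2: "\<And>i. fst (s i) < fst (s (Suc i))" and s3: "\<And>i. snd (s i) < snd (s (Suc i))"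
    and s4: "\<And>i. zle n (pr {..<snd (s i)} (w (fst (s (Suc i))))) ((1/2) ^ (i + 2))" by blast
  \<comment> \<open>The window \<open>A i\<close> belongs to the vector of step
    \<open>i + 1\<close>: the vector of step 0 has no cut on its left.\<close>
  define q where "q = (\<lambda>i. fst (s (Suc i)))"
  define A where "A = (\<lambda>i. {snd (s i)..<snd (s (Suc i))})"
  have q: "strict_mono q" unfolding q_def using s2 by (simp add: strict_mono_Suc_iff)
  have sm: "strict_mono (\<lambda>i. snd (s i))" using s3 by (simp add: strict_mono_Suc_iff)
  have disj: "A i \<inter> A i' = {}" if "i < i'" for i i'
    using strict_mono_less_eq[OF sm, of "Suc i" i'] that by (auto simp: A_def)
  have A: "disjoint_family A" "\<And>i. finite (A i)"
    using disjoint_familyI_less[OF disj] by (auto simp: A_def)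
  obtain r m g C' d where r: "strict_mono r" and b: "blocks n m (A \<circ> r) g C' d"
      and err: "\<And>i. zle n (\<lambda>j k. pr (A (r i)) (w (q (r i))) j k - jet (g i) j k) ((1/2) ^ i)"
    using block_dichotomy_zle[OF A, of n "\<lambda>i. w (q i)" C] w by blast
  have "zle n (\<lambda>j k. w (q (r i)) j k - jet (g i) j k) (2 * (1/2) ^ i)" for i
  proof -
    let ?l = "r i"
    have "zle n (\<lambda>j k. pr {..<snd (s ?l)} (w (q ?l)) j k + pr {snd (s (Suc ?l))..} (w (q ?l)) j k) ((1/2) ^ (?l + 2) + (1/2) ^ (Suc ?l + 2))"
      unfolding q_def by (rule zle_add[OF s4 s1])
    \<comment> \<open>Head and tail errors together stay below \<open>(1/2)^i\<close>; the dichotomy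
      adds the same amount, whence the factor 2 in the claim.\<close>
    moreover have "(1/2) ^ (?l + 2) + (1/2) ^ (Suc ?l + 2) \<le> (1/2::real) ^ i"
    proof -
      have "(1/2::real) ^ ?l \<le> (1/2) ^ i" using strict_mono_imp_increasing[OF r, of i] by (intro power_decreasing) auto
      moreover have "(1/2) ^ (?l + 2) + (1/2) ^ (Suc ?l + 2) = 3/8 * (1/2::real) ^ ?l" by (simp add: power_add)
      moreover have "0 \<le> (1/2::real) ^ ?l" by simp
      ultimately show ?thesis by linarith
    qed
    ultimately have "zle n (\<lambda>j k. pr {..<snd (s ?l)} (w (q ?l)) j k + pr {snd (s (Suc ?l))..} (w (q ?l)) j k) ((1/2) ^ i)"
      by (rule zle_mono)
    from zle_add[OF this err[of i]]
    have "zle n (\<lambda>j k. (pr {..<snd (s ?l)} (w (q ?l)) j k + pr {snd (s (Suc ?l))..} (w (q ?l)) j k) +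
       (pr (A ?l) (w (q ?l)) j k - jet (g i) j k)) (2 * (1/2) ^ i)" by simp
    moreover have "(pr {..<snd (s ?l)} (w (q ?l)) j k + pr {snd (s (Suc ?l))..} (w (q ?l)) j k) +
       (pr (A ?l) (w (q ?l)) j k - jet (g i) j k) = w (q ?l) j k - jet (g i) j k" for j k
      using s3[of ?l] by (auto simp: pr_def A_def)
    ultimately show ?thesis by simp
  qed
  moreover have "strict_mono (q \<circ> r)" using q r by (rule strict_mono_o)
  ultimately have "strict_mono (q \<circ> r) \<and> blocks n m (A \<circ> r) g C' d \<and>
     (\<forall>i. zle n (\<lambda>j k. w ((q \<circ> r) i) j k - jet (g i) j k) (2 * (1/2) ^ i))"
    using b by simp
  thus ?thesis by blast
qed

text \<open>In terms of \<open>x = ln (M / c)\<close> the quantity is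
  \<open>c x^(2 N) / exp x\<close>: the square in \<open>fk\<close> beats the number
  \<open>M\<close> of terms, and the logarithms do not change this.\<close>

lemma fk_average_small:
  assumes c: "c > 0"
  shows "eventually (\<lambda>M. real M * fk (Suc N) (c / real M) < 1) sequentially"
proof -
  have "filterlim (\<lambda>M. real M / c) at_top sequentially"
    using filterlim_tendsto_pos_mult_at_top[OF tendsto_const[of "1/c"] _ filterlim_real_sequentially] c by simp
  hence fl: "filterlim (\<lambda>M. ln (real M / c)) at_top sequentially"
    by (rule filterlim_compose[OF ln_at_top])
  have "((\<lambda>M. c * (ln (real M / c) ^ (2 * N) / exp (ln (real M / c)))) \<longlongrightarrow> c * 0) sequentially"
    by (intro tendsto_mult_left filterlim_compose[OF tendsto_power_div_exp_0 fl])
  hence "eventually (\<lambda>M. c * (ln (real M / c) ^ (2 * N) / exp (ln (real M / c))) < 1) sequentially"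
    by (rule order_tendstoD) simp
  thus ?thesis using eventually_gt_at_top[of 0]
  proof eventually_elim
    case (elim M)
    have "ln (c / real M) = - ln (real M / c)" using elim c by (simp add: ln_div)
    hence "ln (c / real M) ^ (2 * N) = ln (real M / c) ^ (2 * N)" by simp
    hence "real M * fk (Suc N) (c / real M) = real M * ((c / real M)\<^sup>2 * ln (real M / c) ^ (2 * N))"
      by (simp add: fk_def)
    also have "\<dots> = c * (ln (real M / c) ^ (2 * N) / exp (ln (real M / c)))"
      using elim c by (simp add: power2_eq_square)
    finally show ?case using elim by simp
  qed
qed

text \<open>For large \<open>M\<close> the coefficients \<open>c / M\<close> have \<open>fk\<close>
  sum below 1, so the upper estimate bounds their combination by \<open>K\<close>, and division by
  \<open>c\<close> makes the mean small. The start \<open>p\<close> is free so that the mean can be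
  taken over arbitrarily late vectors.\<close>

lemma block_averages_null:
  assumes b: "blocks n m A g C d" and err: "\<And>i. zle n (\<lambda>j k. w i j k - jet (g i) j k) (2 * (1/2) ^ i)"
    and e: "e > 0"
  shows "\<exists>M>0. zle n (\<lambda>j k. (1 / of_nat M) * (\<Sum>i\<in>{p..<p + M}. w i j k)) e"
proof -
  note Bl = blocksD[OF b]
  have main: "eventually (\<lambda>M. zle n (\<lambda>j k. (1 / of_nat M) * (\<Sum>i\<in>{p..<p + M}. jet (g i) j k)) (e / 2)) sequentially"
  proof (cases "m = n")
    case True
    have "zle n (\<lambda>j k. (1 / of_nat M) * (\<Sum>i\<in>{p..<p + M}. jet (g i) j k)) (e / 2) = zle n (\<lambda>j k. 0) (e / 2)" for M
      by (rule zle_cong) (simp add: Bl(6) True)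
    thus ?thesis using e zle_zero[of "e/2" n] by simp
  next
    case False
    hence mn: "m < n" using Bl(1) by simp
    then obtain N where N: "n - m = Suc N" by (metis Suc_diff_Suc)
    obtain K where K: "K \<ge> 0" and up: "\<And>I a. finite I \<Longrightarrow> (\<And>i. i \<in> I \<Longrightarrow> cmod (a i) \<le> exp (-1)) \<Longrightarrow> (\<Sum>i\<in>I. fk (n - m) (cmod (a i))) \<le> 1
       \<Longrightarrow> zle n (\<lambda>j k. \<Sum>i\<in>I. a i * jet (g i) j k) K"
    proof -
      show thesis by (rule block_upper_estimate[OF b mn]) (fact that)
    qed
    \<comment> \<open>Chosen to give \<open>K / c \<le> e / 2\<close>; \<open>K + 1\<close> keeps
      \<open>c\<close> positive when \<open>K = 0\<close>.\<close>
    define c where "c = 2 * (K + 1) / e"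
    have c: "c > 0" "K / c \<le> e / 2" using K e by (auto simp: c_def field_simps)
    have "(\<lambda>M. c / real M) \<longlonglongrightarrow> 0" by (rule tendsto_divide_0[OF tendsto_const]) (auto intro: filterlim_real_sequentially filterlim_at_top_imp_at_infinity)
    hence "eventually (\<lambda>M. c / real M < exp (-1)) sequentially" by (rule order_tendstoD) simp
    with fk_average_small[OF c(1), of N] eventually_gt_at_top[of 0] show ?thesis
    proof eventually_elim
      case (elim M)
      define a :: "nat \<Rightarrow> complex" where "a = (\<lambda>i. of_real (c / real M))"
      have ca: "cmod (a i) = c / real M" for i using c unfolding a_def by (simp only: norm_of_real) simp
      have "zle n (\<lambda>j k. \<Sum>i\<in>{p..<p + M}. a i * jet (g i) j k) K"
        using elim by (intro up) (auto simp: ca N)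
      from zle_scale[OF this, of "of_real (1 / c)"]
      have "zle n (\<lambda>j k. of_real (1/c) * (\<Sum>i\<in>{p..<p + M}. a i * jet (g i) j k)) (K / c)"
        using c by (simp add: norm_divide)
      moreover have "of_real (1/c) * (\<Sum>i\<in>{p..<p + M}. a i * jet (g i) j k) = (1 / of_nat M) * (\<Sum>i\<in>{p..<p + M}. jet (g i) j k)" for j k
        using c unfolding a_def by (simp add: sum_distrib_left)
      ultimately show ?case using c(2) by (simp add: zle_mono)
    qed
  qed
  have "(\<lambda>M. 4 / real M) \<longlonglongrightarrow> 0" by (rule tendsto_divide_0[OF tendsto_const]) (auto intro: filterlim_real_sequentially filterlim_at_top_imp_at_infinity)
  hence "eventually (\<lambda>M. 4 / real M < e / 2) sequentially" by (rule order_tendstoD) (use e in simp)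
  with main eventually_gt_at_top[of 0]
  have "eventually (\<lambda>M. M > 0 \<and> zle n (\<lambda>j k. (1 / of_nat M) * (\<Sum>i\<in>{p..<p + M}. w i j k)) e) sequentially"
  proof eventually_elim
    case (elim M)
    have "zle n (\<lambda>j k. \<Sum>i\<in>{p..<p + M}. w i j k - jet (g i) j k) (\<Sum>i\<in>{p..<p + M}. 2 * (1/2) ^ i)"
      by (rule zle_sum) (auto intro: err)
    moreover have "(\<Sum>i\<in>{p..<p + M}. 2 * (1/2::real) ^ i) \<le> 4"
    proof -
      have "(\<Sum>i\<in>{p..<p + M}. 2 * (1/2::real) ^ i) \<le> (\<Sum>i<p + M. 2 * (1/2::real) ^ i)"
        by (rule sum_mono2) auto
      also have "\<dots> \<le> 4" unfolding sum_distrib_left[symmetric] by (simp add: sum_gp_strict)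
      finally show ?thesis .
    qed
    ultimately have "zle n (\<lambda>j k. \<Sum>i\<in>{p..<p + M}. w i j k - jet (g i) j k) 4" by (rule zle_mono)
    from zle_scale[OF this, of "1 / of_nat M"]
    have "zle n (\<lambda>j k. (1 / of_nat M) * (\<Sum>i\<in>{p..<p + M}. w i j k - jet (g i) j k)) (e / 2)"
      by (rule zle_mono) (use elim in \<open>simp add: norm_divide\<close>)
    from zle_add[OF elim(1) this]
    have "zle n (\<lambda>j k. (1 / of_nat M) * (\<Sum>i\<in>{p..<p + M}. w i j k)) e"
      by (simp add: sum_subtractf right_diff_distrib)
    thus ?case using elim by simp
  qed
  thus ?thesis using eventually_happens'[OF sequentially_bot] by blast
qed

text \<open>A fast Cauchy subsequence is summed through its differences; the components of order
  \<open>n\<close> and above are set to 0, as the carrier demands.\<close>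

lemma zle_complete:
  fixes s :: "nat \<Rightarrow> zelem"
  assumes cau: "\<And>e. e > 0 \<Longrightarrow> \<exists>m0. \<forall>p\<ge>m0. \<forall>q\<ge>m0. zle n (\<lambda>j k. s p j k - s q j k) e"
  shows "\<exists>y. (\<forall>j\<ge>n. y j = (\<lambda>_. 0)) \<and> (\<forall>e>0. \<exists>m0. \<forall>p\<ge>m0. zle n (\<lambda>j k. y j k - s p j k) e)"
proof -
  have "\<exists>u. \<forall>i. (\<forall>p\<ge>u i. \<forall>q\<ge>u i. zle n (\<lambda>j k. s p j k - s q j k) ((1/2) ^ i)) \<and> u i < u (Suc i)"
  proof (rule dependent_nat_choice)
    show "\<exists>a. \<forall>p\<ge>a. \<forall>q\<ge>a. zle n (\<lambda>j k. s p j k - s q j k) ((1/2) ^ 0)" by (rule cau) simp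
    fix a :: nat and i
    obtain m0 where "\<forall>p\<ge>m0. \<forall>q\<ge>m0. zle n (\<lambda>j k. s p j k - s q j k) ((1/2) ^ Suc i)" using cau[of "(1/2) ^ Suc i"] by auto
    thus "\<exists>b. (\<forall>p\<ge>b. \<forall>q\<ge>b. zle n (\<lambda>j k. s p j k - s q j k) ((1/2) ^ Suc i)) \<and> a < b"
      by (intro exI[of _ "max m0 (Suc a)"]) auto
  qed
  then obtain u where u: "\<And>i p q. p \<ge> u i \<Longrightarrow> q \<ge> u i \<Longrightarrow> zle n (\<lambda>j k. s p j k - s q j k) ((1/2) ^ i)"
    "\<And>i. u i < u (Suc i)" by blast
  define x where "x = (\<lambda>i j k. s (u (Suc i)) j k - s (u i) j k)"
  have x: "zle n (x i) ((1/2) ^ i)" for i unfolding x_def using u(2)[of i] by (intro u(1)) auto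
  have geo: "(\<lambda>i. (1/2::real) ^ (i + m)) sums (2 * (1/2) ^ m)" for m
    using sums_mult2[OF geometric_sums[of "1/2::real"], of "(1/2) ^ m"] by (simp add: power_add)
  have sx: "summable (\<lambda>i. x i j k)" if "j < n" for j k
    using zle_suminf(2)[of n x, OF x _ that] geo[of 0] by (simp add: sums_iff)
  define y where "y = (\<lambda>j k. if j < n then s (u 0) j k + (\<Sum>i. x i j k) else 0)"
  have tele: "(\<Sum>i<m. x i j k) = s (u m) j k - s (u 0) j k" for m j k
    unfolding x_def by (rule sum_lessThan_telescope)
  have yt: "zle n (\<lambda>j k. y j k - s (u m) j k) (2 * (1/2) ^ m)" for m
  proof -
    have "zle n (\<lambda>j k. \<Sum>i. x (i + m) j k) (\<Sum>i. (1/2) ^ (i + m))"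
      by (rule zle_suminf(1)) (use x geo[of m] in \<open>auto simp: sums_iff\<close>)
    moreover have "zle n (\<lambda>j k. \<Sum>i. x (i + m) j k) B = zle n (\<lambda>j k. y j k - s (u m) j k) B" for B
    proof (rule zle_cong)
      fix j k assume j: "j < n"
      have "(\<Sum>i. x (i + m) j k) = (\<Sum>i. x i j k) - (\<Sum>i<m. x i j k)"
        by (rule suminf_minus_initial_segment[OF sx[OF j]])
      thus "(\<Sum>i. x (i + m) j k) = y j k - s (u m) j k" using j by (simp add: tele y_def)
    qed
    ultimately show ?thesis using geo[of m] by (simp add: sums_iff)
  qed
  have "\<exists>m0. \<forall>p\<ge>m0. zle n (\<lambda>j k. y j k - s p j k) e" if e: "e > 0" for e
  proof -
    obtain m where m: "(1/2) ^ m < e / 3" using half_power_less[of "e/3"] e by auto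
    have "zle n (\<lambda>j k. y j k - s p j k) e" if p: "p \<ge> u m" for p
    proof -
      have "zle n (\<lambda>j k. (y j k - s (u m) j k) + (s (u m) j k - s p j k)) (2 * (1/2) ^ m + (1/2) ^ m)"
        using p by (intro zle_add yt u(1)) auto
      moreover have "2 * (1/2) ^ m + (1/2) ^ m \<le> e" using m by simp
      ultimately show ?thesis using zle_mono by fastforce
    qed
    thus ?thesis by blast
  qed
  moreover have "\<forall>j\<ge>n. y j = (\<lambda>_. 0)" by (auto simp: y_def)
  ultimately show ?thesis by blast
qed

subsection \<open>Continuity of coordinate functionals\<close>

text \<open>Isolates the Banach space argument that derives continuity of the coordinate functionals
  from completeness and unique expansions. \<open>X\<close> will be the closed span of the basic
  sequence, and \<open>nu\<close> has to be a complete norm on \<open>X\<close> only.\<close>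

locale unique_expansions = vector_space scale
  for scale :: "complex \<Rightarrow> 'a::ab_group_add \<Rightarrow> 'a" +
  fixes X :: "'a set" and nu :: "'a \<Rightarrow> real" and b :: "nat \<Rightarrow> 'a"
  assumes X: "subspace X"
    and nu_nonneg: "x \<in> X \<Longrightarrow> nu x \<ge> 0"
    and nu_add: "x \<in> X \<Longrightarrow> y \<in> X \<Longrightarrow> nu (x + y) \<le> nu x + nu y"
    and nu_scale: "x \<in> X \<Longrightarrow> nu (scale c x) = cmod c * nu x"
    and nu_zero: "x \<in> X \<Longrightarrow> nu x = 0 \<Longrightarrow> x = 0"
    and nu_complete: "(\<And>i. s i \<in> X) \<Longrightarrow> (\<And>e. e > 0 \<Longrightarrow> \<exists>M. \<forall>p\<ge>M. \<forall>q\<ge>M. nu (s p - s q) < e)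
        \<Longrightarrow> \<exists>y\<in>X. (\<lambda>i. nu (y - s i)) \<longlonglongrightarrow> 0"
    and b: "b i \<in> X" "nu (b i) = 1"
    and expansion: "y \<in> X \<Longrightarrow> \<exists>!a. (\<lambda>m. nu (y - (\<Sum>i\<le>m. scale (a i) (b i)))) \<longlonglongrightarrow> 0"
begin

definition S :: "nat \<Rightarrow> (nat \<Rightarrow> complex) \<Rightarrow> 'a" where
  "S m a = (\<Sum>i\<le>m. scale (a i) (b i))"

definition coef :: "'a \<Rightarrow> nat \<Rightarrow> complex" where
  "coef y = (THE a. (\<lambda>m. nu (y - S m a)) \<longlonglongrightarrow> 0)"

lemma S_in: "S m a \<in> X"
  unfolding S_def by (intro subspace_sum[OF X] subspace_scale[OF X] b)

lemma S_add: "S m (\<lambda>i. a i + a' i) = S m a + S m a'"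
  by (simp add: S_def scale_left_distrib sum.distrib)

lemma S_scale: "S m (\<lambda>i. c * a i) = scale c (S m a)"
  by (simp add: S_def scale_sum_right)

lemma S_diff: "S m (\<lambda>i. a i - a' i) = S m a - S m a'"
  by (simp add: S_def scale_left_diff_distrib sum_subtractf)

lemma S_sum: "S m (\<lambda>i. \<Sum>l\<in>L. a l i) = (\<Sum>l\<in>L. S m (a l))"
  unfolding S_def scale_sum_left by (rule sum.swap)

lemma inX: "x \<in> X \<Longrightarrow> y \<in> X \<Longrightarrow> x + y \<in> X" "x \<in> X \<Longrightarrow> y \<in> X \<Longrightarrow> x - y \<in> X" "x \<in> X \<Longrightarrow> scale c x \<in> X" "0 \<in> X"
  using X by (auto intro: subspace_add subspace_diff subspace_scale subspace_0)

lemma nu_0: "nu 0 = 0"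
  using nu_scale[OF inX(4), of 0] by simp

lemma nu_minus_commute: "x \<in> X \<Longrightarrow> y \<in> X \<Longrightarrow> nu (x - y) = nu (y - x)"
  using nu_scale[OF inX(2), of y x "-1"] by simp

lemma nu_diff: "x \<in> X \<Longrightarrow> y \<in> X \<Longrightarrow> nu (x - y) \<le> nu x + nu y"
  using nu_add[of x "scale (-1) y"] nu_scale[of y "-1"] inX(3)[of y "-1"] by simp

lemma nu_triangle: "x \<in> X \<Longrightarrow> y \<in> X \<Longrightarrow> z \<in> X \<Longrightarrow> nu (x - z) \<le> nu (x - y) + nu (y - z)"
  using nu_add[of "x - y" "y - z"] inX(2) by simp

lemma nu_sum: "finite L \<Longrightarrow> (\<And>l. l \<in> L \<Longrightarrow> f l \<in> X) \<Longrightarrow> nu (\<Sum>l\<in>L. f l) \<le> (\<Sum>l\<in>L. nu (f l))"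
proof (induction L rule: finite_induct)
  case (insert l L)
  have "nu (f l + (\<Sum>l\<in>L. f l)) \<le> nu (f l) + nu (\<Sum>l\<in>L. f l)"
    using insert by (intro nu_add subspace_sum[OF X]) auto
  thus ?case using insert by simp
qed (simp add: nu_0)

lemma coef_lim: "y \<in> X \<Longrightarrow> (\<lambda>m. nu (y - S m (coef y))) \<longlonglongrightarrow> 0"
  unfolding coef_def using theI'[OF expansion[of y, folded S_def]] by simp

lemma coef_unique: "y \<in> X \<Longrightarrow> (\<lambda>m. nu (y - S m a)) \<longlonglongrightarrow> 0 \<Longrightarrow> coef y = a"
  using expansion[of y, folded S_def] coef_lim by blast

lemma coef_diff:
  assumes "x \<in> X" "y \<in> X" shows "coef (x - y) = (\<lambda>i. coef x i - coef y i)"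
proof (rule coef_unique)
  show "(\<lambda>m. nu (x - y - S m (\<lambda>i. coef x i - coef y i))) \<longlonglongrightarrow> 0"
  proof (rule real_tendsto_sandwich[OF _ _ tendsto_const])
    show "(\<lambda>m. nu (x - S m (coef x)) + nu (y - S m (coef y))) \<longlonglongrightarrow> 0"
      using tendsto_add[OF coef_lim[OF assms(1)] coef_lim[OF assms(2)]] by simp
    have "nu ((x - S m (coef x)) - (y - S m (coef y))) \<le> nu (x - S m (coef x)) + nu (y - S m (coef y))" for m
      using assms S_in by (intro nu_diff inX)
    thus "eventually (\<lambda>m. nu (x - y - S m (\<lambda>i. coef x i - coef y i)) \<le> nu (x - S m (coef x)) + nu (y - S m (coef y))) sequentially"
      by (simp add: S_diff algebra_simps)
    show "eventually (\<lambda>m. 0 \<le> nu (x - y - S m (\<lambda>i. coef x i - coef y i))) sequentially"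
      using assms S_in by (intro always_eventually allI nu_nonneg inX)
  qed
qed (use assms inX in auto)

lemma coef_scale:
  assumes "x \<in> X" shows "coef (scale c x) = (\<lambda>i. c * coef x i)"
proof (rule coef_unique)
  have "nu (scale c x - S m (\<lambda>i. c * coef x i)) = cmod c * nu (x - S m (coef x))" for m
    using nu_scale[of "x - S m (coef x)" c] assms S_in inX by (simp add: S_scale scale_right_diff_distrib)
  thus "(\<lambda>m. nu (scale c x - S m (\<lambda>i. c * coef x i))) \<longlonglongrightarrow> 0"
    using tendsto_mult_left[OF coef_lim[OF assms], of "cmod c"] by simp
qed (use assms inX in auto)

lemma coef_bound:
  assumes "\<And>m. nu (S m a) \<le> B"
  shows "cmod (a k) \<le> 2 * B"
proof -
  have B: "B \<ge> 0" using assms[of 0] nu_nonneg[OF S_in, of 0 a] by linarith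
  have "cmod (a k) = nu (scale (a k) (b k))" using nu_scale[OF b(1)] b(2) by simp
  also have "\<dots> \<le> 2 * B"
  proof (cases k)
    case 0
    thus ?thesis using assms[of 0] B by (simp add: S_def)
  next
    case (Suc k')
    hence "scale (a k) (b k) = S k a - S k' a" by (simp add: S_def)
    thus ?thesis using nu_diff[OF S_in S_in, of k a k' a] assms[of k] assms[of k'] by simp
  qed
  finally show ?thesis .
qed

text \<open>Balls of the larger norm given by the supremum of \<open>nu (S m (coef y))\<close> over
  \<open>m\<close>, for which the coordinate functionals are continuous by
  \<open>coef_bound\<close>; the task is to compare it with \<open>nu\<close>.\<close>

definition ball_sums :: "real \<Rightarrow> 'a set" where
  "ball_sums N = {y \<in> X. \<forall>m. nu (S m (coef y)) \<le> N}"

lemma ball_sums_diff: "x \<in> ball_sums N \<Longrightarrow> y \<in> ball_sums N \<Longrightarrow> x - y \<in> ball_sums (2 * N)"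
  unfolding ball_sums_def
proof safe
  fix m assume x: "x \<in> X" "\<forall>m. nu (S m (coef x)) \<le> N" and y: "y \<in> X" "\<forall>m. nu (S m (coef y)) \<le> N"
  show "nu (S m (coef (x - y))) \<le> 2 * N"
    unfolding coef_diff[OF x(1) y(1)] S_diff using nu_diff[OF S_in S_in, of m "coef x" m "coef y"] x(2) y(2)
    by (smt (verit))
qed (auto intro: inX)

lemma ball_sums_scale: "x \<in> ball_sums N \<Longrightarrow> scale c x \<in> ball_sums (cmod c * N)"
  by (auto simp: ball_sums_def inX coef_scale S_scale nu_scale[OF S_in] intro!: mult_left_mono)

lemma ball_sums_cover: "y \<in> X \<Longrightarrow> \<exists>N::nat. y \<in> ball_sums (real N)"
proof -
  assume y: "y \<in> X"
  have "convergent (\<lambda>m. nu (y - S m (coef y)))" using coef_lim[OF y] by (auto simp: convergent_def)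
  then obtain K where K: "\<And>m. norm (nu (y - S m (coef y))) \<le> K"
    using convergent_imp_Bseq by (metis BseqE)
  have "nu (S m (coef y)) \<le> nu y + K" for m
  proof -
    have "nu (y - (y - S m (coef y))) \<le> nu y + nu (y - S m (coef y))" using y S_in by (intro nu_diff inX)
    thus ?thesis using K[of m] by simp
  qed
  moreover obtain N :: nat where "nu y + K \<le> real N" using real_arch_simple by blast
  ultimately have "nu (S m (coef y)) \<le> real N" for m by (meson order_trans)
  thus ?thesis using y by (auto simp: ball_sums_def)
qed

text \<open>Baire category: the closures of the sets \<open>ball_sums N\<close> cover
  \<open>X\<close>, so one of them contains a ball around some \<open>x0\<close>. Taking differences
  moves the centre to 0 and doubles \<open>N\<close>.\<close>

lemma approx_ball_sums:
  "\<exists>N\<ge>0. \<exists>r>0. \<forall>v\<in>X. nu v < r \<longrightarrow> (\<forall>e>0. \<exists>u\<in>ball_sums N. nu (v - u) < e)"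
proof -
  \<comment> \<open>Extended by 0 off \<open>X\<close>, because nonnegativity and symmetry of the
    metric are demanded at all points of the type.\<close>
  define d where "d = (\<lambda>x y. if x \<in> X \<and> y \<in> X then nu (x - y) else 0)"
  interpret M: Metric_space X d
  proof
    show "0 \<le> d x y" for x y by (auto simp: d_def inX intro!: nu_nonneg)
    show "d x y = d y x" for x y by (auto simp: d_def nu_minus_commute)
    show "(d x y = 0) = (x = y)" if "x \<in> X" "y \<in> X" for x y
      using that nu_zero[of "x - y"] inX by (auto simp: d_def nu_0)
    show "d x z \<le> d x y + d y z" if "x \<in> X" "y \<in> X" "z \<in> X" for x y z
      using that nu_triangle by (auto simp: d_def)
  qed
  have complete: "M.mcomplete"
    unfolding M.mcomplete_def
  proof (intro allI impI)
    fix s assume s: "M.MCauchy s"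
    have sX: "s i \<in> X" for i using s by (auto simp: M.MCauchy_def)
    have "\<exists>y\<in>X. (\<lambda>i. nu (y - s i)) \<longlonglongrightarrow> 0"
    proof (rule nu_complete[OF sX])
      fix e :: real assume "e > 0"
      then obtain M where "\<forall>n n'. M \<le> n \<longrightarrow> M \<le> n' \<longrightarrow> d (s n) (s n') < e" using s by (auto simp: M.MCauchy_def)
      thus "\<exists>M. \<forall>p\<ge>M. \<forall>q\<ge>M. nu (s p - s q) < e" using sX by (auto simp: d_def)
    qed
    then obtain y where y: "y \<in> X" "(\<lambda>i. nu (y - s i)) \<longlonglongrightarrow> 0" by blast
    have "(\<lambda>i. d (s i) y) \<longlonglongrightarrow> 0" using y sX nu_minus_commute by (simp add: d_def)
    hence "limitin M.mtopology s y sequentially"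
      using y sX by (simp add: M.limit_metric_sequentially) (auto simp: LIMSEQ_def dist_real_def intro: exI[of _ 0])
    thus "\<exists>x. limitin M.mtopology s x sequentially" by blast
  qed
  define T where "T = (\<lambda>N::nat. M.mtopology closure_of ball_sums (real N))"
  have sub: "ball_sums N \<subseteq> X" for N by (auto simp: ball_sums_def)
  have "\<exists>N. M.mtopology interior_of T N \<noteq> {}"
  proof (rule ccontr)
    assume "\<not> ?thesis"
    hence "\<And>C. C \<in> range T \<Longrightarrow> closedin M.mtopology C \<and> M.mtopology interior_of C = {}"
      by (auto simp: T_def)
    from M.metric_Baire_category_alt[OF complete _ this]
    have "M.mtopology interior_of \<Union>(range T) = {}" by simp
    moreover have "\<Union>(range T) = X"
    proof
      show "\<Union>(range T) \<subseteq> X" using closure_of_subset_topspace[of M.mtopology] by (auto simp: T_def)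
      show "X \<subseteq> \<Union>(range T)"
      proof
        fix y assume "y \<in> X"
        then obtain N where "y \<in> ball_sums (real N)" using ball_sums_cover by blast
        hence "y \<in> T N" unfolding T_def using closure_of_subset[of "ball_sums (real N)" M.mtopology] sub by auto
        thus "y \<in> \<Union>(range T)" by blast
      qed
    qed
    ultimately show False using inX(4) interior_of_topspace[of M.mtopology] by auto
  qed
  then obtain N x0 where x0: "x0 \<in> M.mtopology interior_of T N" by blast
  have "openin M.mtopology (M.mtopology interior_of T N)" by simp
  then obtain r where r: "r > 0" "M.mball x0 r \<subseteq> M.mtopology interior_of T N"
    using x0 unfolding M.openin_mtopology by blast
  have "M.mball x0 r \<subseteq> T N" using r(2) interior_of_subset[of M.mtopology "T N"] by auto
  have x0X: "x0 \<in> X" using x0 interior_of_subset_topspace[of M.mtopology "T N"] by auto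
  have near: "\<exists>a\<in>ball_sums (real N). nu (y - a) < e" if "y \<in> X" "nu (y - x0) < r" "e > 0" for y e
  proof -
    have "d x0 y < r" using that x0X nu_minus_commute[of x0 y] by (simp add: d_def)
    hence "y \<in> M.mball x0 r" unfolding M.in_mball using that x0X by blast
    hence "y \<in> T N" using \<open>M.mball x0 r \<subseteq> T N\<close> by blast
    hence "\<exists>a\<in>ball_sums (real N). a \<in> M.mball y e" using that unfolding T_def M.metric_closure_of by auto
    then obtain a where a: "a \<in> ball_sums (real N)" "d y a < e" unfolding M.in_mball by blast
    hence "nu (y - a) < e" using that(1) sub by (auto simp: d_def subset_iff)
    thus ?thesis using a(1) by blast
  qed
  have "\<exists>u\<in>ball_sums (2 * real N). nu (v - u) < e" if v: "v \<in> X" "nu v < r" and e: "e > 0" for v e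
  proof -
    obtain a where a: "a \<in> ball_sums (real N)" "nu (x0 + v - a) < e/2"
      using near[of "x0 + v" "e/2"] v e x0X inX by auto
    obtain a' where a': "a' \<in> ball_sums (real N)" "nu (x0 - a') < e/2"
      using near[of "x0" "e/2"] e x0X r nu_0 by auto
    have aX: "a \<in> X" "a' \<in> X" using a a' sub by auto
    have "nu ((x0 + v - a) - (x0 - a')) \<le> nu (x0 + v - a) + nu (x0 - a')"
      using aX x0X v by (intro nu_diff inX)
    hence "nu (v - (a - a')) < e" using a a' by (simp add: algebra_simps)
    thus ?thesis using ball_sums_diff[OF a(1) a'(1)] by blast
  qed
  thus ?thesis using r(1) by (intro exI[of _ "2 * real N"]) auto
qed

text \<open>Homogeneity: the approximation is applied to \<open>2^l v\<close> and scaled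
  back.\<close>

lemma approx_ball_sums_scaled:
  assumes N: "\<And>v e. v \<in> X \<Longrightarrow> nu v < r \<Longrightarrow> e > 0 \<Longrightarrow> \<exists>u\<in>ball_sums N. nu (v - u) < e"
    and v: "v \<in> X" "nu v < r * (1/2) ^ l" and e: "e > 0"
  shows "\<exists>u\<in>ball_sums (N * (1/2) ^ l). nu (v - u) < e"
proof -
  have c: "cmod (2 ^ l) = 2 ^ l" "cmod ((1/2) ^ l) = (1/2) ^ l" by (simp_all add: norm_power norm_divide)
  have "nu (scale (2 ^ l) v) < r" using v nu_scale[OF v(1), of "2 ^ l"] c(1) by (simp add: field_simps power_divide)
  then obtain u where u: "u \<in> ball_sums N" "nu (scale (2 ^ l) v - u) < e"
    using N[of "scale (2 ^ l) v" e] v e inX by auto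
  have uX: "u \<in> X" using u by (simp add: ball_sums_def)
  have "v - scale ((1/2) ^ l) u = scale ((1/2) ^ l) (scale (2 ^ l) v - u)"
    by (simp add: scale_right_diff_distrib power_mult_distrib[symmetric])
  hence "nu (v - scale ((1/2) ^ l) u) = (1/2) ^ l * nu (scale (2 ^ l) v - u)"
    using nu_scale[of "scale (2 ^ l) v - u" "(1/2) ^ l"] uX v inX c(2) by simp
  also have "\<dots> \<le> 1 * nu (scale (2 ^ l) v - u)"
    using uX v inX by (intro mult_right_mono nu_nonneg) (auto simp: power_le_one)
  finally have "nu (v - scale ((1/2) ^ l) u) < e" using u by simp
  moreover have "scale ((1/2) ^ l) u \<in> ball_sums (N * (1/2) ^ l)"
    using ball_sums_scale[OF u(1), of "(1/2) ^ l"] unfolding c(2) by (simp add: mult.commute)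
  ultimately show ?thesis by blast
qed

text \<open>Banach's theorem on the continuity of the coordinate functionals, by the successive approximation
  argument of the open mapping theorem.\<close>

lemma coef_locally_bounded: "\<exists>K\<ge>0. \<exists>r>0. \<forall>v\<in>X. nu v < r \<longrightarrow> cmod (coef v k) \<le> K"
proof -
  obtain N r where N0: "N \<ge> 0" and r: "r > 0" and N: "\<And>v e. v \<in> X \<Longrightarrow> nu v < r \<Longrightarrow> e > 0 \<Longrightarrow> \<exists>u\<in>ball_sums N. nu (v - u) < e"
    using approx_ball_sums by blast
  have "cmod (coef v k) \<le> 4 * N" if v: "v \<in> X" "nu v < r" for v
  proof -
    \<comment> \<open>\<open>V l\<close> is the remainder after \<open>l\<close> corrections; the
      correction \<open>V l - V (Suc l)\<close> has all partial sums bounded by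
      \<open>N (1/2)^l\<close>.\<close>
    have "\<exists>V. \<forall>l. (V l \<in> X \<and> nu (V l) < r * (1/2) ^ l \<and> (l = 0 \<longrightarrow> V l = v)) \<and> V l - V (Suc l) \<in> ball_sums (N * (1/2) ^ l)"
    proof (rule dependent_nat_choice)
      show "\<exists>x. x \<in> X \<and> nu x < r * (1/2) ^ 0 \<and> ((0::nat) = 0 \<longrightarrow> x = v)" using v by auto
      fix x l assume x: "x \<in> X \<and> nu x < r * (1/2) ^ l \<and> (l = 0 \<longrightarrow> x = v)"
      obtain u where u: "u \<in> ball_sums (N * (1/2) ^ l)" "nu (x - u) < r * (1/2) ^ Suc l"
        using approx_ball_sums_scaled[where N=N and r=r and v=x and l=l and e="r * (1/2) ^ Suc l", OF N] x r by auto
      thus "\<exists>y. (y \<in> X \<and> nu y < r * (1/2) ^ Suc l \<and> (Suc l = 0 \<longrightarrow> y = v)) \<and> x - y \<in> ball_sums (N * (1/2) ^ l)"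
        using x by (intro exI[of _ "x - u"]) (auto simp: ball_sums_def inX)
    qed
    then obtain V where V: "\<And>l. V l \<in> X" "\<And>l. nu (V l) < r * (1/2) ^ l" "V 0 = v"
      and VU: "\<And>l. V l - V (Suc l) \<in> ball_sums (N * (1/2) ^ l)" by blast
    define u where "u = (\<lambda>l. V l - V (Suc l))"
    have uX: "u l \<in> X" for l unfolding u_def by (intro inX V)
    have uS: "nu (S m (coef (u l))) \<le> N * (1/2) ^ l" for m l using VU[of l] by (simp add: u_def ball_sums_def)
    have cb: "cmod (coef (u l) i) \<le> 2 * N * (1/2) ^ l" for l i using coef_bound[OF uS, of l i] by simp
    have geo: "(\<lambda>l. 2 * N * (1/2) ^ l) sums (4 * N)"
      using sums_mult[OF geometric_sums[of "1/2::real"], of "2 * N"] by simp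
    have summ: "summable (\<lambda>l. cmod (coef (u l) i))" for i
      using sums_summable[OF geo] by (rule summable_comparison_test') (use cb in auto)
    have summ': "summable (\<lambda>l. coef (u l) i)" for i using summ by (rule summable_norm_cancel)
    \<comment> \<open>The candidate expansion of \<open>v\<close>: the coefficients of all
      corrections added up.\<close>
    define c where "c = (\<lambda>i. \<Sum>l. coef (u l) i)"
    define ct where "ct = (\<lambda>J i. c i - (\<Sum>l<J. coef (u l) i))"
    have ct0: "(\<lambda>J. ct J i) \<longlonglongrightarrow> 0" for i
      using tendsto_diff[OF tendsto_const summable_LIMSEQ[OF summ'[of i]], of "c i"] by (simp add: ct_def c_def)
    have cmodc: "cmod (c i) \<le> 4 * N" for i
    proof -
      have "cmod (c i) \<le> (\<Sum>l. cmod (coef (u l) i))" unfolding c_def by (rule summable_norm[OF summ])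
      also have "\<dots> \<le> (\<Sum>l. 2 * N * (1/2) ^ l)" by (intro suminf_le summ sums_summable[OF geo] cb)
      finally show ?thesis using sums_unique[OF geo] by simp
    qed
    have St0: "(\<lambda>J. nu (S m (ct J))) \<longlonglongrightarrow> 0" for m
    proof (rule real_tendsto_sandwich[OF _ _ tendsto_const])
      show "(\<lambda>J. \<Sum>i\<le>m. cmod (ct J i)) \<longlonglongrightarrow> 0"
        using tendsto_sum[of "{..m}" "\<lambda>i J. cmod (ct J i)" "\<lambda>i. 0"] tendsto_norm[OF ct0] by simp
      show "eventually (\<lambda>J. 0 \<le> nu (S m (ct J))) sequentially" by (intro always_eventually allI nu_nonneg S_in)
      have "nu (S m (ct J)) \<le> (\<Sum>i\<le>m. cmod (ct J i))" for J
      proof -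
        have "nu (S m (ct J)) \<le> (\<Sum>i\<le>m. nu (scale (ct J i) (b i)))" unfolding S_def by (intro nu_sum inX b) auto
        thus ?thesis by (simp add: nu_scale b)
      qed
      thus "eventually (\<lambda>J. nu (S m (ct J)) \<le> (\<Sum>i\<le>m. cmod (ct J i))) sequentially" by simp
    qed
    \<comment> \<open>Split off \<open>q\<close> corrections, which are bounded by a geometric
      series, and let \<open>q\<close> tend to infinity. What remains tends to 0, since for fixed
      \<open>m\<close> only finitely many coefficients are involved.\<close>
    have Stail: "nu (S m (ct J)) \<le> 2 * N * (1/2) ^ J" for m J
    proof -
      have "nu (S m (ct J)) \<le> 2 * N * (1/2) ^ J + nu (S m (ct (J + q)))" for q
      proof -
        have "ct J = (\<lambda>i. (\<Sum>l\<in>{J..<J + q}. coef (u l) i) + ct (J + q) i)"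
        proof
          fix i
          have "(\<Sum>l<J + q. coef (u l) i) = (\<Sum>l<J. coef (u l) i) + (\<Sum>l\<in>{J..<J + q}. coef (u l) i)"
            by (simp add: lessThan_atLeast0 sum.atLeastLessThan_concat)
          thus "ct J i = (\<Sum>l\<in>{J..<J + q}. coef (u l) i) + ct (J + q) i" by (simp add: ct_def)
        qed
        hence eq: "S m (ct J) = (\<Sum>l\<in>{J..<J + q}. S m (coef (u l))) + S m (ct (J + q))"
          by (simp only: S_add S_sum)
        have "nu (\<Sum>l\<in>{J..<J + q}. S m (coef (u l))) \<le> (\<Sum>l\<in>{J..<J + q}. nu (S m (coef (u l))))"
          by (rule nu_sum) (auto intro: S_in)
        also have "\<dots> \<le> (\<Sum>l\<in>{J..<J + q}. N * (1/2) ^ l)" by (intro sum_mono uS)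
        also have "\<dots> = (\<Sum>l<q. N * (1/2) ^ (l + J))"
          using sum.shift_bounds_nat_ivl[of "\<lambda>l. N * (1/2) ^ l" 0 J q] by (simp add: lessThan_atLeast0 add.commute)
        also have "\<dots> = N * (1/2) ^ J * (\<Sum>l<q. (1/2) ^ l)" by (simp add: sum_distrib_left power_add mult_ac)
        also have "\<dots> \<le> N * (1/2) ^ J * 2" using N0 by (intro mult_left_mono) (auto simp: sum_gp_strict)
        finally have "nu (\<Sum>l\<in>{J..<J + q}. S m (coef (u l))) \<le> 2 * N * (1/2) ^ J" by simp
        moreover have "nu (S m (ct J)) \<le> nu (\<Sum>l\<in>{J..<J + q}. S m (coef (u l))) + nu (S m (ct (J + q)))"
          unfolding eq by (intro nu_add subspace_sum[OF X] S_in)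
        ultimately show ?thesis by simp
      qed
      moreover have "(\<lambda>q. 2 * N * (1/2) ^ J + nu (S m (ct (J + q)))) \<longlonglongrightarrow> 2 * N * (1/2) ^ J + 0"
        using LIMSEQ_ignore_initial_segment[OF St0[of m], of J] by (intro tendsto_add tendsto_const) (simp add: add.commute)
      ultimately show ?thesis using LIMSEQ_le_const by fastforce
    qed
    have "(\<lambda>m. nu (v - S m c)) \<longlonglongrightarrow> 0"
    proof (rule tendstoI)
      fix e :: real assume e: "e > 0"
      have "(\<lambda>J. (r + 2 * N) * (1/2) ^ J) \<longlonglongrightarrow> (r + 2 * N) * 0"
        by (intro tendsto_mult_left LIMSEQ_power_zero) simp
      hence "eventually (\<lambda>J. (r + 2 * N) * (1/2) ^ J < e/2) sequentially" by (rule order_tendstoD) (use e in simp)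
      \<comment> \<open>\<open>J\<close> is fixed first, making the remainder \<open>V J\<close> and
        the tail of the coefficients small uniformly in \<open>m\<close>; then only the convergent
        expansions of \<open>J\<close> corrections are left.\<close>
      then obtain J where J: "(r + 2 * N) * (1/2) ^ J < e/2" using eventually_happens'[OF sequentially_bot] by blast
      have "(\<lambda>m. \<Sum>l<J. nu (u l - S m (coef (u l)))) \<longlonglongrightarrow> 0"
        using tendsto_sum[of "{..<J}" "\<lambda>l m. nu (u l - S m (coef (u l)))" "\<lambda>l. 0"] coef_lim[OF uX] by simp
      hence "eventually (\<lambda>m. (\<Sum>l<J. nu (u l - S m (coef (u l)))) < e/2) sequentially" by (rule order_tendstoD) (use e in simp)
      thus "eventually (\<lambda>m. dist (nu (v - S m c)) 0 < e) sequentially"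
      proof eventually_elim
        case (elim m)
        have "(\<Sum>l<J. u l) = V 0 - V J" unfolding u_def using sum_lessThan_telescope'[of V J] by simp
        hence vJ: "v = (\<Sum>l<J. u l) + V J" using V(3) by simp
        have "c = (\<lambda>i. (\<Sum>l<J. coef (u l) i) + ct J i)" by (simp add: ct_def)
        hence Sc: "S m c = (\<Sum>l<J. S m (coef (u l))) + S m (ct J)" by (metis S_add S_sum)
        have "v - S m c = (\<Sum>l<J. u l - S m (coef (u l))) + (V J - S m (ct J))"
          unfolding Sc sum_subtractf by (subst vJ) (simp add: algebra_simps)
        hence "nu (v - S m c) = nu ((\<Sum>l<J. u l - S m (coef (u l))) + (V J - S m (ct J)))" by simp
        moreover have "r * (1/2) ^ J + 2 * N * (1/2) ^ J < e/2" using J by (simp only: distrib_right)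
        moreover have "nu ((\<Sum>l<J. u l - S m (coef (u l))) + (V J - S m (ct J)))
           \<le> nu (\<Sum>l<J. u l - S m (coef (u l))) + nu (V J - S m (ct J))"
          by (intro nu_add subspace_sum[OF X] inX S_in uX V)
        moreover have "nu (\<Sum>l<J. u l - S m (coef (u l))) \<le> (\<Sum>l<J. nu (u l - S m (coef (u l))))"
          by (intro nu_sum inX S_in uX) auto
        moreover have "nu (V J - S m (ct J)) \<le> nu (V J) + nu (S m (ct J))" by (intro nu_diff V S_in)
        ultimately have "nu (v - S m c) < e"
          using elim V(2)[of J] Stail[of m J] by linarith
        moreover have "nu (v - S m c) \<ge> 0" by (intro nu_nonneg inX v S_in)
        ultimately show ?case by simp
      qed
    qed
    \<comment> \<open>Uniqueness of expansions transfers the bound on the constructed coefficients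
      to those of \<open>v\<close>.\<close>
    hence "coef v = c" by (rule coef_unique[OF v(1)])
    thus ?thesis using cmodc by simp
  qed
  thus ?thesis using r N0 by (intro exI[of _ "4 * N"]) auto
qed

text \<open>Scaling turns local boundedness of a linear functional into continuity, and a continuous
  functional that vanishes on approximants of \<open>y\<close> vanishes at \<open>y\<close>.\<close>

lemma coef_eq_0:
  assumes y: "y \<in> X" and ap: "\<And>e. e > 0 \<Longrightarrow> \<exists>z\<in>X. coef z k = 0 \<and> nu (y - z) < e"
  shows "coef y k = 0"
proof -
  obtain K r where K: "K \<ge> 0" "r > 0" "\<And>v. v \<in> X \<Longrightarrow> nu v < r \<Longrightarrow> cmod (coef v k) \<le> K"
    using coef_locally_bounded[of k] by blast
  have "cmod (coef y k) \<le> 0 + e" if e: "e > 0" for e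
  proof -
    define t where "t = (K + 1) / e"
    have t: "t > 0" using K e by (simp add: t_def)
    obtain z where z: "z \<in> X" "coef z k = 0" "nu (y - z) < r / t" using ap[of "r / t"] K t by auto
    have "nu (scale (of_real t) (y - z)) < r" using z t y inX by (subst nu_scale) (auto simp: field_simps)
    hence "cmod (coef (scale (of_real t) (y - z)) k) \<le> K" using y z inX by (intro K(3)) auto
    hence "t * cmod (coef y k) \<le> K" using y z t inX by (simp add: coef_scale coef_diff norm_mult)
    hence "cmod (coef y k) \<le> K / t" using t by (simp add: field_simps)
    also have "\<dots> \<le> e" using K e by (simp add: t_def field_simps)
    finally show ?thesis by simp
  qed
  hence "cmod (coef y k) \<le> 0" by (rule field_le_epsilon)
  thus ?thesis by simp
qed

lemma coef_S: "coef (S q a) = (\<lambda>i. if i \<le> q then a i else 0)"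
proof (rule coef_unique[OF S_in])
  have "S m (\<lambda>i. if i \<le> q then a i else 0) = S q a" if "m \<ge> q" for m
    unfolding S_def using that by (intro sum.mono_neutral_cong_right) auto
  hence "eventually (\<lambda>m. nu (S q a - S m (\<lambda>i. if i \<le> q then a i else 0)) = 0) sequentially"
    by (auto simp: nu_0 eventually_sequentially intro!: exI[of _ q])
  thus "(\<lambda>m. nu (S q a - S m (\<lambda>i. if i \<le> q then a i else 0))) \<longlonglongrightarrow> 0" by (rule tendsto_eventually)
qed

text \<open>The \<open>k\<close>-th coordinate functional vanishes on combinations that start after
  \<open>k\<close>, hence at \<open>y\<close>; an element with zero expansion is 0.\<close>

lemma tail_intersection_zero:
  assumes y: "y \<in> X" and ap: "\<And>p e. e > 0 \<Longrightarrow> \<exists>q a. (\<forall>i<p. a i = 0) \<and> nu (y - S q a) < e"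
  shows "y = 0"
proof -
  have "coef y k = 0" for k
  proof (rule coef_eq_0[OF y])
    fix e :: real assume "e > 0"
    then obtain q a where "\<forall>i<Suc k. a i = 0" "nu (y - S q a) < e" using ap by blast
    thus "\<exists>z\<in>X. coef z k = 0 \<and> nu (y - z) < e" using S_in by (intro bexI[of _ "S q a"]) (auto simp: coef_S)
  qed
  hence "coef y = (\<lambda>i. 0)" by auto
  hence "(\<lambda>m. nu (y - 0)) \<longlonglongrightarrow> 0" using coef_lim[OF y] by (simp add: S_def)
  hence "nu y = 0" by (simp add: LIMSEQ_const_iff)
  thus ?thesis using nu_zero y by blast
qed

end

subsection \<open>Convergence criteria\<close>

lemma fk_0 [simp]: "fk k 0 = 0"
  by (simp add: fk_def)

text \<open>The Delta-2 property near 0: once \<open>t \<le> exp (-|ln c|)\<close>, the logarithm of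
  \<open>c t\<close> is at most twice that of \<open>t\<close> in modulus.\<close>

lemma fk_scaling:
  assumes c: "c > 0"
  shows "\<exists>C\<ge>0. \<exists>t0>0. \<forall>t. 0 \<le> t \<and> t \<le> t0 \<longrightarrow> fk k (c * t) \<le> C * fk k t"
proof -
  define t0 where "t0 = exp (- \<bar>ln c\<bar>)"
  have "fk k (c * t) \<le> (c\<^sup>2 * 4 ^ (k - 1)) * fk k t" if t: "0 \<le> t" "t \<le> t0" for t
  proof (cases "t = 0")
    case False
    hence tp: "t > 0" using t by simp
    have "ln t \<le> ln t0" using tp t by (subst ln_le_cancel_iff) (auto simp: t0_def)
    hence "\<bar>ln c\<bar> \<le> \<bar>ln t\<bar>" by (simp add: t0_def)
    moreover have "ln (c * t) = ln c + ln t" using c tp by (simp add: ln_mult)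
    ultimately have "\<bar>ln (c * t)\<bar> \<le> \<bar>2 * ln t\<bar>" by linarith
    hence "(ln (c * t))\<^sup>2 \<le> (2 * ln t)\<^sup>2" by (simp only: abs_le_square_iff)
    hence "((ln (c * t))\<^sup>2) ^ (k - 1) \<le> ((2 * ln t)\<^sup>2) ^ (k - 1)" by (rule power_mono) simp
    hence "ln (c * t) ^ (2 * (k - 1)) \<le> 4 ^ (k - 1) * ln t ^ (2 * (k - 1))"
      by (simp add: power_mult power_mult_distrib)
    hence "(c * t)\<^sup>2 * ln (c * t) ^ (2 * (k - 1)) \<le> (c * t)\<^sup>2 * (4 ^ (k - 1) * ln t ^ (2 * (k - 1)))"
      by (intro mult_left_mono) auto
    thus ?thesis by (simp add: fk_def power_mult_distrib mult_ac)
  qed simp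
  moreover have "t0 > 0" by (simp add: t0_def)
  moreover have "c\<^sup>2 * 4 ^ (k - 1) \<ge> 0" by simp
  ultimately show ?thesis by blast
qed

lemma fk_summable_scaling:
  fixes a :: "nat \<Rightarrow> real"
  assumes c: "c > 0" and a: "a \<longlonglongrightarrow> 0" "\<And>i. a i \<ge> 0" and s: "summable (\<lambda>i. fk k (a i))"
  shows "summable (\<lambda>i. fk k (c * a i))"
proof -
  obtain C t0 where C: "t0 > 0" "\<And>t. 0 \<le> t \<Longrightarrow> t \<le> t0 \<Longrightarrow> fk k (c * t) \<le> C * fk k t"
    using fk_scaling[OF c, of k] by blast
  have "eventually (\<lambda>i. a i < t0) sequentially" by (rule order_tendstoD(2)[OF a(1) C(1)])
  hence "eventually (\<lambda>i. norm (fk k (c * a i)) \<le> C * fk k (a i)) sequentially"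
    by eventually_elim (use C(2) a(2) in \<open>simp add: fk_nonneg\<close>)
  thus ?thesis by (rule summable_comparison_test_ev[OF _ summable_mult[OF s]])
qed

text \<open>For \<open>k \<ge> 2\<close> the function \<open>fk k\<close> vanishes at 1, so
  summability would not by itself force \<open>a\<close> to tend to 0; the criterion lists both.
  Once \<open>a\<close> is null, \<open>M\<close> may be exchanged for \<open>fk k\<close>, and the
  Delta-2 property removes the dependence on the scale \<open>\<rho>\<close>.\<close>

lemma orlicz_series_conv_iff:
  assumes M: "orlicz_fun M" and d: "d > 0" and Mf: "\<And>t. 0 \<le> t \<Longrightarrow> t \<le> d \<Longrightarrow> M t = fk k t"
  shows "orlicz_series_conv M a \<longleftrightarrow> a \<longlonglongrightarrow> 0 \<and> summable (\<lambda>i. fk k (cmod (a i)))"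
proof -
  have mono: "M s \<le> M t" if "0 \<le> s" "s \<le> t" for s t
    using M that by (auto simp: orlicz_fun_def mono_on_def)
  have M0: "M 0 = 0" using M by (simp add: orlicz_fun_def)
  have Mnn: "M t \<ge> 0" if "t \<ge> 0" for t using mono[of 0 t] that M0 by simp
  have Mpos: "M t > 0" if "t > 0" for t
  proof -
    \<comment> \<open>A point below \<open>d\<close>, where \<open>M\<close> is \<open>fk k\<close>,
      and below 1, where \<open>fk k\<close> is positive; monotonicity of \<open>M\<close> does the
      rest.\<close>
    define s where "s = min t (min d (1/2))"
    have s: "0 < s" "s < 1" "s \<le> d" "s \<le> t" using that d by (auto simp: s_def min_def)
    have "0 < fk k s" using s by (intro fk_pos) auto
    also have "\<dots> = M s" using s by (simp add: Mf)
    also have "\<dots> \<le> M t" using s by (intro mono) auto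
    finally show ?thesis .
  qed
  have conv: "M (t / l) \<le> M t / l" if "t \<ge> 0" "l \<ge> 1" for t l
  proof -
    have "convex_on {0..} M" using M by (simp add: orlicz_fun_def)
    from convex_onD[OF this, of "1 / l" 0 t] that M0 show ?thesis by (simp add: field_simps)
  qed
  have summM: "summable (\<lambda>i. M (cmod (a i) / \<rho>))"
    if a: "a \<longlonglongrightarrow> 0" "summable (\<lambda>i. fk k (cmod (a i)))" and \<rho>: "\<rho> > 0" for a \<rho>
  proof -
    have n: "(\<lambda>i. cmod (a i)) \<longlonglongrightarrow> 0" using tendsto_norm[OF a(1)] by simp
    have s: "summable (\<lambda>i. fk k (1 / \<rho> * cmod (a i)))"
      using \<rho> n a(2) by (intro fk_summable_scaling) auto
    have "(\<lambda>i. cmod (a i) / \<rho>) \<longlonglongrightarrow> 0 / \<rho>" using \<rho> by (intro tendsto_divide n tendsto_const) auto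
    hence "eventually (\<lambda>i. cmod (a i) / \<rho> < d) sequentially" using d by (intro order_tendstoD) auto
    hence "eventually (\<lambda>i. norm (M (cmod (a i) / \<rho>)) \<le> fk k (1 / \<rho> * cmod (a i))) sequentially"
    proof eventually_elim
      case (elim i)
      have "M (cmod (a i) / \<rho>) = fk k (cmod (a i) / \<rho>)" using elim \<rho> by (intro Mf) auto
      thus ?case using \<rho> by (simp add: fk_nonneg)
    qed
    thus ?thesis by (rule summable_comparison_test_ev[OF _ s])
  qed
  show ?thesis
  proof
    assume "a \<longlonglongrightarrow> 0 \<and> summable (\<lambda>i. fk k (cmod (a i)))"
    hence s: "summable (\<lambda>i. M (cmod (a i) / \<rho>))" if "\<rho> > 0" for \<rho> using summM that by blast
    have "(\<lambda>m. lux_norm M (\<lambda>i. a i - (if i \<le> m then a i else 0))) \<longlonglongrightarrow> 0"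
    proof (rule tendstoI)
      fix e :: real assume e: "e > 0"
      have "(\<lambda>m. \<Sum>i. M (cmod (a (i + m)) / (e/2))) \<longlonglongrightarrow> 0"
        using suminf_exist_split2[OF s[of "e/2"]] e by simp
      hence "eventually (\<lambda>m. (\<Sum>i. M (cmod (a (i + m)) / (e/2))) < 1) sequentially"
        by (rule order_tendstoD) simp
      then obtain m0 where m0: "\<And>m. m \<ge> m0 \<Longrightarrow> (\<Sum>i. M (cmod (a (i + m)) / (e/2))) < 1"
        by (auto simp: eventually_sequentially)
      show "eventually (\<lambda>m. dist (lux_norm M (\<lambda>i. a i - (if i \<le> m then a i else 0))) 0 < e) sequentially"
        unfolding eventually_sequentially
      proof (intro exI allI impI)
        fix m assume m: "m0 \<le> m"
        let ?c = "\<lambda>i. a i - (if i \<le> m then a i else 0)"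
        let ?A = "{\<rho>. \<rho> > 0 \<and> summable (\<lambda>i. M (cmod (?c i) / \<rho>)) \<and> (\<Sum>i. M (cmod (?c i) / \<rho>)) \<le> 1}"
        have tail: "M (cmod (?c (i + Suc m)) / (e/2)) = M (cmod (a (i + Suc m)) / (e/2))" for i by simp
        have head: "(\<Sum>i<Suc m. M (cmod (?c i) / (e/2))) = 0" using M0 by (intro sum.neutral) auto
        have sc: "summable (\<lambda>i. M (cmod (?c i) / (e/2)))"
          using s[of "e/2"] e summable_iff_shift[of "\<lambda>i. M (cmod (?c i) / (e/2))" "Suc m"]
            summable_iff_shift[of "\<lambda>i. M (cmod (a i) / (e/2))" "Suc m"] unfolding tail by simp
        have "(\<Sum>i. M (cmod (?c i) / (e/2))) = (\<Sum>i. M (cmod (a (i + Suc m)) / (e/2)))"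
          using suminf_split_initial_segment[OF sc, of "Suc m"] unfolding tail head by simp
        also have "\<dots> < 1" using m by (intro m0) simp
        finally have mem: "e/2 \<in> ?A" using e sc by simp
        have "lux_norm M ?c \<le> e/2" unfolding lux_norm_def
          by (rule cInf_lower[OF mem]) (auto intro!: bdd_belowI[where m=0])
        moreover have "lux_norm M ?c \<ge> 0" unfolding lux_norm_def
        proof (rule cInf_greatest)
          show "?A \<noteq> {}" using mem by blast
        qed simp
        ultimately show "dist (lux_norm M ?c) 0 < e" using e by simp
      qed
    qed
    moreover have "in_orlicz M a" unfolding in_orlicz_def using s[of 1] by (intro exI[of _ 1]) auto
    ultimately show "orlicz_series_conv M a" unfolding orlicz_series_conv_def by blast
  next
    assume "orlicz_series_conv M a"
    then obtain b where b: "in_orlicz M b" and lim: "(\<lambda>m. lux_norm M (\<lambda>i. b i - (if i \<le> m then a i else 0))) \<longlonglongrightarrow> 0"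
      by (auto simp: orlicz_series_conv_def)
    obtain \<rho> where \<rho>: "\<rho> > 0" "summable (\<lambda>i. M (cmod (b i) / \<rho>))" using b by (auto simp: in_orlicz_def)
    have "eventually (\<lambda>t. M t > 1) at_top" using M by (auto simp: orlicz_fun_def filterlim_at_top_dense)
    hence "eventually (\<lambda>t. M t > 1 \<and> t > 0) at_top" using eventually_gt_at_top[of 0] by (rule eventually_conj)
    then obtain T where T: "M T > 1" "T > 0" using eventually_happens'[OF trivial_limit_at_top_linorder] by blast
    \<comment> \<open>Every \<open>r\<close> admissible in the Luxemburg norm has
      \<open>M (cmod (?c i) / r) \<le> 1 < M T\<close>, so \<open>cmod (?c i) \<le> T r\<close>.
      Hence the limit \<open>b\<close> has the same coordinates as \<open>a\<close>.\<close>
    have key: "cmod (b i - a i) \<le> T * lux_norm M (\<lambda>i. b i - (if i \<le> m then a i else 0))" if i: "i \<le> m" for i m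
    proof -
      let ?c = "\<lambda>i. b i - (if i \<le> m then a i else 0)"
      let ?A = "{\<rho>. \<rho> > 0 \<and> summable (\<lambda>i. M (cmod (?c i) / \<rho>)) \<and> (\<Sum>i. M (cmod (?c i) / \<rho>)) \<le> 1}"
      have tail: "M (cmod (?c (i + Suc m)) / \<rho>) = M (cmod (b (i + Suc m)) / \<rho>)" for i by simp
      have sc: "summable (\<lambda>i. M (cmod (?c i) / \<rho>))"
        using \<rho>(2) summable_iff_shift[of "\<lambda>i. M (cmod (?c i) / \<rho>)" "Suc m"]
          summable_iff_shift[of "\<lambda>i. M (cmod (b i) / \<rho>)" "Suc m"] unfolding tail by simp
      define s where "s = (\<Sum>i. M (cmod (?c i) / \<rho>))"
      \<comment> \<open>The infimum says something only if its set is nonempty. By convexity,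
        enlarging \<open>\<rho>\<close> by the factor \<open>l\<close> pushes the sum below 1 and
        exhibits a member.\<close>
      define l where "l = max 1 s"
      have l: "l \<ge> 1" "s / l \<le> 1" by (auto simp: l_def divide_le_eq)
      have le: "M (cmod (?c i) / (\<rho> * l)) \<le> M (cmod (?c i) / \<rho>) / l" for i
        using conv[of "cmod (?c i) / \<rho>" l] l \<rho> by simp
      have sl: "summable (\<lambda>i. M (cmod (?c i) / (\<rho> * l)))"
        using summable_divide[OF sc, of l]
        by (rule summable_comparison_test') (use le l \<rho> in \<open>auto simp: Mnn\<close>)
      have "(\<Sum>i. M (cmod (?c i) / (\<rho> * l))) \<le> (\<Sum>i. M (cmod (?c i) / \<rho>) / l)"
        by (rule suminf_le[OF le sl summable_divide[OF sc]])
      also have "\<dots> = s / l" unfolding s_def by (rule suminf_divide[OF sc])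
      also have "\<dots> \<le> 1" by (rule l(2))
      finally have "\<rho> * l \<in> ?A" using sl l \<rho> by auto
      moreover have "cmod (b i - a i) / T \<le> r" if r: "r \<in> ?A" for r
      proof -
        have "M (cmod (?c i) / r) \<le> (\<Sum>i. M (cmod (?c i) / r))"
          using r sum_le_suminf[of "\<lambda>i. M (cmod (?c i) / r)" "{i}"] by (auto simp: Mnn)
        hence "M (cmod (?c i) / r) < M T" using r T by auto
        hence "cmod (?c i) / r < T" using mono[of T "cmod (?c i) / r"] T by force
        thus ?thesis using r T i by (simp add: field_simps)
      qed
      ultimately have "cmod (b i - a i) / T \<le> Inf ?A" by (intro cInf_greatest) auto
      thus ?thesis using T unfolding lux_norm_def by (simp add: field_simps)
    qed
    have "b i = a i" for i
    proof -
      have "(\<lambda>m. T * lux_norm M (\<lambda>i. b i - (if i \<le> m then a i else 0))) \<longlonglongrightarrow> T * 0"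
        by (intro tendsto_mult_left lim)
      moreover have "\<exists>N. \<forall>m\<ge>N. cmod (b i - a i) \<le> T * lux_norm M (\<lambda>i. b i - (if i \<le> m then a i else 0))"
        using key by blast
      ultimately have "cmod (b i - a i) \<le> T * 0" by (rule LIMSEQ_le_const)
      thus ?thesis by simp
    qed
    hence sa: "summable (\<lambda>i. M (cmod (a i) / \<rho>))" using \<rho>(2) by simp
    have na: "(\<lambda>i. cmod (a i) / \<rho>) \<longlonglongrightarrow> 0"
    proof (rule tendstoI)
      fix e :: real assume e: "e > 0"
      have "eventually (\<lambda>i. M (cmod (a i) / \<rho>) < M e) sequentially"
        by (rule order_tendstoD(2)[OF summable_LIMSEQ_zero[OF sa] Mpos[OF e]])
      thus "eventually (\<lambda>i. dist (cmod (a i) / \<rho>) 0 < e) sequentially"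
      proof eventually_elim
        case (elim i)
        hence "cmod (a i) / \<rho> < e" using mono[of e "cmod (a i) / \<rho>"] e by force
        thus ?case using \<rho> by simp
      qed
    qed
    have "(\<lambda>i. \<rho> * (cmod (a i) / \<rho>)) \<longlonglongrightarrow> \<rho> * 0" by (intro tendsto_mult_left na)
    hence "a \<longlonglongrightarrow> 0" using \<rho> by (simp add: tendsto_norm_zero_iff)
    moreover have "summable (\<lambda>i. fk k (cmod (a i) / \<rho>))"
    proof -
      have "eventually (\<lambda>i. cmod (a i) / \<rho> < d) sequentially" by (rule order_tendstoD(2)[OF na d])
      hence "eventually (\<lambda>i. norm (fk k (cmod (a i) / \<rho>)) \<le> M (cmod (a i) / \<rho>)) sequentially"
        by eventually_elim (use \<rho> Mf in \<open>simp add: fk_nonneg\<close>)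
      thus ?thesis by (rule summable_comparison_test_ev[OF _ sa])
    qed
    hence "summable (\<lambda>i. fk k (\<rho> * (cmod (a i) / \<rho>)))" using \<rho> na by (intro fk_summable_scaling) auto
    hence "summable (\<lambda>i. fk k (cmod (a i)))" using \<rho> by simp
    ultimately show "a \<longlonglongrightarrow> 0 \<and> summable (\<lambda>i. fk k (cmod (a i)))" by blast
  qed
qed

section \<open>Convergence of series in the Rochberg space\<close>

lemma zn_norm_tendsto_0_iff:
  assumes "\<And>m. \<exists>B. zle n (u m) B"
  shows "(\<lambda>m. zn_norm n (u m)) \<longlonglongrightarrow> 0 \<longleftrightarrow> (\<forall>e>0. \<exists>m0. \<forall>m\<ge>m0. zle n (u m) e)"
proof
  assume lim: "(\<lambda>m. zn_norm n (u m)) \<longlonglongrightarrow> 0"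
  show "\<forall>e>0. \<exists>m0. \<forall>m\<ge>m0. zle n (u m) e"
  proof (intro allI impI)
    fix e :: real assume "e > 0"
    hence "eventually (\<lambda>m. zn_norm n (u m) < e) sequentially" by (rule order_tendstoD(2)[OF lim])
    thus "\<exists>m0. \<forall>m\<ge>m0. zle n (u m) e" using assms zn_norm_less unfolding eventually_sequentially by meson
  qed
next
  assume *: "\<forall>e>0. \<exists>m0. \<forall>m\<ge>m0. zle n (u m) e"
  show "(\<lambda>m. zn_norm n (u m)) \<longlonglongrightarrow> 0"
  proof (rule tendstoI)
    fix e :: real assume e: "e > 0"
    then obtain m0 where m0: "\<And>m. m \<ge> m0 \<Longrightarrow> zle n (u m) (e/2)" using * by (meson half_gt_zero)
    have "dist (zn_norm n (u m)) 0 < e" if "m \<ge> m0" for m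
      using zn_norm_le[OF m0[OF that]] zn_norm_nonneg[OF m0[OF that]] e by simp
    thus "eventually (\<lambda>m. dist (zn_norm n (u m)) 0 < e) sequentially" by (auto simp: eventually_sequentially)
  qed
qed

lemma zpsum_zle:
  assumes "\<And>i. zle n (x i) B"
  shows "\<exists>C. zle n (zpsum x a m) C"
  unfolding zpsum_def using zle_sum[of "{..m}" n "\<lambda>i j k. a i * x i j k" "\<lambda>i. cmod (a i) * B"] zle_scale[OF assms] by auto

lemma zpsum_diff:
  assumes "q \<le> p"
  shows "zpsum x a p j k - zpsum x a q j k = (\<Sum>i\<in>{Suc q..<Suc p}. a i * x i j k)"
proof -
  have "(\<Sum>i\<le>p. a i * x i j k) = (\<Sum>i\<le>q. a i * x i j k) + (\<Sum>i\<in>{Suc q..<Suc p}. a i * x i j k)"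
    unfolding lessThan_Suc_atMost[symmetric] lessThan_atLeast0
    by (rule sum.atLeastLessThan_concat[symmetric]) (use assms in auto)
  thus ?thesis by (simp add: zpsum_def)
qed

lemma zn_norm_scale:
  assumes "zle n x B" shows "zn_norm n (\<lambda>j k. c * x j k) = cmod c * zn_norm n x"
proof -
  have le: "zn_norm n (\<lambda>j k. c * x j k) \<le> cmod c * zn_norm n x" if x: "zle n x B" for c x B
  proof (rule field_le_epsilon)
    fix e :: real assume e: "e > 0"
    have "zle n x (zn_norm n x + e / (cmod c + 1))"
      using e by (intro zn_norm_less[OF x]) (simp add: add_nonneg_pos)
    from zn_norm_le[OF zle_scale[OF this, of c]]
    have "zn_norm n (\<lambda>j k. c * x j k) \<le> cmod c * zn_norm n x + cmod c * (e / (cmod c + 1))" by (simp add: distrib_left)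
    also have "cmod c * (e / (cmod c + 1)) \<le> e" using e by (simp add: divide_le_eq add_nonneg_pos mult.commute mult_left_mono)
    finally show "zn_norm n (\<lambda>j k. c * x j k) \<le> cmod c * zn_norm n x + e" by simp
  qed
  show ?thesis
  proof (cases "c = 0")
    case True
    have "zn_norm n (\<lambda>j k. 0) = 0" using zn_norm_le[OF zle_zero[of 0 n]] zn_norm_nonneg[OF zle_zero[of 0 n]] by simp
    thus ?thesis using True by simp
  next
    case False
    have "zn_norm n (\<lambda>j k. (1/c) * (c * x j k)) \<le> cmod (1/c) * zn_norm n (\<lambda>j k. c * x j k)"
      by (rule le[OF zle_scale[OF assms]])
    hence "cmod c * zn_norm n x \<le> zn_norm n (\<lambda>j k. c * x j k)" using False by (simp add: norm_divide field_simps)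
    thus ?thesis using le[OF assms, of c] by simp
  qed
qed

lemma zn_norm_add:
  assumes "zle n x B" "zle n y C" shows "zn_norm n (\<lambda>j k. x j k + y j k) \<le> zn_norm n x + zn_norm n y"
proof (rule field_le_epsilon)
  fix e :: real assume e: "e > 0"
  have "zle n x (zn_norm n x + e/2)" "zle n y (zn_norm n y + e/2)"
    by (rule zn_norm_less[OF assms(1)], use e in simp) (rule zn_norm_less[OF assms(2)], use e in simp)
  from zn_norm_le[OF zle_add[OF this]] show "zn_norm n (\<lambda>j k. x j k + y j k) \<le> zn_norm n x + zn_norm n y + e" by simp
qed

lemma zn_norm_eq_0:
  assumes "zle n x B" "zn_norm n x = 0" "j < n" shows "x j k = 0"
proof -
  have "cmod (x j k) \<le> 0 + e" if e: "e > 0" for e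
  proof -
    have "zle n x (e / 4 ^ j)" by (rule zn_norm_less[OF assms(1)]) (use assms(2) e in simp)
    from zle_coord[OF this assms(3), of k] show ?thesis by simp
  qed
  hence "cmod (x j k) \<le> 0" by (rule field_le_epsilon)
  thus ?thesis by simp
qed

text \<open>By completeness, convergence is a Cauchy condition on segments. On late segments the
  \<open>x i\<close> may be replaced by the blocks at a total cost of at most 4, the sum of the
  errors. The upper estimate for large multiples of late coefficients gives one direction, the lower
  estimate on bounded segments the other.\<close>

lemma zseries_conv_iff:
  assumes b: "blocks n m A g C d" and mn: "m < n"
    and err: "\<And>i. zle n (\<lambda>j k. x i j k - jet (g i) j k) (2 * (1/2) ^ i)"
    and x: "\<And>i. x i \<in> zn n" "\<And>i. zn_norm n (x i) = 1"
  shows "zseries_conv n x a \<longleftrightarrow> a \<longlonglongrightarrow> 0 \<and> summable (\<lambda>i. fk (n - m) (cmod (a i)))"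
proof -
  have x2: "zle n (x i) 2" for i
  proof -
    obtain B where "zle n (x i) B" using x(1)[of i] by (auto simp: zn_iff)
    from zn_norm_less[OF this, of 2] show ?thesis using x(2)[of i] by simp
  qed
  have ge: "summable (\<lambda>i. 2 * (1/2::real) ^ i)" by (intro summable_mult summable_geometric) simp
  have gsum: "(\<Sum>i\<in>{p..<q}. 2 * (1/2::real) ^ i) \<le> 4" for p q
  proof -
    have "(\<Sum>i\<in>{p..<q}. 2 * (1/2::real) ^ i) \<le> (\<Sum>i<q. 2 * (1/2::real) ^ i)" by (rule sum_mono2) auto
    also have "\<dots> \<le> 4" unfolding sum_distrib_left[symmetric] by (simp add: sum_gp_strict)
    finally show ?thesis .
  qed
  have errs: "zle n (\<lambda>j k. \<Sum>i\<in>{p..<q}. a i * (x i j k - jet (g i) j k)) (\<Sum>i\<in>{p..<q}. 2 * (1/2) ^ i)"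
    if "\<And>i. i \<ge> p \<Longrightarrow> cmod (a i) \<le> 1" for p q
  proof (rule zle_sum)
    fix i assume "i \<in> {p..<q}"
    hence "cmod (a i) \<le> 1" using that by simp
    hence "cmod (a i) * (2 * (1/2) ^ i) \<le> 1 * (2 * (1/2) ^ i)" by (intro mult_right_mono) auto
    thus "zle n (\<lambda>j k. a i * (x i j k - jet (g i) j k)) (2 * (1/2) ^ i)"
      using zle_mono[OF zle_scale[OF err[of i], of "a i"]] by simp
  qed simp
  have cauchy_iff: "zseries_conv n x a \<longleftrightarrow> (\<forall>e>0. \<exists>m0. \<forall>q\<ge>m0. \<forall>p\<ge>q. zle n (\<lambda>j k. \<Sum>i\<in>{Suc q..<Suc p}. a i * x i j k) e)" (is "_ \<longleftrightarrow> ?C")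
  proof
    assume "zseries_conv n x a"
    then obtain y where y: "y \<in> zn n" "(\<lambda>m. zn_norm n (zdiff y (zpsum x a m))) \<longlonglongrightarrow> 0" by (auto simp: zseries_conv_def)
    have ex: "\<exists>B. zle n (zdiff y (zpsum x a m)) B" for m
      using y(1) zpsum_zle[of n x 2 a m, OF x2] zle_diff unfolding zn_iff zdiff_def by blast
    show ?C
    proof (intro allI impI)
      fix e :: real assume e: "e > 0"
      then obtain m0 where m0: "\<And>m. m \<ge> m0 \<Longrightarrow> zle n (zdiff y (zpsum x a m)) (e/2)"
        using y(2) unfolding zn_norm_tendsto_0_iff[OF ex] by (meson half_gt_zero)
      have "zle n (\<lambda>j k. \<Sum>i\<in>{Suc q..<Suc p}. a i * x i j k) e" if "q \<ge> m0" "p \<ge> q" for p q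
      proof -
        have "zle n (\<lambda>j k. zdiff y (zpsum x a q) j k - zdiff y (zpsum x a p) j k) (e/2 + e/2)"
          using that by (intro zle_diff m0) auto
        moreover have "zdiff y (zpsum x a q) j k - zdiff y (zpsum x a p) j k = (\<Sum>i\<in>{Suc q..<Suc p}. a i * x i j k)" for j k
          using zpsum_diff[OF that(2), of x a j k] by (simp add: zdiff_def)
        ultimately show ?thesis by simp
      qed
      thus "\<exists>m0. \<forall>q\<ge>m0. \<forall>p\<ge>q. zle n (\<lambda>j k. \<Sum>i\<in>{Suc q..<Suc p}. a i * x i j k) e" by blast
    qed
  next
    assume C: ?C
    have "\<exists>m0. \<forall>p\<ge>m0. \<forall>q\<ge>m0. zle n (\<lambda>j k. zpsum x a p j k - zpsum x a q j k) e" if e: "e > 0" for e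
    proof -
      obtain m0 where m0: "\<And>q p. q \<ge> m0 \<Longrightarrow> p \<ge> q \<Longrightarrow> zle n (\<lambda>j k. \<Sum>i\<in>{Suc q..<Suc p}. a i * x i j k) e"
        using C e by blast
      have 1: "zle n (\<lambda>j k. zpsum x a p j k - zpsum x a q j k) e" if "q \<ge> m0" "p \<ge> q" for p q
        using m0[OF that] by (simp add: zpsum_diff[OF that(2)])
      have "zle n (\<lambda>j k. zpsum x a p j k - zpsum x a q j k) e" if "q \<ge> m0" "p \<ge> m0" for p q
      proof (cases "q \<le> p")
        case False
        hence "zle n (\<lambda>j k. zpsum x a q j k - zpsum x a p j k) e" using that by (intro 1) auto
        from zle_scale[OF this, of "-1"] show ?thesis by simp
      qed (use that 1 in auto)
      thus ?thesis by blast
    qed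
    from zle_complete[OF this] obtain y where y: "\<forall>j\<ge>n. y j = (\<lambda>_. 0)"
      "\<And>e. e > 0 \<Longrightarrow> \<exists>m0. \<forall>p\<ge>m0. zle n (\<lambda>j k. y j k - zpsum x a p j k) e" by blast
    obtain m0 where "zle n (\<lambda>j k. y j k - zpsum x a m0 j k) 1" using y(2)[of 1] by auto
    moreover obtain B where "zle n (zpsum x a m0) B" using zpsum_zle[of n x 2 a, OF x2] by blast
    ultimately have "zle n (\<lambda>j k. (y j k - zpsum x a m0 j k) + zpsum x a m0 j k) (1 + B)" by (rule zle_add)
    hence yz: "y \<in> zn n" using y(1) by (auto simp: zn_iff)
    have ex: "\<exists>B. zle n (zdiff y (zpsum x a m)) B" for m
      using yz zpsum_zle[of n x 2 a m, OF x2] zle_diff unfolding zn_iff zdiff_def by blast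
    have "(\<lambda>m. zn_norm n (zdiff y (zpsum x a m))) \<longlonglongrightarrow> 0"
      unfolding zn_norm_tendsto_0_iff[OF ex] using y(2) by (simp add: zdiff_def)
    thus "zseries_conv n x a" unfolding zseries_conv_def using yz by blast
  qed
  show ?thesis unfolding cauchy_iff
  proof
    assume "a \<longlonglongrightarrow> 0 \<and> summable (\<lambda>i. fk (n - m) (cmod (a i)))"
    hence a0: "a \<longlonglongrightarrow> 0" and s: "summable (\<lambda>i. fk (n - m) (cmod (a i)))" by auto
    have na: "(\<lambda>i. cmod (a i)) \<longlonglongrightarrow> 0" using tendsto_norm[OF a0] by simp
    obtain K where K: "K \<ge> 0" and up: "\<And>I a. finite I \<Longrightarrow> (\<And>i. i \<in> I \<Longrightarrow> cmod (a i) \<le> exp (-1)) \<Longrightarrow>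
       (\<Sum>i\<in>I. fk (n - m) (cmod (a i))) \<le> 1 \<Longrightarrow> zle n (\<lambda>j k. \<Sum>i\<in>I. a i * jet (g i) j k) K"
    proof -
      show thesis by (rule block_upper_estimate[OF b mn]) (fact that)
    qed
    show "\<forall>e>0. \<exists>m0. \<forall>q\<ge>m0. \<forall>p\<ge>q. zle n (\<lambda>j k. \<Sum>i\<in>{Suc q..<Suc p}. a i * x i j k) e"
    proof (intro allI impI)
      fix e :: real assume e: "e > 0"
      \<comment> \<open>The upper estimate is applied to \<open>c a\<close>: the bound
        \<open>K\<close> for it means at most \<open>K / c \<le> e / 2\<close> for the segment
        itself, and summability survives the scaling.\<close>
      define c where "c = 2 * (K + 1) / e"
      have c: "c > 0" "K / c \<le> e / 2" using K e by (auto simp: c_def field_simps)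
      have sc: "summable (\<lambda>i. fk (n - m) (c * cmod (a i)))" by (rule fk_summable_scaling[OF c(1) na _ s]) simp
      obtain m1 where m1: "\<And>q p. q \<ge> m1 \<Longrightarrow> norm (\<Sum>i\<in>{q..<p}. fk (n - m) (c * cmod (a i))) < 1"
        using sc[unfolded summable_Cauchy] zero_less_one by blast
      obtain m2 where m2: "\<And>q p. q \<ge> m2 \<Longrightarrow> norm (\<Sum>i\<in>{q..<p}. 2 * (1/2::real) ^ i) < e/2"
        using ge[unfolded summable_Cauchy] e by (meson half_gt_zero)
      have "(\<lambda>i. c * cmod (a i)) \<longlonglongrightarrow> c * 0" by (intro tendsto_mult_left na)
      hence "eventually (\<lambda>i. c * cmod (a i) < exp (-1)) sequentially" by (intro order_tendstoD) auto
      moreover have "eventually (\<lambda>i. cmod (a i) < 1) sequentially" by (rule order_tendstoD[OF na]) simp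
      ultimately have "eventually (\<lambda>i. c * cmod (a i) < exp (-1) \<and> cmod (a i) < 1) sequentially" by (rule eventually_conj)
      then obtain m3 where m3: "\<And>i. i \<ge> m3 \<Longrightarrow> c * cmod (a i) < exp (-1) \<and> cmod (a i) < 1" by (auto simp: eventually_sequentially)
      have "zle n (\<lambda>j k. \<Sum>i\<in>{Suc q..<Suc p}. a i * x i j k) e" if q: "q \<ge> max m1 (max m2 m3)" for p q
      proof -
        let ?I = "{Suc q..<Suc p}"
        have cm: "cmod (of_real c * a i) = c * cmod (a i)" for i using c by (simp add: norm_mult)
        have "zle n (\<lambda>j k. \<Sum>i\<in>?I. (of_real c * a i) * jet (g i) j k) K"
        proof (rule up)
          fix i assume "i \<in> ?I"
          thus "cmod (of_real c * a i) \<le> exp (-1)" unfolding cm using m3[of i] q by auto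
        next
          have "norm (\<Sum>i\<in>?I. fk (n - m) (c * cmod (a i))) < 1" using q by (intro m1) auto
          thus "(\<Sum>i\<in>?I. fk (n - m) (cmod (of_real c * a i))) \<le> 1" unfolding cm by simp
        qed simp
        from zle_scale[OF this, of "of_real (1/c)"]
        have "zle n (\<lambda>j k. of_real (1/c) * (\<Sum>i\<in>?I. (of_real c * a i) * jet (g i) j k)) (K / c)"
          using c by (simp add: norm_divide)
        moreover have "of_real (1/c) * (\<Sum>i\<in>?I. (of_real c * a i) * jet (g i) j k) = (\<Sum>i\<in>?I. a i * jet (g i) j k)" for j k
          unfolding sum_distrib_left using c by (intro sum.cong refl) simp
        ultimately have z1: "zle n (\<lambda>j k. \<Sum>i\<in>?I. a i * jet (g i) j k) (e/2)" using c(2) by (simp add: zle_mono)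
        have "norm (\<Sum>i\<in>?I. 2 * (1/2::real) ^ i) < e/2" using q by (intro m2) auto
        hence "(\<Sum>i\<in>?I. 2 * (1/2::real) ^ i) \<le> e/2" by simp
        moreover have "zle n (\<lambda>j k. \<Sum>i\<in>?I. a i * (x i j k - jet (g i) j k)) (\<Sum>i\<in>?I. 2 * (1/2) ^ i)"
          using m3 q by (intro errs) (auto intro: less_imp_le)
        ultimately have z2: "zle n (\<lambda>j k. \<Sum>i\<in>?I. a i * (x i j k - jet (g i) j k)) (e/2)" using zle_mono by blast
        have "(\<Sum>i\<in>?I. a i * jet (g i) j k) + (\<Sum>i\<in>?I. a i * (x i j k - jet (g i) j k)) = (\<Sum>i\<in>?I. a i * x i j k)" for j k
          unfolding sum.distrib[symmetric] by (intro sum.cong refl) (simp add: right_diff_distrib)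
        with zle_add[OF z1 z2] show ?thesis by (simp del: sum.op_ivl_Suc)
      qed
      thus "\<exists>m0. \<forall>q\<ge>m0. \<forall>p\<ge>q. zle n (\<lambda>j k. \<Sum>i\<in>{Suc q..<Suc p}. a i * x i j k) e" by blast
    qed
  next
    assume C: "\<forall>e>0. \<exists>m0. \<forall>q\<ge>m0. \<forall>p\<ge>q. zle n (\<lambda>j k. \<Sum>i\<in>{Suc q..<Suc p}. a i * x i j k) e"
    have a0: "a \<longlonglongrightarrow> 0"
    proof (rule tendstoI)
      fix e :: real assume e: "e > 0"
      then obtain m0 where m0: "\<And>q p. q \<ge> m0 \<Longrightarrow> p \<ge> q \<Longrightarrow> zle n (\<lambda>j k. \<Sum>i\<in>{Suc q..<Suc p}. a i * x i j k) (e/2)"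
        using C by (meson half_gt_zero)
      have "dist (a i) 0 < e" if i: "i \<ge> Suc m0" for i
      proof -
        obtain q where q: "i = Suc q" "q \<ge> m0" using i by (cases i) auto
        \<comment> \<open>The segment with \<open>p = Suc q\<close> consists of the single term
          \<open>a i * x i\<close>, and \<open>x i\<close> has norm 1.\<close>
        have "zle n (\<lambda>j k. a i * x i j k) (e/2)" using m0[OF q(2), of "Suc q"] q(1) by simp
        from zn_norm_le[OF this] have "cmod (a i) \<le> e/2" unfolding zn_norm_scale[OF x2] x(2) by simp
        thus ?thesis using e by simp
      qed
      thus "eventually (\<lambda>i. dist (a i) 0 < e) sequentially" by (auto simp: eventually_sequentially)
    qed
    obtain K t0 where K: "K \<ge> 0" and t0: "0 < t0" "t0 < 1" and low: "\<And>I a B. finite I \<Longrightarrow> (\<And>i. i \<in> I \<Longrightarrow> cmod (a i) \<le> t0) \<Longrightarrow>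
       zle n (\<lambda>j k. \<Sum>i\<in>I. a i * jet (g i) j k) B
       \<Longrightarrow> (\<Sum>i\<in>I. fk (n - m) (cmod (a i))) \<le> K * B * max 1 (sqrt (\<Sum>i\<in>I. fk (n - m) (cmod (a i))))"
    proof -
      show thesis by (rule block_lower_estimate[OF b mn]) (fact that)
    qed
    have "eventually (\<lambda>i. cmod (a i) < t0) sequentially"
      using tendsto_norm[OF a0] t0 by (intro order_tendstoD) auto
    then obtain m1 where m1: "\<And>i. i \<ge> m1 \<Longrightarrow> cmod (a i) < t0" by (auto simp: eventually_sequentially)
    obtain m2 where m2: "\<And>q p. q \<ge> m2 \<Longrightarrow> p \<ge> q \<Longrightarrow> zle n (\<lambda>j k. \<Sum>i\<in>{Suc q..<Suc p}. a i * x i j k) 1"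
      using C zero_less_one by blast
    define q where "q = max m1 m2"
    \<comment> \<open>5 is 1 for the segment of the series plus 4 for the perturbation.\<close>
    define K' where "K' = K * 5"
    have bound: "(\<Sum>i\<in>{Suc q..<Suc p}. fk (n - m) (cmod (a i))) \<le> max K' (K'\<^sup>2)" if p: "p \<ge> q" for p
    proof -
      let ?I = "{Suc q..<Suc p}"
      have z1: "zle n (\<lambda>j k. \<Sum>i\<in>?I. a i * x i j k) 1" using p by (intro m2) (auto simp: q_def)
      have "zle n (\<lambda>j k. \<Sum>i\<in>?I. a i * (x i j k - jet (g i) j k)) (\<Sum>i\<in>?I. 2 * (1/2) ^ i)"
      proof (rule errs)
        fix i assume "i \<ge> Suc q"
        hence "m1 \<le> i" by (simp add: q_def)
        from m1[OF this] t0 show "cmod (a i) \<le> 1" by simp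
      qed
      hence z2: "zle n (\<lambda>j k. \<Sum>i\<in>?I. a i * (x i j k - jet (g i) j k)) 4" using gsum zle_mono by blast
      have "zle n (\<lambda>j k. (\<Sum>i\<in>?I. a i * x i j k) - (\<Sum>i\<in>?I. a i * (x i j k - jet (g i) j k))) (1 + 4)"
        by (rule zle_diff[OF z1 z2])
      moreover have "(\<Sum>i\<in>?I. a i * x i j k) - (\<Sum>i\<in>?I. a i * (x i j k - jet (g i) j k)) = (\<Sum>i\<in>?I. a i * jet (g i) j k)" for j k
        unfolding sum_subtractf[symmetric] by (intro sum.cong refl) (simp add: right_diff_distrib)
      ultimately have "zle n (\<lambda>j k. \<Sum>i\<in>?I. a i * jet (g i) j k) 5"
        by (simp del: sum.op_ivl_Suc)
      hence le: "(\<Sum>i\<in>?I. fk (n - m) (cmod (a i))) \<le> K' * max 1 (sqrt (\<Sum>i\<in>?I. fk (n - m) (cmod (a i))))"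
        unfolding K'_def using m1 by (intro low) (auto simp: q_def intro: less_imp_le)
      have "0 \<le> (\<Sum>i\<in>?I. fk (n - m) (cmod (a i)))" "0 \<le> K'" using K by (auto simp: K'_def intro!: sum_nonneg fk_nonneg simp del: sum.op_ivl_Suc)
      thus ?thesis by (rule le_max_sqrt_bound[OF _ _ le])
    qed
    have "summable (\<lambda>i. fk (n - m) (cmod (a (i + Suc q))))"
    proof (rule summableI_nonneg_bounded)
      fix p
      have "(\<Sum>i<p. fk (n - m) (cmod (a (i + Suc q)))) = (\<Sum>i\<in>{Suc q..<Suc (q + p)}. fk (n - m) (cmod (a i)))"
        using sum.shift_bounds_nat_ivl[of "\<lambda>i. fk (n - m) (cmod (a i))" 0 "Suc q" p] by (simp add: lessThan_atLeast0 add.commute)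
      also have "\<dots> \<le> max K' (K'\<^sup>2)" by (rule bound) simp
      finally show "(\<Sum>i<p. fk (n - m) (cmod (a (i + Suc q)))) \<le> max K' (K'\<^sup>2)" .
    qed (rule fk_nonneg)
    hence "summable (\<lambda>i. fk (n - m) (cmod (a i)))" using summable_iff_shift[of "\<lambda>i. fk (n - m) (cmod (a i))" "Suc q"] by simp
    with a0 show "a \<longlonglongrightarrow> 0 \<and> summable (\<lambda>i. fk (n - m) (cmod (a i)))" by blast
  qed
qed

subsection \<open>Closed spans of basic sequences\<close>

lemma zn_zle: "x \<in> zn n \<Longrightarrow> \<exists>B. zle n x B"
  by (simp add: zn_iff)

lemma zn_add: "x \<in> zn n \<Longrightarrow> y \<in> zn n \<Longrightarrow> x + y \<in> zn n"
proof -
  assume x: "x \<in> zn n" and y: "y \<in> zn n"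
  obtain B C where "zle n x B" "zle n y C" using zn_zle[OF x] zn_zle[OF y] by blast
  from zle_add[OF this] have "zle n (x + y) (B + C)" by (simp add: plus_fun_def)
  thus ?thesis using x y by (auto simp: zn_iff fun_eq_iff)
qed

lemma zn_scale: "x \<in> zn n \<Longrightarrow> (\<lambda>j k. c * x j k) \<in> zn n"
proof -
  assume x: "x \<in> zn n"
  obtain B where "zle n x B" using zn_zle[OF x] by blast
  from zle_scale[OF this] show ?thesis using x by (auto simp: zn_iff fun_eq_iff)
qed

lemma zn_zero: "0 \<in> zn n"
  using zle_zero[of 0 n] by (auto simp: zn_iff zero_fun_def)

lemma zpsum_zn: "(\<And>i. x i \<in> zn n) \<Longrightarrow> zpsum x a m \<in> zn n"
proof (induction m)
  case 0
  thus ?case using zn_scale[of "x 0" n "a 0"] by (simp add: zpsum_def)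
next
  case (Suc m)
  have "zpsum x a (Suc m) = zpsum x a m + (\<lambda>j k. a (Suc m) * x (Suc m) j k)"
    by (simp add: zpsum_def fun_eq_iff)
  thus ?case using zn_add[OF Suc.IH[OF Suc.prems] zn_scale[OF Suc.prems]] by metis
qed

lemma zdiff_eq_minus: "zdiff y z = y - z"
  by (simp add: zdiff_def fun_eq_iff)

lemma zdiff_zn: "y \<in> zn n \<Longrightarrow> z \<in> zn n \<Longrightarrow> zdiff y z \<in> zn n"
proof -
  assume y: "y \<in> zn n" and z: "z \<in> zn n"
  have "y + (\<lambda>j k. - 1 * z j k) \<in> zn n" by (rule zn_add[OF y zn_scale[OF z]])
  moreover have "y + (\<lambda>j k. - 1 * z j k) = zdiff y z" by (simp add: zdiff_def fun_eq_iff)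
  ultimately show ?thesis by simp
qed

lemma zclspan_iff:
  assumes x: "\<And>i. x i \<in> zn n"
  shows "y \<in> zclspan n x \<longleftrightarrow> y \<in> zn n \<and> (\<forall>e>0. \<exists>c m. zle n (zdiff y (zpsum x c m)) e)"
proof -
  have "(\<forall>e>0. \<exists>c m. zn_norm n (zdiff y (zpsum x c m)) < e) \<longleftrightarrow> (\<forall>e>0. \<exists>c m. zle n (zdiff y (zpsum x c m)) e)"
    (is "?L \<longleftrightarrow> ?R") if y: "y \<in> zn n"
  proof
    assume L: ?L
    show ?R
    proof (intro allI impI)
      fix e :: real assume "e > 0"
      then obtain c m where cm: "zn_norm n (zdiff y (zpsum x c m)) < e" using L by blast
      obtain B where "zle n (zdiff y (zpsum x c m)) B" using zn_zle[OF zdiff_zn[OF y zpsum_zn[of x n c m, OF x]]] by blast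
      from zn_norm_less[OF this cm] show "\<exists>c m. zle n (zdiff y (zpsum x c m)) e" by blast
    qed
  next
    assume R: ?R
    show ?L
    proof (intro allI impI)
      fix e :: real assume e: "e > 0"
      then obtain c m where cm: "zle n (zdiff y (zpsum x c m)) (e/2)" using R by (meson half_gt_zero)
      from zn_norm_le[OF this] e have "zn_norm n (zdiff y (zpsum x c m)) < e" by linarith
      thus "\<exists>c m. zn_norm n (zdiff y (zpsum x c m)) < e" by blast
    qed
  qed
  thus ?thesis unfolding zclspan_def by blast
qed

lemma zpsum_cut: "m \<le> m' \<Longrightarrow> zpsum x (\<lambda>i. if i \<le> m then c i else 0) m' = zpsum x c m"
  unfolding zpsum_def fun_eq_iff by (intro allI sum.mono_neutral_cong_right) auto

lemma zclspan_add:
  assumes x: "\<And>i. x i \<in> zn n" and y: "y \<in> zclspan n x" and z: "z \<in> zclspan n x"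
  shows "y + z \<in> zclspan n x"
  unfolding zclspan_iff[OF x]
proof (intro conjI allI impI)
  show "y + z \<in> zn n" using y z zn_add by (auto simp: zclspan_def)
  fix e :: real assume "e > 0"
  hence "e/2 > 0" by simp
  then obtain c m c' m' where c: "zle n (zdiff y (zpsum x c m)) (e/2)" and c': "zle n (zdiff z (zpsum x c' m')) (e/2)"
    using y z unfolding zclspan_iff[OF x] by meson
  define M where "M = max m m'"
  define a where "a = (\<lambda>i. (if i \<le> m then c i else 0) + (if i \<le> m' then c' i else 0))"
  have "zpsum x a M j k = zpsum x (\<lambda>i. if i \<le> m then c i else 0) M j k + zpsum x (\<lambda>i. if i \<le> m' then c' i else 0) M j k" for j k
    unfolding zpsum_def a_def sum.distrib[symmetric] by (simp add: distrib_right)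
  hence s: "zpsum x a M j k = zpsum x c m j k + zpsum x c' m' j k" for j k
    using zpsum_cut[of m M x c] zpsum_cut[of m' M x c'] by (simp add: M_def)
  have "zle n (\<lambda>j k. zdiff y (zpsum x c m) j k + zdiff z (zpsum x c' m') j k) (e/2 + e/2)" by (rule zle_add[OF c c'])
  moreover have "(\<lambda>j k. zdiff y (zpsum x c m) j k + zdiff z (zpsum x c' m') j k) = zdiff (y + z) (zpsum x a M)"
    by (simp add: zdiff_def fun_eq_iff s)
  ultimately show "\<exists>c m. zle n (zdiff (y + z) (zpsum x c m)) e" by auto
qed

lemma zclspan_scale:
  assumes x: "\<And>i. x i \<in> zn n" and y: "y \<in> zclspan n x"
  shows "(\<lambda>j k. c * y j k) \<in> zclspan n x"
  unfolding zclspan_iff[OF x]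
proof (intro conjI allI impI)
  show "(\<lambda>j k. c * y j k) \<in> zn n" using y zn_scale by (auto simp: zclspan_def)
  fix e :: real assume e: "e > 0"
  have "e / (cmod c + 1) > 0" using e by (simp add: add_nonneg_pos)
  then obtain a m where a: "zle n (zdiff y (zpsum x a m)) (e / (cmod c + 1))"
    using y unfolding zclspan_iff[OF x] by meson
  have "zle n (\<lambda>j k. c * zdiff y (zpsum x a m) j k) e"
    by (rule zle_mono[OF zle_scale[OF a]]) (use e in \<open>simp add: divide_le_eq add_nonneg_pos mult.commute mult_left_mono\<close>)
  moreover have "(\<lambda>j k. c * zdiff y (zpsum x a m) j k) = zdiff (\<lambda>j k. c * y j k) (zpsum x (\<lambda>i. c * a i) m)"
    by (simp add: zdiff_def fun_eq_iff zpsum_def right_diff_distrib sum_distrib_left mult.assoc)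
  ultimately show "\<exists>a m. zle n (zdiff (\<lambda>j k. c * y j k) (zpsum x a m)) e" by auto
qed

lemma zclspan_complete:
  assumes x: "\<And>i. x i \<in> zn n" and s: "\<And>i. s i \<in> zclspan n x"
    and cau: "\<And>e. e > 0 \<Longrightarrow> \<exists>M. \<forall>p\<ge>M. \<forall>q\<ge>M. zn_norm n (zdiff (s p) (s q)) < e"
  shows "\<exists>y\<in>zclspan n x. (\<lambda>i. zn_norm n (zdiff y (s i))) \<longlonglongrightarrow> 0"
proof -
  have sz: "s i \<in> zn n" for i using s by (simp add: zclspan_def)
  have "\<exists>m0. \<forall>p\<ge>m0. \<forall>q\<ge>m0. zle n (\<lambda>j k. s p j k - s q j k) e" if e: "e > 0" for e
  proof -
    obtain M where M: "\<And>p q. p \<ge> M \<Longrightarrow> q \<ge> M \<Longrightarrow> zn_norm n (zdiff (s p) (s q)) < e" using cau[OF e] by blast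
    have "zle n (\<lambda>j k. s p j k - s q j k) e" if "p \<ge> M" "q \<ge> M" for p q
    proof -
      obtain B where "zle n (zdiff (s p) (s q)) B" using zn_zle[OF zdiff_zn[OF sz sz]] by blast
      from zn_norm_less[OF this M[OF that]] show ?thesis by (simp add: zdiff_def)
    qed
    thus ?thesis by blast
  qed
  from zle_complete[OF this] obtain y where y0: "\<forall>j\<ge>n. y j = (\<lambda>_. 0)"
    and y: "\<And>e. e > 0 \<Longrightarrow> \<exists>m0. \<forall>p\<ge>m0. zle n (\<lambda>j k. y j k - s p j k) e" by blast
  obtain p where p: "zle n (\<lambda>j k. y j k - s p j k) 1" using y[of 1] by auto
  obtain B where "zle n (s p) B" using zn_zle[OF sz] by blast
  from zle_add[OF p this] have "zle n y (1 + B)" by simp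
  hence yz: "y \<in> zn n" using y0 by (auto simp: zn_iff)
  have "y \<in> zclspan n x" unfolding zclspan_iff[OF x]
  proof (intro conjI allI impI yz)
    fix e :: real assume "e > 0"
    hence e: "e/2 > 0" by simp
    obtain p where p: "zle n (\<lambda>j k. y j k - s p j k) (e/2)" using y[OF e] by auto
    obtain c m where c: "zle n (zdiff (s p) (zpsum x c m)) (e/2)" using s[of p] e unfolding zclspan_iff[OF x] by meson
    have "zle n (zdiff y (zpsum x c m)) e" using zle_add[OF p c] by (simp add: zdiff_def)
    thus "\<exists>c m. zle n (zdiff y (zpsum x c m)) e" by blast
  qed
  moreover have "(\<lambda>i. zn_norm n (zdiff y (s i))) \<longlonglongrightarrow> 0"
    using zn_norm_tendsto_0_iff[of n "\<lambda>i. zdiff y (s i)", OF zn_zle[OF zdiff_zn[OF yz sz]]] y by (simp add: zdiff_def)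
  ultimately show ?thesis by blast
qed

text \<open>The locale applied to the closed span. Its purpose is to exclude a nonzero
  coordinatewise limit of a subsequence.\<close>

lemma basic_seq_tail_zero:
  assumes bs: "basic_seq n x" and norm: "\<And>i. zn_norm n (x i) = 1" and y: "y \<in> zn n"
    and ap: "\<And>p e. e > 0 \<Longrightarrow> \<exists>q a. (\<forall>i<p. a i = 0) \<and> zle n (zdiff y (zpsum x a q)) e"
  shows "y = 0"
proof -
  let ?sc = "\<lambda>c (x::zelem) j k. c * x j k"
  let ?X = "zclspan n x"
  have x: "x i \<in> zn n" for i using bs by (simp add: basic_seq_def)
  have S: "(\<Sum>i\<le>m. ?sc (a i) (x i)) = zpsum x a m" for a m
    by (induction m) (simp_all add: zpsum_def fun_eq_iff)
  have zX: "z \<in> zn n" if "z \<in> ?X" for z using that by (simp add: zclspan_def)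
  interpret V: vector_space ?sc
    by unfold_locales (simp_all add: fun_eq_iff algebra_simps)
  interpret U: unique_expansions ?sc ?X "zn_norm n" x
  proof unfold_locales
    show "V.subspace ?X"
    proof (rule V.subspaceI)
      have "zpsum x (\<lambda>i. 0) 0 = 0" by (simp add: zpsum_def fun_eq_iff)
      hence "zdiff 0 (zpsum x (\<lambda>i. 0) 0) = (\<lambda>j k. 0)" by (simp add: zdiff_def fun_eq_iff)
      hence "zle n (zdiff 0 (zpsum x (\<lambda>i. 0) 0)) e" if "e > 0" for e using that zle_zero[of e n] by simp
      thus "0 \<in> ?X" unfolding zclspan_iff[OF x] using zn_zero by blast
    qed (auto intro: zclspan_add[OF x] zclspan_scale[OF x])
  next
    fix z assume z: "z \<in> ?X"
    obtain B where B: "zle n z B" using zn_zle[OF zX[OF z]] by blast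
    show "0 \<le> zn_norm n z" by (rule zn_norm_nonneg[OF B])
    show "zn_norm n (?sc c z) = cmod c * zn_norm n z" for c by (rule zn_norm_scale[OF B])
    show "z = 0" if "zn_norm n z = 0"
    proof (intro ext)
      fix j k
      show "z j k = 0 j k"
      proof (cases "j < n")
        case True
        thus ?thesis using zn_norm_eq_0[OF B that True] by simp
      next
        case False
        thus ?thesis using zX[OF z] by (simp add: zn_iff)
      qed
    qed
  next
    fix z z' assume "z \<in> ?X" "z' \<in> ?X"
    then obtain B C where "zle n z B" "zle n z' C" using zn_zle zX by meson
    from zn_norm_add[OF this] show "zn_norm n (z + z') \<le> zn_norm n z + zn_norm n z'" by (simp add: plus_fun_def)
  next
    fix s :: "nat \<Rightarrow> zelem" assume "\<And>i. s i \<in> ?X" "\<And>e. e > 0 \<Longrightarrow> \<exists>M. \<forall>p\<ge>M. \<forall>q\<ge>M. zn_norm n (s p - s q) < e"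
    thus "\<exists>y\<in>?X. (\<lambda>i. zn_norm n (y - s i)) \<longlonglongrightarrow> 0"
      unfolding zdiff_eq_minus[symmetric] by (rule zclspan_complete[OF x])
  next
    fix i
    have "zpsum x (\<lambda>l. if l = i then 1 else 0) i = x i"
      by (simp add: zpsum_def fun_eq_iff if_distrib[of "\<lambda>c. c * _"] cong: if_cong)
    hence "zdiff (x i) (zpsum x (\<lambda>l. if l = i then 1 else 0) i) = (\<lambda>j k. 0)" by (simp add: zdiff_def)
    hence "zle n (zdiff (x i) (zpsum x (\<lambda>l. if l = i then 1 else 0) i)) e" if "e > 0" for e
      using that zle_zero[of e n] by simp
    thus "x i \<in> ?X" unfolding zclspan_iff[OF x] using x by blast
    show "zn_norm n (x i) = 1" by (rule norm)
  next
    fix z assume "z \<in> ?X"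
    thus "\<exists>!a. (\<lambda>m. zn_norm n (z - (\<Sum>i\<le>m. ?sc (a i) (x i)))) \<longlonglongrightarrow> 0"
      unfolding S zdiff_eq_minus[symmetric] using bs unfolding basic_seq_def by blast
  qed
  have US: "U.S q a = zpsum x a q" for q a unfolding U.S_def by (rule S)
  show ?thesis
  proof (rule U.tail_intersection_zero)
    show "y \<in> ?X" unfolding zclspan_iff[OF x] using y ap[of _ 0] by blast
    fix p and e :: real assume "e > 0"
    hence "e/2 > 0" by simp
    from ap[OF this] obtain q a where qa: "\<forall>i<p. a i = 0" "zle n (zdiff y (zpsum x a q)) (e/2)" by blast
    have "zn_norm n (y - U.S q a) < e"
      unfolding US zdiff_eq_minus[symmetric] using zn_norm_le[OF qa(2)] \<open>e > 0\<close> by linarith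
    thus "\<exists>q a. (\<forall>i<p. a i = 0) \<and> zn_norm n (y - U.S q a) < e" using qa(1) by blast
  qed
qed

text \<open>The substance is that the limit belongs to the space: its heads are norm limits of heads
  of the \<open>x (r i)\<close>, hence uniformly bounded, and bounded completeness applies.\<close>

lemma coordinatewise_limit:
  assumes x: "\<And>i. x i \<in> zn n" "\<And>i. zle n (x i) C"
  shows "\<exists>r y. strict_mono (r :: nat \<Rightarrow> nat) \<and> y \<in> zn n \<and> (\<forall>j k. (\<lambda>i. x (r i) j k) \<longlonglongrightarrow> y j k)"
proof -
  have C: "C \<ge> 0" using zle_nonneg[OF x(2)] .
  have x0: "x i j k = 0" if "j \<ge> n" for i j k using x(1)[of i] that by (simp add: zn_iff)
  have bd: "norm (x i (fst p) (snd p)) \<le> C * 4 ^ n" for i p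
  proof (cases "fst p < n")
    case True
    have "norm (x i (fst p) (snd p)) \<le> C * 4 ^ fst p" by (rule zle_coord[OF x(2) True])
    also have "\<dots> \<le> C * 4 ^ n" using C True by (intro mult_left_mono power_increasing) auto
    finally show ?thesis .
  qed (use C x0 in simp)
  obtain r :: "nat \<Rightarrow> nat" where r: "strict_mono r" "\<And>p. \<exists>l. (\<lambda>i. x (r i) (fst p) (snd p)) \<longlonglongrightarrow> l"
    using function_convergent_subsequence[of "UNIV :: (nat \<times> nat) set" "\<lambda>i p. x i (fst p) (snd p)" "C * 4 ^ n", OF _ bd] by auto
  define y where "y = (\<lambda>j k. lim (\<lambda>i. x (r i) j k))"
  have y: "(\<lambda>i. x (r i) j k) \<longlonglongrightarrow> y j k" for j k
    using r(2)[of "(j, k)"] unfolding y_def convergent_LIMSEQ_iff[symmetric] convergent_def by simp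
  have y0: "y j k = 0" if "j \<ge> n" for j k
    using y[of j k] x0[OF that] by (simp add: LIMSEQ_const_iff)
  have "zle n (pr {..<N} y) (C + 1)" for N
  proof -
    have "eventually (\<lambda>i. zle n (pr {..<N} (\<lambda>j k. x (r i) j k - y j k)) 1) sequentially"
      using LIM_zero[OF y] by (intro head_null) auto
    then obtain i where "zle n (pr {..<N} (\<lambda>j k. x (r i) j k - y j k)) 1"
      using eventually_happens'[OF sequentially_bot] by blast
    from zle_diff[OF zle_pr[OF x(2)[of "r i"], of "{..<N}"] this]
    have "zle n (\<lambda>j k. pr {..<N} (x (r i)) j k - pr {..<N} (\<lambda>j k. x (r i) j k - y j k) j k) (C + 1)" .
    moreover have "(\<lambda>j k. pr {..<N} (x (r i)) j k - pr {..<N} (\<lambda>j k. x (r i) j k - y j k) j k) = pr {..<N} y"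
      by (auto simp: pr_def fun_eq_iff)
    ultimately show ?thesis by simp
  qed
  hence "zle n y (C + 1 + 1)" by (rule bounded_projections_zle)
  hence "y \<in> zn n" using y0 by (auto simp: zn_iff)
  thus ?thesis using r(1) y by blast
qed

theorem theorem4p4:
  fixes n :: nat and x :: "nat \<Rightarrow> zelem"
  assumes "n \<ge> 1"
    and "basic_seq n x"
    and "\<forall>i. zn_norm n (x i) = 1"
  shows "\<exists>r k. strict_mono r \<and> 1 \<le> k \<and> k \<le> n \<and> equiv_orlicz_basis n (x \<circ> r) (fk k)"
proof -
  have xz: "x i \<in> zn n" for i using assms(2) by (simp add: basic_seq_def)
  have norm: "zn_norm n (x i) = 1" for i using assms(3) by simp
  have x2: "zle n (x i) 2" for i
  proof -
    obtain B where "zle n (x i) B" using zn_zle[OF xz] by blast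
    from zn_norm_less[OF this, of 2] show ?thesis using norm[of i] by simp
  qed
  obtain r0 y where r0: "strict_mono (r0 :: nat \<Rightarrow> nat)" and y: "y \<in> zn n"
    and lim: "\<And>j k. (\<lambda>i. x (r0 i) j k) \<longlonglongrightarrow> y j k"
    using coordinatewise_limit[of x n 2, OF xz x2] by blast
  obtain By where By: "zle n y By" using zn_zle[OF y] by blast
  \<comment> \<open>The limit \<open>y\<close> is not yet known to be 0, so the blocks are extracted
    from the differences.\<close>
  define w where "w = (\<lambda>i j k. x (r0 i) j k - y j k)"
  have wz: "zle n (w i) (2 + By)" for i unfolding w_def by (rule zle_diff[OF x2 By])
  have wn: "(\<lambda>i. w i j k) \<longlonglongrightarrow> 0" for j k unfolding w_def by (rule LIM_zero[OF lim])
  obtain r1 m A g C' d where r1: "strict_mono r1" and b: "blocks n m A g C' d"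
    and err: "\<And>i. zle n (\<lambda>j k. w (r1 i) j k - jet (g i) j k) (2 * (1/2) ^ i)"
    using gliding_hump[of n w "2 + By", OF wz wn] by blast
  define r where "r = r0 \<circ> r1"
  have r: "strict_mono r" unfolding r_def by (rule strict_mono_o[OF r0 r1])
  have "y = 0"
  proof (rule basic_seq_tail_zero[OF assms(2) norm y])
    fix p and e :: real assume e: "e > 0"
    obtain M where M: "M > 0" "zle n (\<lambda>j k. (1 / of_nat M) * (\<Sum>i\<in>{p..<p + M}. w (r1 i) j k)) e"
      using block_averages_null[OF b, of "\<lambda>i. w (r1 i)", OF err e] by blast
    \<comment> \<open>The mean over \<open>p..<p + M\<close> of the subsequence, written as a
      combination of the original sequence; since \<open>r l \<ge> l\<close>, its coefficients below
      \<open>p\<close> vanish.\<close>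
    define a :: "nat \<Rightarrow> complex" where "a = (\<lambda>l. if l \<in> r ` {p..<p + M} then 1 / of_nat M else 0)"
    define q where "q = r (p + M)"
    have inj: "inj_on r {p..<p + M}" using strict_mono_imp_inj_on[OF r] .
    have sub: "r ` {p..<p + M} \<subseteq> {..q}" using strict_mono_less_eq[OF r] by (auto simp: q_def)
    have ps: "zpsum x a q j k = (1 / of_nat M) * (\<Sum>i\<in>{p..<p + M}. x (r i) j k)" for j k
    proof -
      have "zpsum x a q j k = (\<Sum>l\<in>r ` {p..<p + M}. (1 / of_nat M) * x l j k)"
        unfolding zpsum_def by (rule sum.mono_neutral_cong_right) (use sub in \<open>auto simp: a_def\<close>)
      also have "\<dots> = (\<Sum>i\<in>{p..<p + M}. (1 / of_nat M) * x (r i) j k)" by (simp add: sum.reindex[OF inj])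
      finally show ?thesis by (simp add: sum_distrib_left)
    qed
    have eq: "zdiff y (zpsum x a q) = (\<lambda>j k. -1 * ((1 / of_nat M) * (\<Sum>i\<in>{p..<p + M}. w (r1 i) j k)))"
    proof (intro ext)
      fix j k
      have "(\<Sum>i\<in>{p..<p + M}. w (r1 i) j k) = (\<Sum>i\<in>{p..<p + M}. x (r i) j k) - of_nat M * y j k"
        by (simp add: w_def r_def sum_subtractf)
      thus "zdiff y (zpsum x a q) j k = -1 * ((1 / of_nat M) * (\<Sum>i\<in>{p..<p + M}. w (r1 i) j k))"
        unfolding zdiff_def ps using M(1) by (simp add: right_diff_distrib)
    qed
    have "zle n (zdiff y (zpsum x a q)) e" unfolding eq using zle_scale[OF M(2), of "-1"] by simp
    moreover have "a i = 0" if "i < p" for i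
    proof -
      have "i \<noteq> r l" if "l \<ge> p" for l using strict_mono_imp_increasing[OF r, of l] that \<open>i < p\<close> by simp
      hence "i \<notin> r ` {p..<p + M}" by (meson atLeastLessThan_iff imageE)
      thus ?thesis by (simp add: a_def)
    qed
    ultimately show "\<exists>q a. (\<forall>i<p. a i = 0) \<and> zle n (zdiff y (zpsum x a q)) e" by blast
  qed
  hence wx: "w (r1 i) = (x \<circ> r) i" for i by (simp add: w_def r_def fun_eq_iff)
  have err': "zle n (\<lambda>j k. (x \<circ> r) i j k - jet (g i) j k) (2 * (1/2) ^ i)" for i
    using err[of i] unfolding wx .
  have mn: "m < n"
  proof (rule ccontr)
    assume "\<not> m < n"
    hence m: "m = n" using blocksD(1)[OF b] by simp
    \<comment> \<open>With all jets zero, \<open>x (r 2)\<close> would be pure error, of norm at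
      most \<open>2 (1/2)^2 = 1/2\<close>, against norm 1; the index 2 is the first for which the
      error bound is below 1.\<close>
    have "zle n (\<lambda>j k. (x \<circ> r) 2 j k - jet (g 2) j k) (2 * (1/2) ^ 2) = zle n ((x \<circ> r) 2) (2 * (1/2) ^ 2)"
      by (rule zle_cong) (simp add: blocksD(6)[OF b] m)
    hence "zle n (x (r 2)) (2 * (1/2) ^ 2)" using err'[of 2] by simp
    from zn_norm_le[OF this] norm[of "r 2"] show False by (simp add: power2_eq_square)
  qed
  have "equiv_orlicz_basis n (x \<circ> r) (fk (n - m))"
    unfolding equiv_orlicz_basis_def
  proof (intro allI impI)
    fix M d' a assume "orlicz_fun M \<and> 0 < d' \<and> (\<forall>t. 0 \<le> t \<and> t \<le> d' \<longrightarrow> M t = fk (n - m) t)"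
    hence "orlicz_series_conv M a \<longleftrightarrow> a \<longlonglongrightarrow> 0 \<and> summable (\<lambda>i. fk (n - m) (cmod (a i)))"
      by (intro orlicz_series_conv_iff[of M d']) auto
    moreover have "zseries_conv n (x \<circ> r) a \<longleftrightarrow> a \<longlonglongrightarrow> 0 \<and> summable (\<lambda>i. fk (n - m) (cmod (a i)))"
      using xz norm by (intro zseries_conv_iff[OF b mn err']) auto
    ultimately show "zseries_conv n (x \<circ> r) a \<longleftrightarrow> orlicz_series_conv M a" by simp
  qed
  moreover have "1 \<le> n - m" "n - m \<le> n" using mn by auto
  ultimately show ?thesis using r by blast
qed

end
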